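(* Let $k\ge 3$ be an integer with $k\notin\{4,5\}$. There exists $N$ such that for all $n\ge N$ the following holds. If $G\in \mathrm{SPEX}(n,W_{2k+1})$, then $V(G)$ can be partitioned into sets $L$ and $R$ with $|L|=\frac n2+s$, $|R|=\frac n2-s$, where $|s|\le 1$, such that every vertex of $L$ is adjacent to every vertex of $R$, the induced graph $G[L]$ belongs to $\mathcal{U}_{k,n/2+s}$, and $G[R]$ contains exactly one edge.
   Context: $W_t$ is the wheel on $t$ vertices: a vertex joined to all vertices of a cycle on $t-1$ vertices. $\lambda_1(G)$ is the largest adjacency eigenvalue of $G$; $\mathrm{SPEX}(n,F)$ is the family of $n$-vertex graphs not containing $F$ as a subgraph whose $\lambda_1$ is maximum among all such graphs. A graph is nearly $(k-1)$-regular if every vertex but one has degree $k-1$ and the remaining vertex has degree $k-2$. $\mathcal{U}_{k,m}$ is the family of graphs on $m$ vertices that are $(k-1)$-regular or nearly $(k-1)$-regular and contain no path on $2k-1$ vertices. *)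

theory Defs
  imports "Jordan_Normal_Form.Spectral_Radius"
begin

record 'a sgraph =
  verts :: "'a set"
  edges :: "'a set set"

definition simple_graph :: "'a sgraph \<Rightarrow> bool" where
  "simple_graph G \<longleftrightarrow> finite (verts G) \<and> (\<forall>e\<in>edges G. e \<subseteq> verts G \<and> card e = 2)"

definition adjacent :: "'a sgraph \<Rightarrow> 'a \<Rightarrow> 'a \<Rightarrow> bool" where
  "adjacent G u v \<longleftrightarrow> {u, v} \<in> edges G"

definition vdegree :: "'a sgraph \<Rightarrow> 'a \<Rightarrow> nat" where
  "vdegree G v = card {u \<in> verts G. adjacent G v u}"

definition induced :: "'a sgraph \<Rightarrow> 'a set \<Rightarrow> 'a sgraph" where
  "induced G S = \<lparr>verts = S, edges = {e \<in> edges G. e \<subseteq> S}\<rparr>"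

text \<open>Containment as a subgraph that need not be induced.\<close>

definition contains_subgraph :: "'a sgraph \<Rightarrow> 'b sgraph \<Rightarrow> bool" where
  "contains_subgraph G F \<longleftrightarrow>
     (\<exists>f. inj_on f (verts F) \<and> f ` verts F \<subseteq> verts G \<and> (\<forall>e\<in>edges F. f ` e \<in> edges G))"

definition path_graph :: "nat \<Rightarrow> nat sgraph" where
  "path_graph t = \<lparr>verts = {..<t}, edges = {{i, Suc i} | i. Suc i < t}\<rparr>"

text \<open>
  The wheel has \<open>t\<close> vertices in total: the hub is \<open>0\<close> and the rim is the cycle
  \<open>1, 2, \<dots>, t - 1, 1\<close>. This is meaningful for \<open>t \<ge> 4\<close>.
\<close>

definition wheel :: "nat \<Rightarrow> nat sgraph" where
  "wheel t = \<lparr>verts = {..<t},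
     edges = {{0, i} | i. 1 \<le> i \<and> i < t}
           \<union> {{i, Suc i} | i. 1 \<le> i \<and> Suc i < t}
           \<union> {{t - 1, 1}}\<rparr>"

text \<open>
  The adjacency matrix is indexed by the vertex labels, so it is meant for graphs with
  vertex set \<open>{..<n}\<close>. It is real symmetric, so all its eigenvalues are real
  and restricting to real eigenvalues loses nothing.
\<close>

definition adj_mat :: "nat sgraph \<Rightarrow> real mat" where
  "adj_mat G = mat (card (verts G)) (card (verts G)) (\<lambda>(i, j). if adjacent G i j then 1 else 0)"

definition lambda1 :: "nat sgraph \<Rightarrow> real" where
  "lambda1 G = Max (spectrum (adj_mat G))"

text \<open>Graphs on \<open>n\<close> vertices are taken as labelled graphs with vertex set \<open>{..<n}\<close>.\<close>

definition free_graphs :: "nat \<Rightarrow> 'b sgraph \<Rightarrow> nat sgraph set" where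
  "free_graphs n F = {G. simple_graph G \<and> verts G = {..<n} \<and> \<not> contains_subgraph G F}"

definition SPEX :: "nat \<Rightarrow> 'b sgraph \<Rightarrow> nat sgraph set" where
  "SPEX n F = {G \<in> free_graphs n F. \<forall>H\<in>free_graphs n F. lambda1 H \<le> lambda1 G}"

definition regular_graph :: "nat \<Rightarrow> 'a sgraph \<Rightarrow> bool" where
  "regular_graph d G \<longleftrightarrow> (\<forall>v\<in>verts G. vdegree G v = d)"

definition nearly_regular :: "nat \<Rightarrow> 'a sgraph \<Rightarrow> bool" where
  "nearly_regular d G \<longleftrightarrow>
     (\<exists>w\<in>verts G. vdegree G w = d - 1 \<and> (\<forall>v\<in>verts G - {w}. vdegree G v = d))"

definition U_family :: "nat \<Rightarrow> nat \<Rightarrow> 'a sgraph set" where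
  "U_family k m = {G. simple_graph G \<and> card (verts G) = m
     \<and> (regular_graph (k - 1) G \<or> nearly_regular (k - 1) G)
     \<and> \<not> contains_subgraph G (path_graph (2 * k - 1))}"

end

theory Submission
  imports Defs "HOL-Analysis.Function_Topology"
begin

text \<open>
  The argument works directly with the Perron vector \<open>x\<close>, scaled to maximum entry \<open>1\<close> at a vertex \<open>u\<close>.
  Neighbourhoods contain no cycle on \<open>2 k\<close> vertices, hence are sparse, so counting walks of length two
  from \<open>u\<close> bounds \<open>\<lambda>\<^sup>2\<close> by the number of edges between \<open>N(u)\<close> and its complement plus a lower-order
  term; as \<open>\<lambda> > n / 2\<close>, the graph is almost complete bipartite with parts \<open>N(u)\<close> and its complement.
  Joining any single vertex \<open>v\<close> to a whole part instead of to its old neighbours keeps the graph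
  wheel-free, so maximality gives \<open>\<Sum>\<^bsub>w \<in> S\<^esub> x\<^sub>w \<le> \<lambda> x\<^sub>v\<close> for that part \<open>S\<close>. This forces all entries of
  \<open>x\<close> to be \<open>1 - O(1/n)\<close>, all degrees inside the parts to be at most \<open>k - 1\<close>, and each vertex to miss at
  most \<open>k - 1\<close> vertices of the other part.

  Let \<open>a\<close> and \<open>b\<close> be the largest degrees attained by many vertices inside the two parts. The edge count
  gives \<open>a + b \<ge> k - 1\<close>. A cycle on \<open>2 k\<close> vertices in the neighbourhood of a vertex of \<open>L\<close> can alternate
  between its \<open>a\<close> neighbours in \<open>L\<close> and short paths inside \<open>R\<close>; such cycles exclude \<open>a, b \<ge> 1\<close> unless
  \<open>k \<in> {4, 5}\<close> or \<open>k = 3\<close>, \<open>a = b = 1\<close>, and the latter case has too small a \<open>\<lambda>\<close>. So \<open>{a, b} = {0, k - 1}\<close>,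
  and all remaining defects are bounded in number. Evaluating the quadratic form of the
  intended extremal graph at \<open>x\<close> then shows that there are none, and a comparison of
  \<open>\<lambda>\<^sup>2 - (k - 1) \<lambda>\<close> with \<open>|L| |R|\<close> bounds the imbalance.
\<close>

section \<open>Wheels in relations\<close>

text \<open>No competing graph is ever diagonalised. Maximality enters only as a bound on the
  quadratic form of every wheel-free \<open>H\<close> at every vector \<open>y\<close>, so each
  comparison amounts to choosing a graph and a test vector. The obstacle is precision. Spectral
  estimates determine the graph only up to lower-order defects, while the conclusion fixes single
  edges. One edge changes the form by a constant, and replacing entries of the Perron vector by 1
  costs O(1/n) per defect; so the defects must first be bounded in terms of \<open>k\<close> alone.
  That is the purpose of the typical degrees. The values 4 and 5 of \<open>k\<close> escape because
  the cycle argument only yields \<open>a * (t + 1) < 2 * k\<close>, where \<open>t\<close> is the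
  order of the paths supplied by the part of typical degree \<open>b\<close>. For
  \<open>k = 4\<close> the pair (2, 1) with \<open>t = 2\<close>, and for \<open>k = 5\<close> the
  pairs (3, 1) with \<open>t = 2\<close> and (2, 2) with \<open>t = 3\<close>, satisfy this and
  still have sum \<open>k - 1\<close>.\<close>

definition rel_graph :: "'a set \<Rightarrow> ('a \<Rightarrow> 'a \<Rightarrow> bool) \<Rightarrow> bool" where
  "rel_graph V E \<longleftrightarrow> finite V \<and> (\<forall>u v. E u v \<longrightarrow> u \<in> V \<and> v \<in> V \<and> u \<noteq> v \<and> E v u)"

definition nbrs :: "('a \<Rightarrow> 'a \<Rightarrow> bool) \<Rightarrow> 'a set \<Rightarrow> 'a \<Rightarrow> 'a set" where
  "nbrs E S v = {u \<in> S. E v u}"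

definition cyc :: "('a \<Rightarrow> 'a \<Rightarrow> bool) \<Rightarrow> 'a list \<Rightarrow> bool" where
  "cyc E c \<longleftrightarrow> distinct c \<and> successively E c \<and> E (last c) (hd c)"

text \<open>In an irreflexive relation the hub \<open>h\<close> automatically lies off the rim
  \<open>c\<close>, so for a \<open>rel_graph\<close> this excludes exactly the wheel on
  \<open>2 * k + 1\<close> vertices.\<close>

definition wheel_free :: "nat \<Rightarrow> ('a \<Rightarrow> 'a \<Rightarrow> bool) \<Rightarrow> bool" where
  "wheel_free k E \<longleftrightarrow> \<not> (\<exists>h c. length c = 2 * k \<and> cyc E c \<and> (\<forall>v\<in>set c. E h v))"

lemma rel_graphD:
  assumes "rel_graph V E"
  shows "finite V" "E u v \<Longrightarrow> u \<in> V" "E u v \<Longrightarrow> v \<in> V" "\<not> E u u" "E u v \<Longrightarrow> E v u"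
  using assms unfolding rel_graph_def by blast+

lemma rel_graph_sym: "rel_graph V E \<Longrightarrow> E u v \<longleftrightarrow> E v u"
  unfolding rel_graph_def by blast

lemma finite_nbrs [simp]: "finite S \<Longrightarrow> finite (nbrs E S v)"
  unfolding nbrs_def by simp

lemma nbrs_subset: "nbrs E S v \<subseteq> S"
  unfolding nbrs_def by blast

lemma in_nbrs [simp]: "u \<in> nbrs E S v \<longleftrightarrow> u \<in> S \<and> E v u"
  unfolding nbrs_def by blast

lemma successively_cong_set:
  assumes "\<And>a b. a \<in> set c \<Longrightarrow> b \<in> set c \<Longrightarrow> P a b \<Longrightarrow> Q a b" and "successively P c"
  shows "successively Q c"
  using assms(2,1) by (rule successively_mono)

section \<open>Rims assembled from single connecting vertices and path segments\<close>

lemma interleave_path: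
  assumes "length as = length ss" and "\<And>s. s \<in> set ss \<Longrightarrow> s \<noteq> [] \<and> successively E s"
    and "\<And>a v. a \<in> set as \<Longrightarrow> v \<in> set (concat ss) \<Longrightarrow> E a v \<and> E v a"
    and "as \<noteq> []"
  shows "successively E (concat (map2 (#) as ss)) \<and> hd (concat (map2 (#) as ss)) = hd as
    \<and> concat (map2 (#) as ss) \<noteq> [] \<and> last (concat (map2 (#) as ss)) \<in> set (concat ss)"
  using assms
proof (induction as ss rule: list_induct2)
  case Nil
  then show ?case by simp
next
  case (Cons a as s ss)
  have s: "s \<noteq> []" "successively E s" using Cons.prems(1) by auto
  have as: "successively E (a # s)" using s Cons.prems(2)[of a "hd s"] by (simp add: successively_Cons)
  show ?case
  proof (cases "as = []")
    case True
    then show ?thesis using Cons.hyps as s by simp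
  next
    case False
    have IH: "successively E (concat (map2 (#) as ss)) \<and> hd (concat (map2 (#) as ss)) = hd as
      \<and> concat (map2 (#) as ss) \<noteq> [] \<and> last (concat (map2 (#) as ss)) \<in> set (concat ss)"
      by (rule Cons.IH) (use Cons.prems False in auto)
    have "E (last s) (hd as)" using Cons.prems(2)[of "hd as" "last s"] s False by auto
    then have "E (last (a # s)) (hd (concat (map2 (#) as ss)))" using IH s by simp
    then have "successively E ((a # s) @ concat (map2 (#) as ss))"
      unfolding successively_append_iff using IH as by blast
    then show ?thesis using IH s by simp
  qed
qed

lemma interleave_set:
  assumes "length as = length ss"
  shows "mset (concat (map2 (#) as ss)) = mset as + mset (concat ss)"
  using assms by (induction as ss rule: list_induct2) auto

text \<open>All rims against an almost complete bipartite background have this shape: connectors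
  \<open>as\<close>, with no edges assumed among them, separated by segments \<open>ss\<close> to
  which they are completely joined. One connector per segment makes the cycle close, as the last
  segment ends next to \<open>hd as\<close>.\<close>

lemma wheel_from_segments:
  assumes "wheel_free k E"
    and "length as = length ss" and "as \<noteq> []"
    and "distinct as" "distinct (concat ss)" "set as \<inter> set (concat ss) = {}"
    and "\<And>s. s \<in> set ss \<Longrightarrow> s \<noteq> [] \<and> successively E s"
    and "\<And>a v. a \<in> set as \<Longrightarrow> v \<in> set (concat ss) \<Longrightarrow> E a v \<and> E v a"
    and "\<And>v. v \<in> set as \<Longrightarrow> E h v" "\<And>v. v \<in> set (concat ss) \<Longrightarrow> E h v"
    and "length as + length (concat ss) = 2 * k"
  shows False
proof -
  let ?c = "concat (map2 (#) as ss)"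
  note I = interleave_path[of as ss E, OF assms(2,7,8,3)]
  have ms: "mset ?c = mset (as @ concat ss)" using interleave_set[OF assms(2)] by simp
  have "distinct (as @ concat ss)" using assms(4-6) by simp
  then have d: "distinct ?c" using mset_eq_imp_distinct_iff[OF ms] by simp
  have l: "length ?c = 2 * k" using mset_eq_length[OF ms] assms(11) by simp
  have st: "set ?c = set as \<union> set (concat ss)" using mset_eq_setD[OF ms] by simp
  have "E (last ?c) (hd ?c)" using I assms(8)[of "hd as" "last ?c"] assms(3) by simp
  then have "cyc E ?c" using d I unfolding cyc_def by blast
  moreover have "\<forall>v\<in>set ?c. E h v" using st assms(9,10) by blast
  ultimately show False using assms(1) l unfolding wheel_free_def by blast
qed

text \<open>Robust existence: a path on \<open>t\<close> vertices survives the deletion of any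
  \<open>f\<close> vertices. In this form disjoint segments can be chosen greedily, each being
  charged to the budget \<open>f\<close>.\<close>

definition path_supply :: "('a \<Rightarrow> 'a \<Rightarrow> bool) \<Rightarrow> 'a set \<Rightarrow> nat \<Rightarrow> nat \<Rightarrow> bool" where
  "path_supply E R t f \<longleftrightarrow> (\<forall>F. finite F \<and> card F \<le> f \<longrightarrow>
     (\<exists>p. distinct p \<and> length p = t \<and> set p \<subseteq> R - F \<and> successively E p))"

lemma successively_take: "successively P xs \<Longrightarrow> successively P (take n xs)"
  by (metis append_take_drop_id successively_append_iff)

lemma path_supply_segments:
  assumes "path_supply E R t f" and "finite F" and "card F + sum_list lens \<le> f"
    and "\<And>l. l \<in> set lens \<Longrightarrow> 1 \<le> l \<and> l \<le> t"
  shows "\<exists>ss. map length ss = lens \<and> distinct (concat ss) \<and> set (concat ss) \<subseteq> R - F \<and>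
    (\<forall>s\<in>set ss. s \<noteq> [] \<and> successively E s)"
  using assms(2-4)
proof (induction lens arbitrary: F)
  case Nil
  then show ?case by simp
next
  case (Cons l lens)
  have "finite F \<and> card F \<le> f" using Cons.prems(1,2) by simp
  then obtain q where q: "distinct q" "length q = t" "set q \<subseteq> R - F" "successively E q"
    using assms(1)[unfolded path_supply_def, rule_format, of F] by metis
  define p where "p = take l q"
  have p: "distinct p" "length p = l" "set p \<subseteq> R - F" "successively E p"
    using q Cons.prems(3)[of l] set_take_subset[of l q] unfolding p_def
    by (auto intro: successively_take)
  have "card (F \<union> set p) \<le> card F + l" using card_Un_le[of F "set p"] distinct_card[OF p(1)] p(2) by simp
  then have "\<exists>ss. map length ss = lens \<and> distinct (concat ss) \<and> set (concat ss) \<subseteq> R - (F \<union> set p) \<and>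
    (\<forall>s\<in>set ss. s \<noteq> [] \<and> successively E s)"
    using Cons.prems by (intro Cons.IH) auto
  then obtain ss where ss: "map length ss = lens" "distinct (concat ss)"
    "set (concat ss) \<subseteq> R - (F \<union> set p)" "\<forall>s\<in>set ss. s \<noteq> [] \<and> successively E s" by blast
  have "p \<noteq> []" using p(2) Cons.prems(3)[of l] by auto
  moreover have "distinct (concat (p # ss))" using p(1) ss(2,3) by auto
  moreover have "set (concat (p # ss)) \<subseteq> R - F" using p(3) ss(3) by auto
  ultimately have "map length (p # ss) = l # lens \<and> distinct (concat (p # ss)) \<and>
     set (concat (p # ss)) \<subseteq> R - F \<and> (\<forall>s\<in>set (p # ss). s \<noteq> [] \<and> successively E s)"
    using p ss(1,4) by simp
  then show ?case by (rule exI[of _ "p # ss"])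
qed

lemma exists_lengths:
  fixes a t T :: nat
  assumes "a \<le> T" "T \<le> a * t"
  shows "\<exists>lens. length lens = a \<and> sum_list lens = T \<and> (\<forall>l\<in>set lens. 1 \<le> l \<and> l \<le> t)"
  using assms
proof (induction a arbitrary: T)
  case 0
  then show ?case by simp
next
  case (Suc a)
  \<comment> \<open>Take as much as possible while leaving 1 for each of the \<open>a\<close>
    remaining entries.\<close>
  define l where "l = min t (T - a)"
  have t1: "1 \<le> t" using Suc.prems by (cases t) auto
  have l: "1 \<le> l" "l \<le> t" "l \<le> T - a" using t1 Suc.prems unfolding l_def by auto
  have "T - l \<le> a * t"
  proof (cases "t \<le> T - a")
    case True then show ?thesis using Suc.prems unfolding l_def by simp
  next
    case False
    then have "T - l = a" using Suc.prems unfolding l_def by simp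
    then show ?thesis using t1 by simp
  qed
  moreover have "a \<le> T - l" using l Suc.prems by simp
  ultimately obtain lens where "length lens = a" "sum_list lens = T - l" "\<forall>l\<in>set lens. 1 \<le> l \<and> l \<le> t"
    using Suc.IH by blast
  then have "length (l # lens) = Suc a \<and> sum_list (l # lens) = T \<and> (\<forall>l\<in>set (l # lens). 1 \<le> l \<and> l \<le> t)"
    using l by simp
  then show ?case by (rule exI[of _ "l # lens"])
qed

text \<open>With the vertices of \<open>A\<close> as connectors, the other
  \<open>2 * k - card A\<close> rim vertices must split into \<open>card A\<close> segments of 1 to
  \<open>t\<close> vertices. The lower limit is met by \<open>card A \<le> k\<close>, the upper one
  by \<open>2 * k \<le> card A * (t + 1)\<close>. The set \<open>F\<close> collects the vertices of
  \<open>R\<close> that are not joined to everything required.\<close>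

lemma wheel_from_supply:
  assumes "wheel_free k E" and "rel_graph V E"
    and "finite A" "1 \<le> card A" "card A \<le> k" "2 * k \<le> card A * (t + 1)"
    and "path_supply E R t f" "finite F" "card F + 2 * k \<le> f"
    and "\<And>r. r \<in> R - F \<Longrightarrow> E h r" "\<And>a r. a \<in> A \<Longrightarrow> r \<in> R - F \<Longrightarrow> E a r"
    and "\<And>a. a \<in> A \<Longrightarrow> E h a" "A \<inter> R = {}"
  shows False
proof -
  obtain lens where lens: "length lens = card A" "sum_list lens = 2 * k - card A"
    "\<forall>l\<in>set lens. 1 \<le> l \<and> l \<le> t"
    using exists_lengths[of "card A" "2 * k - card A" t] assms(5,6) by fastforce
  have "\<exists>ss. map length ss = lens \<and> distinct (concat ss) \<and> set (concat ss) \<subseteq> R - F \<and>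
    (\<forall>s\<in>set ss. s \<noteq> [] \<and> successively E s)"
    by (rule path_supply_segments[OF assms(7,8)]) (use lens assms(9) in auto)
  then obtain ss where ss: "map length ss = lens" "distinct (concat ss)"
    "set (concat ss) \<subseteq> R - F" "\<forall>s\<in>set ss. s \<noteq> [] \<and> successively E s" by blast
  obtain as where as: "set as = A" "distinct as" using finite_distinct_list[OF assms(3)] by blast
  have la: "length as = card A" using distinct_card[OF as(2)] as(1) by simp
  have ls: "length ss = card A" using ss(1) lens(1) by (metis length_map)
  have lc: "length (concat ss) = 2 * k - card A" using ss(1) lens(2) by (simp add: length_concat)
  show False
  proof (rule wheel_from_segments[OF assms(1), of as ss h])
    show "as \<noteq> []" using la assms(4) by auto
    show "set as \<inter> set (concat ss) = {}" using as(1) assms(13) ss(3) by blast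
    show "E a v \<and> E v a" if "a \<in> set as" "v \<in> set (concat ss)" for a v
    proof -
      have "v \<in> R - F" using that(2) ss(3) by blast
      then have "E a v" using assms(11) that(1) as(1) by blast
      then show ?thesis using rel_graphD(5)[OF assms(2)] by blast
    qed
    show "E h v" if "v \<in> set (concat ss)" for v using that ss(3) assms(10) by blast
  qed (use as la ls lc ss assms in auto)
qed

lemma path_supply_singletons:
  assumes "f < card R" "finite R"
  shows "path_supply E R 1 f"
  unfolding path_supply_def
proof (intro allI impI)
  fix F :: "'a set" assume F: "finite F \<and> card F \<le> f"
  then have "\<not> R \<subseteq> F" using assms card_mono[of F R] by force
  then obtain r where "r \<in> R - F" by blast
  then have "distinct [r] \<and> length [r] = 1 \<and> set [r] \<subseteq> R - F \<and> successively E [r]" by simp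
  then show "\<exists>p. distinct p \<and> length p = 1 \<and> set p \<subseteq> R - F \<and> successively E p" by blast
qed

text \<open>This is the case of one-vertex segments, where the rim alternates between
  \<open>A\<close> and \<open>B\<close>. It drives the approximate part of the argument.\<close>

lemma wheel_from_biclique:
  assumes "wheel_free k E" "rel_graph V E" "1 \<le> k"
    and "finite A" "card A = k" "finite B" "2 * k < card B"
    and "\<And>a b. a \<in> A \<Longrightarrow> b \<in> B \<Longrightarrow> E a b"
    and "\<And>a. a \<in> A \<Longrightarrow> E h a" "\<And>b. b \<in> B \<Longrightarrow> E h b"
  shows False
proof -
  have "A \<inter> B = {}" using assms(8) rel_graphD(4)[OF assms(2)] by blast
  then show False
    using wheel_from_supply[OF assms(1,2,4), of 1 B "2 * k" "{}" h] path_supply_singletons[OF assms(7,6)]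
      assms by auto
qed

section \<open>Replacing the neighbourhood of a single vertex\<close>

definition rejoin :: "('a \<Rightarrow> 'a \<Rightarrow> bool) \<Rightarrow> 'a \<Rightarrow> 'a set \<Rightarrow> 'a \<Rightarrow> 'a \<Rightarrow> bool" where
  "rejoin E v S a b \<longleftrightarrow> (if a = v then b \<in> S else if b = v then a \<in> S else E a b)"

lemma rel_graph_rejoin:
  assumes "rel_graph V E" "S \<subseteq> V" "v \<in> V" "v \<notin> S"
  shows "rel_graph V (rejoin E v S)"
  using assms unfolding rel_graph_def rejoin_def by auto

text \<open>A wheel through the rejoined vertex \<open>v\<close> becomes a wheel of the old graph once \<open>v\<close> is
  replaced by a common neighbour of the wheel vertices in \<open>S\<close>.\<close>

lemma wheel_free_rejoin:
  assumes "wheel_free k E" "rel_graph V E" "v \<notin> S" "1 \<le> k"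
    and sub: "\<And>W F. W \<subseteq> S \<Longrightarrow> finite W \<Longrightarrow> card W \<le> 2 * k + 1 \<Longrightarrow> finite F \<Longrightarrow> card F \<le> 2 * k + 1
      \<Longrightarrow> \<exists>v'. v' \<notin> F \<and> (\<forall>w\<in>W. E v' w)"
  shows "wheel_free k (rejoin E v S)"
  unfolding wheel_free_def
proof
  assume "\<exists>h c. length c = 2 * k \<and> cyc (rejoin E v S) c \<and> (\<forall>u\<in>set c. rejoin E v S h u)"
  then obtain h c where c: "length c = 2 * k" "cyc (rejoin E v S) c" "\<forall>u\<in>set c. rejoin E v S h u" by blast
  have c0: "c \<noteq> []" using c(1) assms(4) by auto
  define X where "X = insert h (set c)"
  have cX: "card X \<le> 2 * k + 1" "finite X" unfolding X_def
    using card_length[of c] card_insert_le_m1[of _ "set c" h] c(1) by (auto simp: card_insert_if)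
  have "card (X \<inter> S) \<le> 2 * k + 1" using cX card_mono[of X "X \<inter> S"] by simp
  \<comment> \<open>Avoiding the hub and the whole rim keeps the substitution \<open>g\<close>
    injective.\<close>
  then obtain v' where v': "v' \<notin> X" "\<forall>w\<in>X \<inter> S. E v' w" using sub[of "X \<inter> S" X] cX by auto
  define g where "g z = (if z = v then v' else z)" for z
  have gE: "E (g a) (g b)" if "a \<in> X" "b \<in> X" and r: "rejoin E v S a b" for a b
  proof -
    consider "a = v" "b \<noteq> v" "b \<in> S" | "b = v" "a \<noteq> v" "a \<in> S" | "a \<noteq> v" "b \<noteq> v" "E a b"
      using r assms(3) unfolding rejoin_def by (cases "a = v"; cases "b = v") auto
    then show ?thesis
    proof cases
      case 1
      then show ?thesis using v'(2) that(2) unfolding g_def by simp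
    next
      case 2
      then have "E v' a" using v'(2) that(1) by simp
      then show ?thesis using 2 rel_graphD(5)[OF assms(2)] unfolding g_def by simp
    next
      case 3
      then show ?thesis unfolding g_def by simp
    qed
  qed
  have inj: "inj_on g (set c)" using v'(1) unfolding inj_on_def g_def X_def by auto
  have sc: "set c \<subseteq> X" unfolding X_def by blast
  have "distinct (map g c)" using c(2) inj unfolding cyc_def by (simp add: distinct_map)
  moreover have "successively E (map g c)"
    unfolding successively_map using c(2) sc gE
    by (auto simp: cyc_def intro!: successively_cong_set[where P = "rejoin E v S"])
  moreover have "E (last (map g c)) (hd (map g c))"
  proof -
    have "last c \<in> X" "hd c \<in> X" using c0 sc by auto
    then show ?thesis using c0 c(2) gE[of "last c" "hd c"] unfolding cyc_def by (simp add: last_map hd_map)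
  qed
  moreover have "\<forall>u\<in>set (map g c). E (g h) u" using c(3) gE[of h] unfolding X_def by auto
  ultimately have "cyc E (map g c) \<and> (\<forall>u\<in>set (map g c). E (g h) u) \<and> length (map g c) = 2 * k"
    using c(1) unfolding cyc_def by auto
  then show False using assms(1) unfolding wheel_free_def by blast
qed

section \<open>Almost regular graphs without long paths\<close>

text \<open>Here \<open>d\<close> bounds the degrees, \<open>t\<close> is the order of the forbidden
  path, and \<open>e\<close> is the allowed total shortfall of the degree sum from
  \<open>d * card W\<close>. For \<open>e = 1\<close> the degree conditions describe the regular and
  the nearly regular graphs; a total shortfall has the advantage of adding up under disjoint
  unions.\<close>

definition deg_graph :: "nat \<Rightarrow> nat \<Rightarrow> nat \<Rightarrow> 'a set \<Rightarrow> ('a \<Rightarrow> 'a \<Rightarrow> bool) \<Rightarrow> bool" where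
  "deg_graph d t e W U \<longleftrightarrow> rel_graph W U \<and> (\<forall>v\<in>W. card (nbrs U W v) \<le> d) \<and>
     d * card W \<le> (\<Sum>v\<in>W. card (nbrs U W v)) + e \<and>
     \<not> (\<exists>p. distinct p \<and> length p = t \<and> successively U p)"

text \<open>The argument \<open>T\<close> only fixes the vertex type, which the numerical parameters
  do not determine.\<close>

definition deg_size :: "nat \<Rightarrow> nat \<Rightarrow> nat \<Rightarrow> 'a itself \<Rightarrow> nat \<Rightarrow> bool" where
  "deg_size d t e T m \<longleftrightarrow> (\<forall>W::'a set. finite W \<and> card W = m \<longrightarrow> (\<exists>U. deg_graph d t e W U))"

lemma successively_disjoint_union:
  assumes "rel_graph W1 U1" "rel_graph W2 U2" "W1 \<inter> W2 = {}"
    and "successively (\<lambda>a b. U1 a b \<or> U2 a b) p"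
  shows "successively U1 p \<or> successively U2 p"
  using assms(4)
proof (induction p rule: induct_list012)
  case (3 x y zs)
  note W = rel_graphD(2,3)[OF assms(1)] rel_graphD(2,3)[OF assms(2)]
  have IH: "successively U1 (y # zs) \<or> successively U2 (y # zs)" using 3 by simp
  show ?case
  proof (cases zs)
    case Nil
    then show ?thesis using 3 by auto
  next
    case (Cons z ws)
    consider "U1 x y" | "U2 x y" using 3 by auto
    then show ?thesis
    proof cases
      case 1
      then have "\<not> U2 y z" using W(2)[of x y] W(3)[of y z] assms(3) by blast
      then show ?thesis using 1 IH Cons by auto
    next
      case 2
      then have "\<not> U1 y z" using W(1)[of y z] W(4)[of x y] assms(3) by blast
      then show ?thesis using 2 IH Cons by auto
    qed
  qed
qed auto

lemma deg_graph_union: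
  assumes "deg_graph d t e1 W1 U1" "deg_graph d t e2 W2 U2" "W1 \<inter> W2 = {}"
  shows "deg_graph d t (e1 + e2) (W1 \<union> W2) (\<lambda>a b. U1 a b \<or> U2 a b)"
proof -
  let ?U = "\<lambda>a b. U1 a b \<or> U2 a b"
  have r: "rel_graph W1 U1" "rel_graph W2 U2" using assms unfolding deg_graph_def by auto
  note W = rel_graphD(1,2,3)[OF r(1)] rel_graphD(1,2,3)[OF r(2)]
  have rg: "rel_graph (W1 \<union> W2) ?U" using r unfolding rel_graph_def by blast
  have n1: "nbrs ?U (W1 \<union> W2) v = nbrs U1 W1 v" if "v \<in> W1" for v
    using that W assms(3) unfolding nbrs_def by blast
  have n2: "nbrs ?U (W1 \<union> W2) v = nbrs U2 W2 v" if "v \<in> W2" for v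
    using that W assms(3) unfolding nbrs_def by blast
  have "(\<Sum>v\<in>W1 \<union> W2. card (nbrs ?U (W1 \<union> W2) v)) =
      (\<Sum>v\<in>W1. card (nbrs U1 W1 v)) + (\<Sum>v\<in>W2. card (nbrs U2 W2 v))"
    by (subst sum.union_disjoint) (use W assms(3) n1 n2 in auto)
  moreover have "card (W1 \<union> W2) = card W1 + card W2" using W assms(3) by (simp add: card_Un_disjoint)
  moreover have "d * card W1 \<le> (\<Sum>v\<in>W1. card (nbrs U1 W1 v)) + e1"
    "d * card W2 \<le> (\<Sum>v\<in>W2. card (nbrs U2 W2 v)) + e2"
    using assms unfolding deg_graph_def by auto
  ultimately have s: "d * card (W1 \<union> W2) \<le> (\<Sum>v\<in>W1 \<union> W2. card (nbrs ?U (W1 \<union> W2) v)) + (e1 + e2)"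
    by (simp add: algebra_simps)
  have m: "\<forall>v\<in>W1 \<union> W2. card (nbrs ?U (W1 \<union> W2) v) \<le> d"
    using n1 n2 assms(1,2) unfolding deg_graph_def by auto
  have "\<not> (\<exists>p. distinct p \<and> length p = t \<and> successively ?U p)"
    using successively_disjoint_union[OF r assms(3)] assms(1,2) unfolding deg_graph_def by blast
  then show ?thesis using rg s m unfolding deg_graph_def by blast
qed

lemma deg_size_add:
  assumes "deg_size d t e1 T m1" "deg_size d t e2 T m2"
  shows "deg_size d t (e1 + e2) T (m1 + m2)"
  unfolding deg_size_def
proof (intro allI impI)
  fix W :: "'a set" assume W: "finite W \<and> card W = m1 + m2"
  then obtain W1 where W1: "W1 \<subseteq> W" "card W1 = m1" "finite W1"
    using obtain_subset_with_card_n[of m1 W] by auto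
  have "card (W - W1) = m2" "finite (W - W1)" using W W1 by (auto simp: card_Diff_subset)
  then obtain U1 U2 where "deg_graph d t e1 W1 U1" "deg_graph d t e2 (W - W1) U2"
    using assms W1 unfolding deg_size_def by blast
  from deg_graph_union[OF this] W1 show "\<exists>U. deg_graph d t (e1 + e2) W U"
    by (auto simp: Un_absorb1)
qed

lemma deg_size_0:
  assumes "1 < t"
  shows "deg_size d t 0 T 0"
  unfolding deg_size_def
proof (intro allI impI)
  fix W :: "'a set" assume W: "finite W \<and> card W = 0"
  have "\<not> (\<exists>p::'a list. distinct p \<and> length p = t \<and> successively (\<lambda>_ _. False) p)"
  proof
    assume "\<exists>p::'a list. distinct p \<and> length p = t \<and> successively (\<lambda>_ _. False) p"
    then obtain p :: "'a list" where "length p = t" "successively (\<lambda>_ _. False) p" by blast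
    then show False using assms by (cases p; cases "tl p") auto
  qed
  then have "deg_graph d t 0 W (\<lambda>_ _. False)" using W unfolding deg_graph_def rel_graph_def by auto
  then show "\<exists>U. deg_graph d t 0 W U" by blast
qed

lemma deg_size_mult:
  assumes "deg_size d t 0 T m" "1 < t"
  shows "deg_size d t 0 T (a * m)"
proof (induction a)
  case (Suc a)
  then show ?case using deg_size_add[OF assms(1) Suc] by simp
qed (use deg_size_0 assms(2) in auto)

text \<open>Building blocks are given on \<open>{..<m}\<close> by an arithmetic relation and carried
  to \<open>W\<close> along a bijection. They have fewer than \<open>t\<close> vertices, which
  leaves no room for the forbidden path.\<close>

lemma deg_size_base:
  assumes "\<And>i j. R i j \<Longrightarrow> i \<noteq> j \<and> R j i"
    and "\<And>i. i < m \<Longrightarrow> card {j. j < m \<and> R i j} \<le> d"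
    and "d * m \<le> (\<Sum>i<m. card {j. j < m \<and> R i j}) + e" and "m < t" "1 < t"
  shows "deg_size d t e T m"
  unfolding deg_size_def
proof (intro allI impI)
  fix W :: "'a set" assume W: "finite W \<and> card W = m"
  then obtain f where f: "bij_betw f W {..<m}"
    by (metis bij_betw_iff_card card_lessThan finite_lessThan)
  define U where "U u v \<longleftrightarrow> u \<in> W \<and> v \<in> W \<and> R (f u) (f v)" for u v
  have rg: "rel_graph W U" using W assms(1) unfolding rel_graph_def U_def by blast
  have nb: "card (nbrs U W u) = card {j. j < m \<and> R (f u) j}" if "u \<in> W" for u
  proof -
    have "bij_betw f (nbrs U W u) {j. j < m \<and> R (f u) j}"
      using f that unfolding bij_betw_def U_def nbrs_def inj_on_def by auto
    then show ?thesis by (rule bij_betw_same_card)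
  qed
  have fl: "f u < m" if "u \<in> W" for u using f that unfolding bij_betw_def by auto
  have "(\<Sum>u\<in>W. card (nbrs U W u)) = (\<Sum>u\<in>W. card {j. j < m \<and> R (f u) j})" using nb by simp
  also have "\<dots> = (\<Sum>i<m. card {j. j < m \<and> R i j})" using f by (rule sum.reindex_bij_betw)
  finally have s: "d * card W \<le> (\<Sum>u\<in>W. card (nbrs U W u)) + e" using assms(3) W by simp
  have "\<not> (\<exists>p. distinct p \<and> length p = t \<and> successively U p)"
  proof
    assume "\<exists>p. distinct p \<and> length p = t \<and> successively U p"
    then obtain p where p: "distinct p" "length p = t" "successively U p" by blast
    \<comment> \<open>As \<open>1 < t\<close>, every vertex of the path lies on an edge of
      \<open>U\<close>, and such edges stay inside \<open>W\<close>.\<close>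
    have "set p \<subseteq> W"
    proof
      fix x assume "x \<in> set p"
      then obtain i where i: "i < t" "x = p ! i" using p(2) by (metis in_set_conv_nth)
      show "x \<in> W"
      proof (cases "Suc i < t")
        case True
        then show ?thesis using successively_nth[OF p(3), of i] p(2) i unfolding U_def by simp
      next
        case False
        then have "Suc (i - 1) = i" using i assms(5) by simp
        then show ?thesis using successively_nth[OF p(3), of "i - 1"] p(2) i unfolding U_def by simp
      qed
    qed
    then have "t \<le> m" using distinct_card[OF p(1)] p(2) card_mono[of W "set p"] W by simp
    then show False using assms(4) by simp
  qed
  moreover have "\<forall>u\<in>W. card (nbrs U W u) \<le> d" using nb fl assms(2) by simp
  ultimately have "deg_graph d t e W U" using rg s unfolding deg_graph_def by blast
  then show "\<exists>U. deg_graph d t e W U" by blast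
qed

text \<open>The block is the complete graph on \<open>k\<close> vertices.\<close>

lemma deg_size_complete: "3 \<le> k \<Longrightarrow> deg_size (k - 1) (2 * k - 1) 0 T k"
proof (rule deg_size_base[where R = "\<lambda>i j. i \<noteq> j"])
  assume k: "3 \<le> k"
  have c: "card {j. j < k \<and> i \<noteq> j} = k - 1" if "i < k" for i
  proof -
    have "{j. j < k \<and> i \<noteq> j} = {..<k} - {i}" by auto
    then show ?thesis using that by simp
  qed
  show "card {j. j < k \<and> i \<noteq> j} \<le> k - 1" if "i < k" for i using c[OF that] by simp
  show "(k - 1) * k \<le> (\<Sum>i<k. card {j. j < k \<and> i \<noteq> j}) + 0" using c by simp
qed auto

text \<open>The block is complete bipartite with the two parity classes of size \<open>k - 1\<close>
  as sides; its order is one too small for the forbidden path.\<close>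

lemma deg_size_bipartite: "3 \<le> k \<Longrightarrow> deg_size (k - 1) (2 * k - 1) 0 T (2 * k - 2)"
proof (rule deg_size_base[where R = "\<lambda>i j. i mod 2 \<noteq> j mod 2"])
  assume k: "3 \<le> k"
  have c: "card {j. j < 2 * k - 2 \<and> i mod 2 \<noteq> j mod 2} = k - 1" for i
  proof -
    have "bij_betw (\<lambda>q. 2 * q + (1 - i mod 2)) {..<k - 1} {j. j < 2 * k - 2 \<and> i mod 2 \<noteq> j mod 2}"
    proof (rule bij_betw_byWitness[where f' = "\<lambda>j. j div 2"])
      show "\<forall>q\<in>{..<k - 1}. (2 * q + (1 - i mod 2)) div 2 = q" by auto
      show "\<forall>j\<in>{j. j < 2 * k - 2 \<and> i mod 2 \<noteq> j mod 2}. 2 * (j div 2) + (1 - i mod 2) = j"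
      proof
        fix j assume "j \<in> {j. j < 2 * k - 2 \<and> i mod 2 \<noteq> j mod 2}"
        then have "1 - i mod 2 = j mod 2" by (simp add: mod2_eq_if split: if_splits)
        then show "2 * (j div 2) + (1 - i mod 2) = j" by simp
      qed
      show "(\<lambda>q. 2 * q + (1 - i mod 2)) ` {..<k - 1} \<subseteq> {j. j < 2 * k - 2 \<and> i mod 2 \<noteq> j mod 2}"
      proof
        fix j assume "j \<in> (\<lambda>q. 2 * q + (1 - i mod 2)) ` {..<k - 1}"
        then obtain q where q: "q < k - 1" "j = 2 * q + (1 - i mod 2)" by auto
        have "j mod 2 = (1 - i mod 2) mod 2" unfolding q(2) by (rule mod_mult_self4)
        then have "i mod 2 \<noteq> j mod 2" by (cases "even i") (simp_all add: mod2_eq_if)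
        moreover have "j < 2 * k - 2" using q by linarith
        ultimately show "j \<in> {j. j < 2 * k - 2 \<and> i mod 2 \<noteq> j mod 2}" by simp
      qed
      show "(\<lambda>j. j div 2) ` {j. j < 2 * k - 2 \<and> i mod 2 \<noteq> j mod 2} \<subseteq> {..<k - 1}" by auto
    qed
    from bij_betw_same_card[OF this] show ?thesis by simp
  qed
  show "card {j. j < 2 * k - 2 \<and> i mod 2 \<noteq> j mod 2} \<le> k - 1" for i using c by simp
  show "(k - 1) * (2 * k - 2) \<le> (\<Sum>i<2 * k - 2. card {j. j < 2 * k - 2 \<and> i mod 2 \<noteq> j mod 2}) + 0"
    using c by simp
qed auto

text \<open>The complement of this graph is a path on three vertices together with a perfect matching
  of the other vertices.\<close>

lemma deg_size_odd:
  assumes k: "3 \<le> k" "even k"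
  shows "deg_size (k - 1) (2 * k - 1) 1 T (k + 1)"
proof (rule deg_size_base[where R = "\<lambda>i j. i div 2 \<noteq> j div 2 \<and> {i, j} \<noteq> {0, k}"])
  let ?R = "\<lambda>i j. i div 2 \<noteq> j div 2 \<and> {i, j} \<noteq> {0::nat, k}"
  have c0: "card {j. j < k + 1 \<and> ?R 0 j} = k - 2"
  proof -
    have "{j. j < k + 1 \<and> ?R 0 j} = {..<k + 1} - {0, 1, k}" using k by (auto simp: doubleton_eq_iff)
    moreover have "card {0, 1, k} = 3" using k by auto
    moreover have "{0, 1, k} \<subseteq> {..<k + 1}" using k by auto
    ultimately show ?thesis using card_Diff_subset[of "{0, 1, k}" "{..<k + 1}"] by simp
  qed
  have c: "card {j. j < k + 1 \<and> ?R i j} = k - 1" if i: "i < k + 1" "i \<noteq> 0" for i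
  proof -
    define i' where "i' = (if i = k then 0 else if even i then i + 1 else i - 1)"
    have i': "i' \<noteq> i" "i' < k + 1" using i k unfolding i'_def by auto
    have R: "?R i j \<longleftrightarrow> j \<notin> {i, i'}" if "j < k + 1" for j
    proof (cases "i = k")
      case True
      then show ?thesis using that k unfolding i'_def by (auto simp: doubleton_eq_iff)
    next
      case False
      have "i div 2 = j div 2 \<longleftrightarrow> j = i \<or> j = (if even i then i + 1 else i - 1)" by presburger
      then show ?thesis using False i unfolding i'_def by (auto simp: doubleton_eq_iff)
    qed
    have "{j. j < k + 1 \<and> ?R i j} = {j. j < k + 1 \<and> j \<notin> {i, i'}}"
      by (intro Collect_cong conj_cong refl R)
    also have "\<dots> = {..<k + 1} - {i, i'}" by auto
    finally have "{j. j < k + 1 \<and> ?R i j} = {..<k + 1} - {i, i'}" .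
    moreover have "{i, i'} \<subseteq> {..<k + 1}" using i' i by auto
    ultimately show ?thesis using card_Diff_subset[of "{i, i'}" "{..<k + 1}"] i' by simp
  qed
  show "card {j. j < k + 1 \<and> ?R i j} \<le> k - 1" if "i < k + 1" for i
    using c0 c[OF that] by (cases "i = 0") auto
  have "(\<Sum>i<k + 1. card {j. j < k + 1 \<and> ?R i j})
      = (\<Sum>i\<in>{..<k + 1} - {0}. card {j. j < k + 1 \<and> ?R i j}) + card {j. j < k + 1 \<and> ?R 0 j}"
    by (subst sum.remove[of _ 0]) auto
  also have "(\<Sum>i\<in>{..<k + 1} - {0}. card {j. j < k + 1 \<and> ?R i j}) = (\<Sum>i\<in>{..<k + 1} - {0}. k - 1)"
    by (rule sum.cong) (use c in auto)
  also have "\<dots> = k * (k - 1)" by simp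
  finally show "(k - 1) * (k + 1) \<le> (\<Sum>i<k + 1. card {j. j < k + 1 \<and> ?R i j}) + 1"
    unfolding c0 using k(1) by (auto simp: algebra_simps)
qed (use k in \<open>auto simp: insert_commute\<close>)

text \<open>Blocks of orders \<open>k\<close> and \<open>2 * k - 2\<close> are combined. Modulo
  \<open>k\<close> the second order is -2, so \<open>b\<close> such blocks work as soon as
  \<open>k\<close> divides \<open>m + 2 * b\<close>. The parity assumption provides such a
  \<open>b \<le> k\<close>, and the lower bound on \<open>m\<close> leaves room for \<open>b\<close>
  blocks.\<close>

lemma deg_size_parity:
  assumes k: "3 \<le> k" and "odd k \<or> even m" and m: "k * (2 * k - 2) \<le> m"
  shows "deg_size (k - 1) (2 * k - 1) 0 T m"
proof -
  define r where "r = m mod k"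
  have rk: "r < k" unfolding r_def using k by simp
  obtain b where b: "b \<le> k" "k dvd m + 2 * b"
  proof (cases "even (k - r)")
    case True
    then have "2 * ((k - r) div 2) = k - r" by simp
    then have "m + 2 * ((k - r) div 2) = (m div k) * k + k" using rk unfolding r_def
      by (metis add.assoc div_mult_mod_eq le_add_diff_inverse less_imp_le)
    then show ?thesis using that[of "(k - r) div 2"] by auto
  next
    case False
    then have "odd k"
    proof (cases "odd k")
      case False
      then have "even m" using assms(2) by simp
      then have "even r" unfolding r_def using False by (simp add: dvd_mod)
      then show ?thesis using \<open>odd (k - r)\<close> False rk by simp
    qed
    then have "even (2 * k - r)" using False rk by auto
    then have "2 * ((2 * k - r) div 2) = 2 * k - r" by simp
    then have "m + 2 * ((2 * k - r) div 2) = (m div k) * k + 2 * k" using rk div_mult_mod_eq[of m k] unfolding r_def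
      by linarith
    then have "k dvd m + 2 * ((2 * k - r) div 2)" by simp
    moreover have "(2 * k - r) div 2 \<le> k" by simp
    ultimately show ?thesis using that by blast
  qed
  have le: "b * (2 * k - 2) \<le> m" using b(1) m by (meson le_trans mult_le_mono1)
  have "b * (2 * k - 2) + 2 * b = b * 2 * k" using k by (auto simp: algebra_simps diff_mult_distrib2)
  then have "m - b * (2 * k - 2) = (m + 2 * b) - b * 2 * k" using le by linarith
  then have "k dvd m - b * (2 * k - 2)" using b(2) by (simp add: dvd_diff_nat)
  then obtain a where a: "m - b * (2 * k - 2) = a * k" by (metis dvd_def mult.commute)
  have t: "1 < 2 * k - 1" using k by simp
  have "deg_size (k - 1) (2 * k - 1) (0 + 0) T (a * k + b * (2 * k - 2))"
    by (intro deg_size_add deg_size_mult deg_size_complete deg_size_bipartite k t)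
  moreover have "a * k + b * (2 * k - 2) = m" using a le by linarith
  ultimately show ?thesis by simp
qed

lemma deg_graph_mono: "deg_graph d t e W U \<Longrightarrow> e \<le> e' \<Longrightarrow> deg_graph d t e' W U"
  unfolding deg_graph_def by auto

text \<open>What remains is even \<open>k\<close> with odd \<open>m\<close>, where a regular graph
  of the odd degree \<open>k - 1\<close> cannot exist. A single block of odd order with shortfall 1
  repairs the parity.\<close>

lemma deg_size_large:
  assumes k: "3 \<le> k" and m: "k * (2 * k - 2) + k + 1 \<le> m"
  shows "deg_size (k - 1) (2 * k - 1) 1 T m"
proof (cases "odd k \<or> even m")
  case True
  then show ?thesis using deg_size_parity[OF k, of m T] m deg_graph_mono unfolding deg_size_def
    by (metis add_leD1 zero_le)
next
  case False
  then have "odd k \<or> even (m - (k + 1))" using m by auto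
  then have "deg_size (k - 1) (2 * k - 1) (0 + 1) T ((m - (k + 1)) + (k + 1))"
    using k m False by (intro deg_size_add deg_size_parity deg_size_odd) auto
  then show ?thesis using m by simp
qed

section \<open>The candidate extremal graphs\<close>

lemma cyc_rotate:
  assumes "cyc E (p @ q)" "q \<noteq> []"
  shows "cyc E (q @ p)"
  using assms unfolding cyc_def successively_append_iff by (cases "p = []") auto

lemma cyc_rotate_to:
  assumes "cyc E c" "w \<in> set c"
  obtains c' where "cyc E (w # c')" "set (w # c') = set c" "length (w # c') = length c"
proof -
  obtain p q where "c = p @ w # q" using assms(2) by (meson split_list)
  then have "cyc E ((w # q) @ p)" using cyc_rotate[of E p "w # q"] assms(1) by simp
  then have "cyc E (w # (q @ p))" by simp
  moreover have "set (w # (q @ p)) = set c" "length (w # (q @ p)) = length c" using \<open>c = p @ w # q\<close> by auto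
  ultimately show ?thesis using that by blast
qed

text \<open>Between consecutive vertices of \<open>R\<close> there is a vertex outside \<open>R\<close>, except at the single
  edge inside \<open>R\<close>.\<close>

lemma path_one_edge_count:
  assumes "\<And>u v. H u v \<Longrightarrow> u \<in> R \<Longrightarrow> v \<in> R \<Longrightarrow> {u, v} = {r1, r2}"
    and "distinct c" "successively H c"
  shows "length (filter (\<lambda>v. v \<in> R) c) \<le> length (filter (\<lambda>v. v \<notin> R) c)
    + (if r1 \<in> set c \<and> r2 \<in> set c then 1 else 0) + (if c \<noteq> [] \<and> hd c \<in> R then 1 else 0)"
  using assms(2,3)
proof (induction c rule: induct_list012)
  case (3 x y zs)
  have IH: "length (filter (\<lambda>v. v \<in> R) (y # zs)) \<le> length (filter (\<lambda>v. v \<notin> R) (y # zs))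
    + (if r1 \<in> set (y # zs) \<and> r2 \<in> set (y # zs) then 1 else 0) + (if y \<in> R then 1 else 0)"
    using 3 by simp
  show ?case
  proof (cases "x \<in> R")
    case x: True
    show ?thesis
    proof (cases "y \<in> R")
      case True
      then have e: "{x, y} = {r1, r2}" using assms(1)[of x y] 3 x by simp
      have "x \<notin> set (y # zs)" using 3 by simp
      then have n: "(r1 \<in> set (y # zs) \<and> r2 \<in> set (y # zs)) = False" using e by (metis insert_iff singletonD)
      have "length (filter (\<lambda>v. v \<in> R) (y # zs)) \<le> length (filter (\<lambda>v. v \<notin> R) (y # zs)) + 1"
        using IH True unfolding n by simp
      moreover have "r1 \<in> set (x # y # zs)" "r2 \<in> set (x # y # zs)" using e
        by (metis insert_iff list.simps(15) singletonD)+
      ultimately show ?thesis using x True by simp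
    next
      case False
      then show ?thesis using IH x by (auto split: if_splits)
    qed
  next
    case False
    then show ?thesis using IH by (auto split: if_splits)
  qed
qed auto

definition join_graph :: "'a set \<Rightarrow> 'a set \<Rightarrow> ('a \<Rightarrow> 'a \<Rightarrow> bool) \<Rightarrow> 'a \<Rightarrow> 'a \<Rightarrow> 'a \<Rightarrow> 'a \<Rightarrow> bool" where
  "join_graph L R U r1 r2 a b \<longleftrightarrow>
     U a b \<or> (a \<in> L \<and> b \<in> R) \<or> (a \<in> R \<and> b \<in> L) \<or> {a, b} = {r1, r2}"

text \<open>The position of the hub decides. If it lies in \<open>R\<close>, all rim vertices but at
  most one lie in \<open>L\<close>, and dropping one vertex leaves a path on
  \<open>2 * k - 1\<close> vertices in \<open>L\<close>. If it lies in \<open>L\<close>, the rim has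
  at most \<open>k - 1\<close> vertices outside \<open>R\<close>, and the single edge inside
  \<open>R\<close> allows only one more vertex inside \<open>R\<close> than outside.\<close>

lemma wheel_free_join_graph:
  assumes k: "3 \<le> k" and U: "deg_graph (k - 1) (2 * k - 1) e L U"
    and LR: "finite R" "L \<inter> R = {}" "r1 \<in> R" "r2 \<in> R" "r1 \<noteq> r2"
  shows "wheel_free k (join_graph L R U r1 r2)"
  unfolding wheel_free_def
proof
  let ?H = "join_graph L R U r1 r2"
  have rU: "rel_graph L U" using U unfolding deg_graph_def by blast
  note UL = rel_graphD[OF rU]
  have HR: "{u, v} = {r1, r2}" if "?H u v" "u \<in> R" "v \<in> R" for u v
    using that UL LR unfolding join_graph_def by blast
  have HL: "?H u v \<longleftrightarrow> U u v" if "u \<in> L" "v \<in> L" for u v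
  proof -
    have "u \<noteq> r1" "u \<noteq> r2" using that LR by auto
    then have "{u, v} \<noteq> {r1, r2}" by auto
    then show ?thesis using that LR(2) unfolding join_graph_def by blast
  qed
  assume "\<exists>h c. length c = 2 * k \<and> cyc ?H c \<and> (\<forall>v\<in>set c. ?H h v)"
  then obtain h c where c: "length c = 2 * k" "cyc ?H c" "\<forall>v\<in>set c. ?H h v" by blast
  have c0: "c \<noteq> []" using c(1) k by auto
  have "?H h (hd c)" using c(3) c0 by simp
  then have h: "h \<in> L \<or> h \<in> R" unfolding join_graph_def using UL LR by (auto simp: doubleton_eq_iff)
  show False
  proof (cases "h \<in> R")
    case True
    have cL: "v \<in> L \<or> {h, v} = {r1, r2}" if "v \<in> set c" for v
      using c(3) that UL LR True unfolding join_graph_def by blast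
    obtain w c' where c': "cyc ?H (w # c')" "set (w # c') = set c" "length (w # c') = length c" "set c' \<subseteq> L"
    proof (cases "set c \<subseteq> L")
      case True
      obtain c' where c': "cyc ?H (hd c # c')" "set (hd c # c') = set c" "length (hd c # c') = length c"
        using cyc_rotate_to[OF c(2), of "hd c"] c0 by auto
      then have "set c' \<subseteq> L" using True by auto
      then show ?thesis using that[OF c'] by blast
    next
      case False
      then obtain w where w: "w \<in> set c" "w \<notin> L" by blast
      obtain c' where c': "cyc ?H (w # c')" "set (w # c') = set c" "length (w # c') = length c"
        using cyc_rotate_to[OF c(2) w(1)] by auto
      have "set c' \<subseteq> L"
      proof
        fix v assume v: "v \<in> set c'"
        show "v \<in> L"
        proof (rule ccontr)
          assume "v \<notin> L"
          then have "{h, v} = {r1, r2}" using cL[of v] v c'(2) by auto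
          moreover have "{h, w} = {r1, r2}" using cL[OF w(1)] w(2) by blast
          ultimately have "v = w" by (metis doubleton_eq_iff)
          then show False using c'(1) v unfolding cyc_def by simp
        qed
      qed
      then show ?thesis using that[OF c'] by blast
    qed
    have "successively ?H c'" "distinct c'" using c'(1) unfolding cyc_def by (auto simp: successively_Cons)
    then have "successively U c'" "distinct c'" "length c' = 2 * k - 1"
      using successively_cong_set[of c' ?H U] HL c'(3,4) c(1) by auto
    then show False using U unfolding deg_graph_def by blast
  next
    case False
    then have hL: "h \<in> L" using h by blast
    have inA: "v \<in> nbrs U L h" if "v \<in> set c" "v \<notin> R" for v
    proof -
      have "?H h v" using c(3) that by blast
      then show ?thesis using that UL False LR unfolding join_graph_def nbrs_def by (auto simp: doubleton_eq_iff)
    qed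
    have cA: "card (set c - R) \<le> k - 1"
    proof -
      have "set c - R \<subseteq> nbrs U L h" using inA by blast
      then have "card (set c - R) \<le> card (nbrs U L h)" by (rule card_mono[rotated]) (use UL in simp)
      then show ?thesis using U hL unfolding deg_graph_def by fastforce
    qed
    have fl: "length (filter (\<lambda>v. v \<notin> R) d) = card (set d - R)" if "distinct d" for d
    proof -
      have "card (set (filter (\<lambda>v. v \<notin> R) d)) = length (filter (\<lambda>v. v \<notin> R) d)"
        using that by (intro distinct_card) simp
      moreover have "set (filter (\<lambda>v. v \<notin> R) d) = set d - R" by auto
      ultimately show ?thesis by simp
    qed
    have bound: "2 * k \<le> 2 * card (set c - R) + 1 + (if hd d \<in> R then 1 else 0)"
      if "cyc ?H d" "set d = set c" "length d = length c" for d
    proof -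
      have d: "distinct d" "successively ?H d" using that(1) unfolding cyc_def by auto
      have "length (filter (\<lambda>v. v \<in> R) d) \<le> length (filter (\<lambda>v. v \<notin> R) d)
        + (if r1 \<in> set d \<and> r2 \<in> set d then 1 else 0) + (if d \<noteq> [] \<and> hd d \<in> R then 1 else 0)"
        by (rule path_one_edge_count[OF HR d])
      moreover have "length (filter (\<lambda>v. v \<in> R) d) + length (filter (\<lambda>v. v \<notin> R) d) = 2 * k"
        using sum_length_filter_compl[of "\<lambda>v. v \<in> R" d] that c(1) by simp
      ultimately show ?thesis using fl[OF d(1)] that(2) by (auto split: if_splits)
    qed
    show False
    proof (cases "set c \<subseteq> R")
      case True
      then have z: "card (set c - R) = 0" by (metis Diff_eq_empty_iff card.empty)
      then show False using bound[OF c(2) refl refl] k unfolding z by (simp split: if_splits)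
    next
      case False
      \<comment> \<open>Starting the cycle outside \<open>R\<close> removes the boundary term of the
        count, so that \<open>2 * k \<le> 2 * (k - 1) + 1\<close>.\<close>
      then obtain a where a: "a \<in> set c" "a \<notin> R" by blast
      obtain c' where c': "cyc ?H (a # c')" "set (a # c') = set c" "length (a # c') = length c"
        using cyc_rotate_to[OF c(2) a(1)] by auto
      then show False using bound[OF c'] a(2) cA k by auto
    qed
  qed
qed

text \<open>The graph inside \<open>L\<close> enters the later comparisons only through its degrees,
  so its construction is forgotten here.\<close>

definition target :: "nat \<Rightarrow> 'a set \<Rightarrow> 'a set \<Rightarrow> ('a \<Rightarrow> 'a \<Rightarrow> bool) \<Rightarrow> bool" where
  "target k L R H \<longleftrightarrow> rel_graph (L \<union> R) H \<and> wheel_free k H \<and> (\<forall>u\<in>L. \<forall>v\<in>R. H u v) \<and>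
     (\<forall>v\<in>L. card (nbrs H L v) \<le> k - 1) \<and>
     (k - 1) * card L \<le> (\<Sum>v\<in>L. card (nbrs H L v)) + 1 \<and>
     (\<exists>r1 r2. r1 \<noteq> r2 \<and> r1 \<in> R \<and> r2 \<in> R \<and> (\<forall>u\<in>R. \<forall>v\<in>R. H u v \<longleftrightarrow> {u, v} = {r1, r2}))"

lemma target_size:
  fixes k :: nat
  assumes "3 \<le> k"
  shows "3 * (k * (2 * k - 2) + k + 1) < 1000 * k ^ 6"
proof -
  define m where "m = k * (2 * k - 2)"
  have "m \<le> 2 * k ^ 2" unfolding m_def by (simp add: power2_eq_square)
  moreover have "k ^ 2 \<le> k ^ 6" "k ^ 1 \<le> k ^ 6" by (rule power_increasing; use assms in simp)+
  moreover have "0 < k ^ 6" using assms by simp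
  ultimately show ?thesis unfolding m_def[symmetric] add_mult_distrib2 power_one_right by linarith
qed

lemma target_exists:
  fixes L R :: "'a set"
  assumes k: "3 \<le> k" and fin: "finite L" "finite R" and LR: "L \<inter> R = {}"
    and L: "k * (2 * k - 2) + k + 1 \<le> card L" and R: "2 \<le> card R"
  shows "\<exists>H. target k L R H"
proof -
  obtain U where U: "deg_graph (k - 1) (2 * k - 1) 1 L U"
    using deg_size_large[OF k L, of "TYPE('a)"] fin unfolding deg_size_def by blast
  have rU: "rel_graph L U" using U unfolding deg_graph_def by blast
  note UL = rel_graphD[OF rU]
  obtain r1 r2 where r: "r1 \<in> R" "r2 \<in> R" "r1 \<noteq> r2"
    using R card_le_Suc0_iff_eq[OF fin(2)] by force
  let ?H = "join_graph L R U r1 r2"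
  have HL: "?H u v \<longleftrightarrow> U u v" if "u \<in> L" "v \<in> L" for u v
  proof -
    have "{u, v} \<noteq> {r1, r2}" using that LR r by (auto simp: doubleton_eq_iff)
    then show ?thesis using that LR unfolding join_graph_def by blast
  qed
  have nL: "nbrs ?H L v = nbrs U L v" if "v \<in> L" for v using HL that unfolding nbrs_def by blast
  have "rel_graph (L \<union> R) ?H"
    unfolding rel_graph_def
  proof (intro conjI allI impI)
    show "finite (L \<union> R)" using fin by simp
    fix u v assume h: "?H u v"
    show "u \<in> L \<union> R" "v \<in> L \<union> R" "u \<noteq> v" "?H v u"
      using h UL LR r unfolding join_graph_def by (auto simp: doubleton_eq_iff)
  qed
  moreover have "?H u v \<longleftrightarrow> {u, v} = {r1, r2}" if "u \<in> R" "v \<in> R" for u v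
    using that LR UL unfolding join_graph_def by blast
  moreover have "wheel_free k ?H" by (rule wheel_free_join_graph[OF k U fin(2) LR r])
  moreover have "\<forall>u\<in>L. \<forall>v\<in>R. ?H u v" unfolding join_graph_def by blast
  moreover have "(\<forall>v\<in>L. card (nbrs ?H L v) \<le> k - 1)" using U nL unfolding deg_graph_def by simp
  moreover have "(k - 1) * card L \<le> (\<Sum>v\<in>L. card (nbrs ?H L v)) + 1"
    using U nL unfolding deg_graph_def by simp
  ultimately have "target k L R ?H" using r unfolding target_def by blast
  then show ?thesis by blast
qed

section \<open>Dense bipartite pairs and the maximality condition\<close>

lemma sum_card_nbrs_swap:
  assumes "finite X" "finite Y"
  shows "(\<Sum>u\<in>X. card (nbrs E Y u)) = (\<Sum>y\<in>Y. card {u \<in> X. E u y})"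
proof -
  have "(\<Sum>u\<in>X. card (nbrs E Y u)) = (\<Sum>u\<in>X. \<Sum>y\<in>Y. if E u y then 1 else 0)"
    using assms by (simp add: nbrs_def flip: sum.inter_filter)
  also have "\<dots> = (\<Sum>y\<in>Y. \<Sum>u\<in>X. if E u y then 1 else 0)" by (rule sum.swap)
  also have "\<dots> = (\<Sum>y\<in>Y. card {u \<in> X. E u y})"
    using assms by (simp flip: sum.inter_filter)
  finally show ?thesis .
qed

lemma sum_le_threshold:
  fixes f :: "'a \<Rightarrow> real" and M t :: real
  assumes "finite X" "\<And>u. u \<in> X \<Longrightarrow> f u \<le> M" "0 \<le> t" "0 \<le> M"
  shows "sum f X \<le> card {u \<in> X. t \<le> f u} * M + card X * t"
proof -
  have "sum f X \<le> (\<Sum>u\<in>X. (if t \<le> f u then M else 0) + t)"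
    by (rule sum_mono) (use assms in \<open>auto simp: add_increasing2\<close>)
  also have "\<dots> = card {u \<in> X. t \<le> f u} * M + card X * t"
    using assms(1) by (simp add: sum.distrib flip: sum.inter_filter)
  finally show ?thesis .
qed

text \<open>A constant number of vertices of large degree already has a large common
  neighbourhood, by pigeonhole over their possible neighbourhood traces.\<close>

lemma dense_biclique:
  fixes \<epsilon> :: real and t :: nat
  assumes "0 < \<epsilon>" "1 \<le> t"
  shows "\<exists>N. \<forall>n\<ge>N. \<forall>X Y :: 'a set. \<forall>E. finite X \<and> finite Y \<and> card X \<le> n \<and> card Y \<le> n \<and>
    \<epsilon> * (real n)\<^sup>2 \<le> real (\<Sum>u\<in>X. card (nbrs E Y u)) \<longrightarrow>
    (\<exists>A B. A \<subseteq> X \<and> B \<subseteq> Y \<and> card A = t \<and> card B = t \<and> (\<forall>a\<in>A. \<forall>b\<in>B. E a b))"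
proof -
  \<comment> \<open>\<open>M\<close> vertices of large degree will be sampled. The inequality
    \<open>4 * t \<le> M * \<epsilon>\<close> ensures that vertices of \<open>Y\<close> with fewer
    than \<open>t\<close> neighbours in the sample account for at most half of the guaranteed
    \<open>M * (\<epsilon> / 2 * n)\<close> edges.\<close>
  define M where "M = nat \<lceil>4 * real t / \<epsilon>\<rceil>"
  have M: "4 * real t \<le> M * \<epsilon>"
    unfolding M_def using assms(1) by (simp add: field_simps) (metis (no_types, opaque_lifting) le_of_int_ceiling mult.commute pos_divide_le_eq)
  have M0: "0 < M" using M assms by (cases "M = 0") auto
  \<comment> \<open>This makes \<open>\<epsilon> / 2 * n\<close> at least \<open>M\<close>, so that
    the sample exists, and \<open>\<epsilon> / 4 * n\<close> larger than \<open>t * 2 ^ M\<close>,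
    so that some trace on the sample occurs \<open>t\<close> times.\<close>
  define N where "N = nat \<lceil>(2 * real M + 4 * (t * 2 ^ M) + 4) / \<epsilon>\<rceil>"
  have N: "2 * real M + 4 * (t * 2 ^ M) + 4 \<le> n * \<epsilon>" if "N \<le> n" for n
  proof -
    have "(2 * real M + 4 * (t * 2 ^ M) + 4) / \<epsilon> \<le> real n" using that unfolding N_def by linarith
    then show ?thesis using assms(1) by (simp add: field_simps)
  qed
  show ?thesis
  proof (intro exI[of _ N] allI impI)
    fix n and X Y :: "'a set" and E
    assume n: "N \<le> n" and XY: "finite X \<and> finite Y \<and> card X \<le> n \<and> card Y \<le> n \<and>
      \<epsilon> * (real n)\<^sup>2 \<le> real (\<Sum>u\<in>X. card (nbrs E Y u))"
    have n0: "0 < n"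
    proof -
      have "0 < 2 * real M + 4 * (t * 2 ^ M) + 4" by (intro add_nonneg_pos add_nonneg_nonneg) auto
      then have "0 < n * \<epsilon>" using N[OF n] by linarith
      then show ?thesis by (cases "n = 0") auto
    qed
    define X' where "X' = {u \<in> X. \<epsilon> / 2 * n \<le> real (card (nbrs E Y u))}"
    have dY: "card (nbrs E Y u) \<le> n" for u
      using XY card_mono[of Y "nbrs E Y u"] nbrs_subset[of E Y u] by linarith
    have "real (\<Sum>u\<in>X. card (nbrs E Y u)) \<le> card X' * real n + card X * (\<epsilon> / 2 * n)"
      unfolding X'_def of_nat_sum by (rule sum_le_threshold) (use XY dY assms in auto)
    moreover have "card X * (\<epsilon> / 2 * n) \<le> n * (\<epsilon> / 2 * n)" using XY assms by (intro mult_right_mono) auto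
    ultimately have "n * (\<epsilon> / 2 * n) \<le> card X' * real n" using XY by (simp add: power2_eq_square algebra_simps)
    then have "\<epsilon> / 2 * n \<le> card X'" using n0 by (simp add: mult.commute)
    then have "\<epsilon> * n \<le> 2 * card X'" by simp
    moreover have "2 * real M + 4 * (real t * 2 ^ M) + 4 \<le> \<epsilon> * n" using N[OF n] by (simp add: mult.commute)
    moreover have "0 \<le> real t * 2 ^ M" by simp
    ultimately have "M \<le> card X'" by linarith
    then obtain X0 where X0: "X0 \<subseteq> X'" "card X0 = M" "finite X0"
      using obtain_subset_with_card_n by blast
    have X0X: "X0 \<subseteq> X" using X0 unfolding X'_def by auto
    define g where "g y = {u \<in> X0. E u y}" for y
    have gM: "card (g y) \<le> M" for y using card_mono[of X0 "g y"] X0 unfolding g_def by auto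
    have "M * (\<epsilon> / 2 * n) = (\<Sum>u\<in>X0. \<epsilon> / 2 * n)" using X0 by simp
    also have "\<dots> \<le> (\<Sum>u\<in>X0. real (card (nbrs E Y u)))"
      by (rule sum_mono) (use X0 in \<open>auto simp: X'_def\<close>)
    also have "\<dots> = (\<Sum>y\<in>Y. real (card (g y)))"
      using sum_card_nbrs_swap[of X0 Y E] X0 XY unfolding g_def by (simp flip: of_nat_sum)
    finally have s1: "M * (\<epsilon> / 2 * n) \<le> (\<Sum>y\<in>Y. real (card (g y)))" .
    define Y' where "Y' = {y \<in> Y. real t \<le> real (card (g y))}"
    have "(\<Sum>y\<in>Y. real (card (g y))) \<le> card Y' * real M + card Y * real t"
      unfolding Y'_def by (rule sum_le_threshold) (use XY gM in auto)
    also have "card Y * real t \<le> n * real t" using XY by (intro mult_right_mono) auto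
    also have "n * real t \<le> M * (\<epsilon> / 4 * n)" using mult_left_mono[OF M, of "real n / 4"] by (simp add: algebra_simps)
    finally have "M * (\<epsilon> / 4 * n) \<le> M * real (card Y')" using s1 by (simp add: algebra_simps)
    then have "\<epsilon> / 4 * n \<le> card Y'" using M0 by simp
    then have "real (t * 2 ^ M) < card Y'" using N[OF n] by (simp add: algebra_simps)
    then have Y'c: "t * 2 ^ M < card Y'" by linarith
    have fY': "finite Y'" using XY unfolding Y'_def by auto
    have "\<exists>S\<in>Pow X0. t \<le> card {y \<in> Y'. g y = S}"
    proof (rule ccontr)
      assume "\<not> ?thesis"
      then have lt: "card {y \<in> Y'. g y = S} \<le> t" if "S \<in> Pow X0" for S
        using that by (meson linear)
      have sub: "Y' \<subseteq> (\<Union>S\<in>Pow X0. {y \<in> Y'. g y = S})"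
      proof
        fix y assume "y \<in> Y'"
        moreover have "g y \<in> Pow X0" unfolding g_def by blast
        ultimately show "y \<in> (\<Union>S\<in>Pow X0. {y \<in> Y'. g y = S})" by simp
      qed
      have "card Y' \<le> card (\<Union>S\<in>Pow X0. {y \<in> Y'. g y = S})"
        by (rule card_mono[OF _ sub]) (use X0 fY' in simp)
      also have "\<dots> \<le> (\<Sum>S\<in>Pow X0. card {y \<in> Y'. g y = S})"
        by (rule card_UN_le) (use X0 in simp)
      also have "\<dots> \<le> (\<Sum>S\<in>Pow X0. t)" by (rule sum_mono) (use lt in auto)
      also have "\<dots> = t * 2 ^ M" using X0 by (simp add: card_Pow)
      finally show False using Y'c by simp
    qed
    then obtain S where S: "S \<subseteq> X0" "t \<le> card {y \<in> Y'. g y = S}" by auto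
    obtain B where B: "B \<subseteq> {y \<in> Y'. g y = S}" "card B = t" using obtain_subset_with_card_n[OF S(2)] by blast
    then have "B \<noteq> {}" using assms(2) by auto
    then obtain b where "b \<in> B" by blast
    then have "t \<le> card S" using B unfolding Y'_def by auto
    then obtain A where A: "A \<subseteq> S" "card A = t" using obtain_subset_with_card_n[of t S] by blast
    have "A \<subseteq> X" using A S X0X by blast
    moreover have "B \<subseteq> Y" using B unfolding Y'_def by auto
    moreover have "\<forall>a\<in>A. \<forall>b\<in>B. E a b" using A B unfolding g_def by blast
    ultimately show "\<exists>A B. A \<subseteq> X \<and> B \<subseteq> Y \<and> card A = t \<and> card B = t \<and> (\<forall>a\<in>A. \<forall>b\<in>B. E a b)"
      using A B by blast
  qed
qed

text \<open>The quadratic form of the adjacency matrix, that is, twice the sum of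
  \<open>y u * y v\<close> over the edges.\<close>

definition quad :: "'a set \<Rightarrow> ('a \<Rightarrow> 'a \<Rightarrow> bool) \<Rightarrow> ('a \<Rightarrow> real) \<Rightarrow> real" where
  "quad V E y = (\<Sum>u\<in>V. y u * (\<Sum>v\<in>nbrs E V u. y v))"

lemma nbrs_Un: "nbrs E (S \<union> T) v = nbrs E S v \<union> nbrs E T v"
  unfolding nbrs_def by blast

lemma sum_nbrs_swap:
  fixes y z :: "'a \<Rightarrow> real"
  assumes "finite X" "finite Y" "\<And>u v. E u v \<Longrightarrow> E v u"
  shows "(\<Sum>u\<in>X. y u * (\<Sum>v\<in>nbrs E Y u. z v)) = (\<Sum>v\<in>Y. z v * (\<Sum>u\<in>nbrs E X v. y u))"
proof -
  have "(\<Sum>u\<in>X. y u * (\<Sum>v\<in>nbrs E Y u. z v)) = (\<Sum>u\<in>X. \<Sum>v\<in>Y. if E u v then y u * z v else 0)"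
    using assms by (simp add: nbrs_def sum_distrib_left flip: sum.inter_filter)
  also have "\<dots> = (\<Sum>v\<in>Y. \<Sum>u\<in>X. if E u v then y u * z v else 0)" by (rule sum.swap)
  also have "\<dots> = (\<Sum>v\<in>Y. \<Sum>u\<in>X. if E v u then z v * y u else 0)"
    using assms(3) by (intro sum.cong refl) (auto simp: mult.commute)
  also have "\<dots> = (\<Sum>v\<in>Y. z v * (\<Sum>u\<in>nbrs E X v. y u))"
    using assms by (simp add: nbrs_def sum_distrib_left flip: sum.inter_filter)
  finally show ?thesis .
qed

lemma quad_split:
  assumes "rel_graph (L \<union> R) E" "L \<inter> R = {}"
  shows "quad (L \<union> R) E y = (\<Sum>u\<in>L. y u * (\<Sum>v\<in>nbrs E L u. y v)) + (\<Sum>u\<in>R. y u * (\<Sum>v\<in>nbrs E R u. y v))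
    + 2 * (\<Sum>u\<in>L. y u * (\<Sum>v\<in>nbrs E R u. y v))"
proof -
  have f: "finite L" "finite R" using rel_graphD(1)[OF assms(1)] by auto
  have s: "(\<Sum>v\<in>nbrs E (L \<union> R) u. y v) = (\<Sum>v\<in>nbrs E L u. y v) + (\<Sum>v\<in>nbrs E R u. y v)" for u
    unfolding nbrs_Un by (rule sum.union_disjoint) (use f assms(2) in auto)
  have "quad (L \<union> R) E y = (\<Sum>u\<in>L. y u * (\<Sum>v\<in>nbrs E (L \<union> R) u. y v)) + (\<Sum>u\<in>R. y u * (\<Sum>v\<in>nbrs E (L \<union> R) u. y v))"
    unfolding quad_def by (rule sum.union_disjoint) (use f assms(2) in auto)
  also have "\<dots> = (\<Sum>u\<in>L. y u * (\<Sum>v\<in>nbrs E L u. y v)) + (\<Sum>u\<in>R. y u * (\<Sum>v\<in>nbrs E R u. y v))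
     + (\<Sum>u\<in>L. y u * (\<Sum>v\<in>nbrs E R u. y v)) + (\<Sum>u\<in>R. y u * (\<Sum>v\<in>nbrs E L u. y v))"
    unfolding s by (simp add: algebra_simps sum.distrib)
  also have "(\<Sum>u\<in>R. y u * (\<Sum>v\<in>nbrs E L u. y v)) = (\<Sum>u\<in>L. y u * (\<Sum>v\<in>nbrs E R u. y v))"
    by (rule sum_nbrs_swap) (use f rel_graphD(5)[OF assms(1)] in auto)
  finally show ?thesis by simp
qed

lemma common_nbr:
  fixes \<mu> :: real
  assumes "finite B" "finite W" "finite F" "\<And>w. w \<in> W \<Longrightarrow> real (card {b \<in> B. \<not> E w b}) \<le> \<mu>"
    and "card W * \<mu> + card F < card B"
  shows "\<exists>b\<in>B. b \<notin> F \<and> (\<forall>w\<in>W. E w b)"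
proof (rule ccontr)
  assume "\<not> ?thesis"
  then have "B \<subseteq> (\<Union>w\<in>W. {b \<in> B. \<not> E w b}) \<union> F" by blast
  then have "card B \<le> card ((\<Union>w\<in>W. {b \<in> B. \<not> E w b}) \<union> F)" using assms by (intro card_mono) auto
  also have "\<dots> \<le> card (\<Union>w\<in>W. {b \<in> B. \<not> E w b}) + card F" by (rule card_Un_le)
  also have "card (\<Union>w\<in>W. {b \<in> B. \<not> E w b}) \<le> (\<Sum>w\<in>W. card {b \<in> B. \<not> E w b})"
    using assms(2) by (rule card_UN_le)
  finally have "real (card B) \<le> (\<Sum>w\<in>W. real (card {b \<in> B. \<not> E w b})) + card F"
    by (simp flip: of_nat_sum of_nat_add)
  also have "(\<Sum>w\<in>W. real (card {b \<in> B. \<not> E w b})) \<le> (\<Sum>w\<in>W. \<mu>)" using assms(4) by (rule sum_mono)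
  finally show False using assms(5) by simp
qed

text \<open>The assumption \<open>maximal\<close> is extremality in variational form: a wheel-free
  competitor \<open>H\<close> has largest eigenvalue at most \<open>lam\<close>, hence its form is
  bounded by \<open>lam\<close> at every vector, in particular at modifications of
  \<open>x\<close>.\<close>

locale extremal =
  fixes k :: nat and V :: "'a set" and E :: "'a \<Rightarrow> 'a \<Rightarrow> bool" and lam :: real and x :: "'a \<Rightarrow> real"
  assumes k3: "3 \<le> k"
    and graph: "rel_graph V E"
    and wf: "wheel_free k E"
    and x_nonneg: "v \<in> V \<Longrightarrow> 0 \<le> x v"
    and x_le_1: "v \<in> V \<Longrightarrow> x v \<le> 1"
    and x_max: "\<exists>u\<in>V. x u = 1"
    and eig: "v \<in> V \<Longrightarrow> (\<Sum>w\<in>nbrs E V v. x w) = lam * x v"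
    and maximal: "\<And>H y. rel_graph V H \<Longrightarrow> wheel_free k H \<Longrightarrow> quad V H y \<le> lam * (\<Sum>v\<in>V. (y v)\<^sup>2)"
begin

lemmas E_D = rel_graphD[OF graph]

lemma quad_x: "quad V E x = lam * (\<Sum>v\<in>V. (x v)\<^sup>2)"
  unfolding quad_def by (simp add: eig sum_distrib_left power2_eq_square mult_ac cong: sum.cong)

text \<open>The test vector takes the value \<open>p\<close> on \<open>L\<close> and
  \<open>q\<close> on \<open>R\<close>. Equal values give the first lower bound on
  \<open>lam\<close>; values in the ratio of the principal eigenvector give the sharper bound behind
  the balance of the parts.\<close>

lemma target_bound:
  fixes p q :: real
  assumes LR: "L \<union> R = V" "L \<inter> R = {}" and L: "k * (2 * k - 2) + k + 1 \<le> card L" and R: "2 \<le> card R"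
  shows "(real (k - 1) * card L - 1) * p\<^sup>2 + 2 * card L * card R * p * q + 2 * q\<^sup>2
    \<le> lam * (card L * p\<^sup>2 + card R * q\<^sup>2)"
proof -
  have f: "finite L" "finite R" using E_D(1) LR by auto
  obtain H where H: "target k L R H" using target_exists[OF k3 f LR(2) L R] by blast
  then have Hg: "rel_graph (L \<union> R) H" "wheel_free k H" "\<And>u v. u \<in> L \<Longrightarrow> v \<in> R \<Longrightarrow> H u v"
    and dL: "(k - 1) * card L \<le> (\<Sum>v\<in>L. card (nbrs H L v)) + 1" unfolding target_def by blast+
  obtain r1 r2 where r: "r1 \<noteq> r2" "r1 \<in> R" "r2 \<in> R" "\<And>u v. u \<in> R \<Longrightarrow> v \<in> R \<Longrightarrow> H u v \<longleftrightarrow> {u, v} = {r1, r2}"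
    using H unfolding target_def by blast
  define y where "y v = (if v \<in> L then p else q)" for v
  have yL: "y v = p" if "v \<in> L" for v using that unfolding y_def by simp
  have yR: "y v = q" if "v \<in> R" for v using that LR unfolding y_def by auto
  have n1: "nbrs H R u = R" if "u \<in> L" for u using Hg(3) that unfolding nbrs_def by blast
  have sL: "(\<Sum>u\<in>L. y u * (\<Sum>v\<in>nbrs H L u. y v)) = (\<Sum>u\<in>L. real (card (nbrs H L u))) * p\<^sup>2"
    by (simp add: yL sum_distrib_right sum_distrib_left power2_eq_square mult_ac)
  have sR: "(\<Sum>u\<in>R. y u * (\<Sum>v\<in>nbrs H R u. y v)) = (\<Sum>u\<in>R. real (card (nbrs H R u))) * q\<^sup>2"
    by (simp add: yR sum_distrib_right sum_distrib_left power2_eq_square mult_ac)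
  have sLR: "(\<Sum>u\<in>L. y u * (\<Sum>v\<in>nbrs H R u. y v)) = card L * card R * p * q"
    by (simp add: yL n1 yR)
  have nr: "nbrs H R u = (if u = r1 then {r2} else if u = r2 then {r1} else {})" if "u \<in> R" for u
    using that r by (auto simp: doubleton_eq_iff nbrs_def)
  have "(\<Sum>u\<in>R. card (nbrs H R u)) = (\<Sum>u\<in>{r1, r2}. card (nbrs H R u))"
    using r nr f by (intro sum.mono_neutral_right) auto
  also have "\<dots> = 2" using r nr by simp
  finally have "(\<Sum>u\<in>R. real (card (nbrs H R u))) = 2" by (simp flip: of_nat_sum)
  then have qd: "quad V H y = (\<Sum>u\<in>L. real (card (nbrs H L u))) * p\<^sup>2 + 2 * q\<^sup>2 + 2 * (card L * card R * p * q)"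
    using quad_split[OF Hg(1) LR(2), of y] sL sR sLR LR(1) by simp
  have "(\<Sum>v\<in>V. (y v)\<^sup>2) = (\<Sum>v\<in>L. (y v)\<^sup>2) + (\<Sum>v\<in>R. (y v)\<^sup>2)"
    unfolding LR(1)[symmetric] by (rule sum.union_disjoint) (use f LR in auto)
  also have "\<dots> = card L * p\<^sup>2 + card R * q\<^sup>2" by (simp add: yL yR)
  finally have ys: "(\<Sum>v\<in>V. (y v)\<^sup>2) = card L * p\<^sup>2 + card R * q\<^sup>2" .
  have "real ((k - 1) * card L) \<le> real ((\<Sum>v\<in>L. card (nbrs H L v)) + 1)" using dL by (simp only: of_nat_le_iff)
  then have "real (k - 1) * card L - 1 \<le> (\<Sum>u\<in>L. real (card (nbrs H L u)))" by simp
  then have "(real (k - 1) * card L - 1) * p\<^sup>2 \<le> (\<Sum>u\<in>L. real (card (nbrs H L u))) * p\<^sup>2"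
    by (rule mult_right_mono) simp
  then show ?thesis using maximal[of H y] Hg qd ys LR(1) by (simp add: mult_ac)
qed

lemma lam_gt:
  assumes "3 * (k * (2 * k - 2) + k + 1) < card V"
  shows "(real (card V) + real (k - 1)) / 2 < lam"
proof -
  define n where "n = card V"
  have "2 * m \<le> n" if "3 * m < n" for m n :: nat using that by linarith
  note size = this[OF assms]
  obtain R where R: "R \<subseteq> V" "card R = n div 2" "finite R"
    using obtain_subset_with_card_n[of "n div 2" V] unfolding n_def by auto
  define L where "L = V - R"
  have LR: "L \<union> R = V" "L \<inter> R = {}" using R unfolding L_def by auto
  have cL: "card L = n - n div 2" using R E_D(1) unfolding L_def n_def by (simp add: card_Diff_subset)
  have half: "m \<le> n - n div 2" if "2 * m \<le> n" for m n :: nat using that by presburger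
  have "k + 1 \<le> k * (2 * k - 2) + k + 1" by simp
  then have "2 * (k + 1) \<le> n" using size unfolding n_def by (meson le_trans mult_le_mono2)
  then have n0: "0 < n" using k3 by simp
  have "2 \<le> card R" using \<open>2 * (k + 1) \<le> n\<close> k3 unfolding R(2) by presburger
  have "k * (2 * k - 2) + k + 1 \<le> card L"
    using size half[of "k * (2 * k - 2) + k + 1" n] unfolding cL n_def by blast
  from target_bound[OF LR this \<open>2 \<le> card R\<close>, of 1 1]
  \<comment> \<open>The shortfall 1 in \<open>L\<close> against the degree sum 2 in \<open>R\<close>
    leaves a surplus of 1. For odd \<open>n\<close> the product of the halves loses only 1 / 2,
    which is why the final inequality is strict.\<close>
  have "real (k - 1) * card L + 2 * (real (card L) * card R) + 1 \<le> lam * (real (card L) + card R)" by simp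
  moreover have "real (card L) + card R = n" using cL R by (simp flip: of_nat_add)
  ultimately have 1: "real (k - 1) * card L + 2 * (real (card L) * card R) + 1 \<le> lam * n" by simp
  have 2: "real n \<le> 2 * card L"
  proof -
    have "n \<le> 2 * card L" using cL by presburger
    then show ?thesis by (simp only: of_nat_le_iff)
  qed
  have "n * n \<le> 4 * (card L * card R) + 1" unfolding cL R(2)
    by (cases "even n") (auto elim!: evenE oddE simp: algebra_simps)
  then have 3: "real n * n \<le> 4 * (real (card L) * card R) + 1" by (simp flip: of_nat_mult of_nat_add)
  have "real (k - 1) * real n \<le> real (k - 1) * (2 * card L)" using 2 by (intro mult_left_mono) auto
  then have "(real n + real (k - 1)) / 2 * n < lam * n" using 1 3 by (simp add: algebra_simps)
  then show ?thesis using n0 unfolding n_def by simp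
qed

text \<open>Test the rejoined graph on \<open>x\<close> altered only at \<open>v\<close>, with new
  value \<open>z\<close>. Everything away from \<open>v\<close> cancels and
  \<open>2 * z * \<sigma> - lam * z\<^sup>2 \<le> lam * (x v)\<^sup>2\<close> remains; the left side
  is largest at \<open>z = \<sigma> / lam\<close>.\<close>

lemma sum_rejoin_le:
  assumes S: "S \<subseteq> V" "v \<in> V" "v \<notin> S" and lam: "0 < lam"
    and wfS: "wheel_free k (rejoin E v S)"
  shows "sum x S \<le> lam * x v"
proof -
  define \<sigma> z where "\<sigma> = sum x S" and "z = sum x S / lam"
  define y where "y u = (if u = v then z else x u)" for u
  have yv: "y v = z" and yu: "\<And>u. u \<noteq> v \<Longrightarrow> y u = x u" unfolding y_def by auto
  let ?H = "rejoin E v S"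
  have f: "finite V" "finite S" using E_D(1) S(1) finite_subset by auto
  have \<sigma>0: "0 \<le> \<sigma>" unfolding \<sigma>_def using S x_nonneg by (intro sum_nonneg) auto
  have nv: "nbrs ?H V v = S" using S unfolding nbrs_def rejoin_def by auto
  have inner: "(\<Sum>w\<in>nbrs ?H V u. y w) = lam * x u - (if E v u then x v else 0) + (if u \<in> S then z else 0)"
    if u: "u \<in> V" "u \<noteq> v" for u
  proof -
    have n: "nbrs ?H V u = (nbrs E V u - {v}) \<union> (if u \<in> S then {v} else {})"
      using u S unfolding nbrs_def rejoin_def by auto
    have "(\<Sum>w\<in>nbrs ?H V u. y w) = (\<Sum>w\<in>nbrs E V u - {v}. y w) + (\<Sum>w\<in>(if u \<in> S then {v} else {}). y w)"
      unfolding n by (rule sum.union_disjoint) (use f in auto)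
    also have "(\<Sum>w\<in>nbrs E V u - {v}. y w) = (\<Sum>w\<in>nbrs E V u - {v}. x w)" by (rule sum.cong) (auto simp: yu)
    also have "\<dots> = (\<Sum>w\<in>nbrs E V u. x w) - (if E v u then x v else 0)"
      using f S(2) E_D(5) by (subst sum_diff1) (auto simp: nbrs_def)
    finally show ?thesis using eig[OF u(1)] yv by auto
  qed
  have ev: "(\<Sum>u\<in>V. if E v u then x u else 0) = lam * x v"
    using eig[OF S(2)] f by (simp add: nbrs_def sum.inter_filter)
  have "quad V ?H y = (\<Sum>u\<in>V - {v}. y u * (\<Sum>w\<in>nbrs ?H V u. y w)) + z * (\<Sum>w\<in>S. y w)"
    unfolding quad_def using sum.remove[OF f(1) S(2), of "\<lambda>u. y u * (\<Sum>w\<in>nbrs ?H V u. y w)"] by (simp add: nv yv)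
  also have "(\<Sum>w\<in>S. y w) = \<sigma>" unfolding \<sigma>_def by (rule sum.cong[OF refl], rule yu) (use S in auto)
  also have "(\<Sum>u\<in>V - {v}. y u * (\<Sum>w\<in>nbrs ?H V u. y w))
      = (\<Sum>u\<in>V - {v}. lam * (x u)\<^sup>2 - x v * (if E v u then x u else 0) + z * (if u \<in> S then x u else 0))"
    by (rule sum.cong) (auto simp: inner yu algebra_simps power2_eq_square)
  also have "\<dots> = lam * (\<Sum>u\<in>V - {v}. (x u)\<^sup>2) - x v * (\<Sum>u\<in>V - {v}. if E v u then x u else 0)
      + z * (\<Sum>u\<in>V - {v}. if u \<in> S then x u else 0)"
    by (simp add: sum.distrib sum_subtractf sum_distrib_left)
  also have "(\<Sum>u\<in>V - {v}. if E v u then x u else 0) = lam * x v"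
    using ev sum.remove[OF f(1) S(2), of "\<lambda>u. if E v u then x u else 0"] E_D(4) by simp
  also have "(\<Sum>u\<in>V - {v}. if u \<in> S then x u else 0) = \<sigma>"
    unfolding \<sigma>_def using f S by (subst sum.inter_restrict[symmetric]) (auto intro!: sum.cong)
  finally have q: "quad V ?H y = lam * (\<Sum>u\<in>V - {v}. (x u)\<^sup>2) - lam * (x v)\<^sup>2 + 2 * z * \<sigma>"
    by (simp add: algebra_simps power2_eq_square)
  have "(\<Sum>u\<in>V. (y u)\<^sup>2) = (\<Sum>u\<in>V - {v}. (y u)\<^sup>2) + z\<^sup>2"
    using sum.remove[OF f(1) S(2), of "\<lambda>u. (y u)\<^sup>2"] yv by simp
  also have "(\<Sum>u\<in>V - {v}. (y u)\<^sup>2) = (\<Sum>u\<in>V - {v}. (x u)\<^sup>2)" by (rule sum.cong) (auto simp: yu)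
  finally have "lam * (\<Sum>u\<in>V - {v}. (x u)\<^sup>2) - lam * (x v)\<^sup>2 + 2 * z * \<sigma> \<le> lam * ((\<Sum>u\<in>V - {v}. (x u)\<^sup>2) + z\<^sup>2)"
    using maximal[OF rel_graph_rejoin[OF graph S] wfS, of y] q by simp
  then have "2 * z * \<sigma> - lam * z\<^sup>2 \<le> lam * (x v)\<^sup>2" by (simp add: algebra_simps)
  moreover have "2 * z * \<sigma> - lam * z\<^sup>2 = \<sigma>\<^sup>2 / lam"
    using lam unfolding z_def \<sigma>_def[symmetric] by (simp add: field_simps power2_eq_square)
  ultimately have "\<sigma>\<^sup>2 / lam \<le> lam * (x v)\<^sup>2" by simp
  then have "\<sigma>\<^sup>2 \<le> (lam * x v)\<^sup>2" using lam by (simp add: divide_le_eq power2_eq_square mult_ac)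
  then show ?thesis unfolding \<sigma>_def[symmetric]
    using lam x_nonneg[OF S(2)] by (intro power2_le_imp_le[of \<sigma>]) auto
qed

text \<open>A union bound finds a vertex of \<open>B\<close> adjacent to any
  \<open>2 * k + 1\<close> prescribed vertices of \<open>S\<close> and outside
  \<open>2 * k + 1\<close> others. Such a vertex can replace \<open>v\<close> in a wheel of the
  rejoined graph.\<close>

lemma sum_le_of_common_nbrs:
  fixes \<mu> :: real
  assumes S: "S \<subseteq> V" "B \<subseteq> V" "v \<in> V" and lam: "0 < lam" and \<mu>: "0 \<le> \<mu>"
    and miss: "\<And>w. w \<in> S \<Longrightarrow> real (card {b \<in> B. \<not> E w b}) \<le> \<mu>"
    and big: "(2 * k + 1) * (\<mu> + 1) < card B"
  shows "sum x (S - {v}) \<le> lam * x v"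
proof (rule sum_rejoin_le)
  show "wheel_free k (rejoin E v (S - {v}))"
  proof (rule wheel_free_rejoin[OF wf graph])
    fix W F :: "'a set"
    assume W: "W \<subseteq> S - {v}" "finite W" "card W \<le> 2 * k + 1" "finite F" "card F \<le> 2 * k + 1"
    have "card W * \<mu> \<le> (2 * k + 1) * \<mu>" using W(3) \<mu> by (intro mult_right_mono) (auto simp: of_nat_mono simp flip: of_nat_Suc of_nat_add)
    then have "card W * \<mu> + card F < card B" using big W(5) by (simp add: algebra_simps)
    then have "\<exists>b\<in>B. b \<notin> F \<and> (\<forall>w\<in>W. E w b)"
      using W S miss E_D(1) finite_subset by (intro common_nbr[of B W F E \<mu>]) auto
    then show "\<exists>v'. v' \<notin> F \<and> (\<forall>w\<in>W. E v' w)" using E_D(5) by blast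
  qed (use k3 in auto)
qed (use S lam in auto)

end

section \<open>Approximate structure\<close>

definition non_nbrs :: "('a \<Rightarrow> 'a \<Rightarrow> bool) \<Rightarrow> 'a set \<Rightarrow> 'a \<Rightarrow> 'a set" where
  "non_nbrs E S v = {u \<in> S. \<not> E v u}"

lemma card_nbrs_non_nbrs:
  assumes "finite S"
  shows "real (card (nbrs E S v)) + real (card (non_nbrs E S v)) = real (card S)"
proof -
  have "card (nbrs E S v \<union> non_nbrs E S v) = card (nbrs E S v) + card (non_nbrs E S v)"
    by (rule card_Un_disjoint) (use assms in \<open>auto simp: nbrs_def non_nbrs_def\<close>)
  moreover have "nbrs E S v \<union> non_nbrs E S v = S" unfolding nbrs_def non_nbrs_def by blast
  ultimately show ?thesis by simp
qed

lemma card_exceeding_le: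
  fixes f :: "'a \<Rightarrow> nat" and \<tau> :: real
  assumes "finite A" "real (sum f A) \<le> \<tau>\<^sup>2" "0 < \<tau>"
  shows "real (card {v \<in> A. \<tau> < f v}) \<le> \<tau>"
proof -
  have "card {v \<in> A. \<tau> < f v} * \<tau> = (\<Sum>v\<in>{v \<in> A. \<tau> < f v}. \<tau>)" by simp
  also have "\<dots> \<le> (\<Sum>v\<in>{v \<in> A. \<tau> < f v}. real (f v))" by (rule sum_mono) auto
  also have "\<dots> \<le> (\<Sum>v\<in>A. real (f v))" by (rule sum_mono2) (use assms in auto)
  also have "\<dots> \<le> \<tau> * \<tau>" using assms(2) by (simp add: power2_eq_square)
  finally show ?thesis using assms(3) by simp
qed

context extremal
begin

text \<open>A large complete bipartite graph inside a neighbourhood contains a rim. The sets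
  \<open>X\<close> and \<open>Y\<close> may overlap; with \<open>X = Y\<close> the sum counts the
  edges inside a set twice.\<close>

lemma no_dense_pair_in_nbrs:
  assumes kst: "\<And>X Y. X \<subseteq> V \<Longrightarrow> Y \<subseteq> V \<Longrightarrow> (\<tau>::real)\<^sup>2 \<le> real (\<Sum>u\<in>X. card (nbrs E Y u)) \<Longrightarrow>
      \<exists>A B. A \<subseteq> X \<and> B \<subseteq> Y \<and> card A = 2 * k + 1 \<and> card B = 2 * k + 1 \<and> (\<forall>a\<in>A. \<forall>b\<in>B. E a b)"
    and X: "X \<subseteq> nbrs E V h" and Y: "Y \<subseteq> nbrs E V h"
  shows "real (\<Sum>u\<in>X. card (nbrs E Y u)) < \<tau>\<^sup>2"
proof (rule ccontr)
  assume "\<not> ?thesis"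
  moreover have "X \<subseteq> V" by (rule order_trans[OF X nbrs_subset])
  moreover have "Y \<subseteq> V" by (rule order_trans[OF Y nbrs_subset])
  ultimately obtain A B where AB: "A \<subseteq> X" "B \<subseteq> Y" "card A = 2 * k + 1" "card B = 2 * k + 1"
    "\<forall>a\<in>A. \<forall>b\<in>B. E a b" using kst[of X Y] by (metis not_less)
  have fB: "finite B" by (rule ccontr) (use AB(4) in simp)
  have "k \<le> card A" using AB by simp
  then obtain A' where A': "A' \<subseteq> A" "card A' = k" "finite A'" using obtain_subset_with_card_n by blast
  show False
  proof (rule wheel_from_biclique[OF wf graph _ A'(3,2) fB, of h])
    show "1 \<le> k" using k3 by simp
    show "2 * k < card B" using AB(4) by simp
    show "E a b" if "a \<in> A'" "b \<in> B" for a b using that A'(1) AB(5) by blast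
    show "E h a" if "a \<in> A'" for a using that A'(1) AB(1) X by (metis in_nbrs subsetD)
    show "E h b" if "b \<in> B" for b using that AB(2) Y by (metis in_nbrs subsetD)
  qed
qed

text \<open>The neighbourhood of \<open>u\<close> and its complement form only an auxiliary
  partition, in which a few vertices may sit on the wrong side. Its well-behaved vertices suffice
  for the rejoining inequality, which bounds all entries of \<open>x\<close>, hence all degrees,
  from below. Then every vertex can be assigned to the side in which it has few neighbours.\<close>

theorem near_bipartition:
  fixes \<tau> :: real
  assumes \<tau>: "2 \<le> \<tau>" "100 * k * \<tau> \<le> card V"
    and kst: "\<And>X Y. X \<subseteq> V \<Longrightarrow> Y \<subseteq> V \<Longrightarrow> \<tau>\<^sup>2 \<le> real (\<Sum>u\<in>X. card (nbrs E Y u)) \<Longrightarrow>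
      \<exists>A B. A \<subseteq> X \<and> B \<subseteq> Y \<and> card A = 2 * k + 1 \<and> card B = 2 * k + 1 \<and> (\<forall>a\<in>A. \<forall>b\<in>B. E a b)"
    and lam: "real (card V) / 2 \<le> lam"
  shows "\<exists>L R. L \<union> R = V \<and> L \<inter> R = {} \<and> real (card V) / 3 \<le> card L \<and> real (card V) / 3 \<le> card R \<and>
    (\<forall>v\<in>L. real (card (non_nbrs E R v)) \<le> 6 * \<tau>) \<and> (\<forall>v\<in>R. real (card (non_nbrs E L v)) \<le> 6 * \<tau>) \<and>
    (\<forall>v\<in>V. 1 - 3 * \<tau> / card V \<le> x v)"
proof -
  define n where "n = real (card V)"
  have k\<tau>: "3 * \<tau> \<le> k * \<tau>" using k3 \<tau>(1) by (intro mult_right_mono) auto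
  have n: "300 * \<tau> \<le> n" "600 \<le> n" "0 < n" using \<tau> k\<tau> unfolding n_def by linarith+
  have lam0: "0 < lam" using lam n unfolding n_def by linarith
  obtain u where u: "u \<in> V" "x u = 1" using x_max by blast
  define A B where "A = nbrs E V u" and "B = V - nbrs E V u"
  have AB: "A \<union> B = V" "A \<inter> B = {}" "A \<subseteq> V" "B \<subseteq> V" unfolding A_def B_def nbrs_def by auto
  have f: "finite V" "finite A" "finite B" using E_D(1) AB(3,4) finite_subset by auto
  have cAB: "real (card A) + card B = n"
    using card_Un_disjoint[OF f(2,3) AB(2)] AB(1) unfolding n_def by simp
  have sA: "sum x A = lam" using eig[OF u(1)] u(2) unfolding A_def by simp
  have deg_split: "card (nbrs E V v) = card (nbrs E A v) + card (nbrs E B v)" for v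
    using card_Un_disjoint[of "nbrs E A v" "nbrs E B v"] f AB nbrs_Un[of E A B v] by (auto simp: nbrs_def)
  have deg_ge: "lam * x v \<le> card (nbrs E V v)" if "v \<in> V" for v
  proof -
    have "(\<Sum>w\<in>nbrs E V v. x w) \<le> (\<Sum>w\<in>nbrs E V v. 1)"
      by (rule sum_mono) (use x_le_1 nbrs_subset in auto)
    then show ?thesis using eig[OF that] by simp
  qed
  define m where "m = real (\<Sum>v\<in>A. card (non_nbrs E B v))"
  have m0: "0 \<le> m" unfolding m_def by (simp del: of_nat_sum)
  have "lam * lam = (\<Sum>v\<in>A. lam * x v)" using sA by (simp flip: sum_distrib_left)
  also have "\<dots> \<le> (\<Sum>v\<in>A. real (card (nbrs E V v)))" by (rule sum_mono) (use deg_ge AB in auto)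
  also have "\<dots> = real (\<Sum>v\<in>A. card (nbrs E A v)) + (\<Sum>v\<in>A. real (card (nbrs E B v)))"
    by (simp add: deg_split sum.distrib)
  also have "(\<Sum>v\<in>A. real (card (nbrs E B v))) = (\<Sum>v\<in>A. card B - real (card (non_nbrs E B v)))"
    by (rule sum.cong) (use card_nbrs_non_nbrs[OF f(3), of E] in \<open>auto simp: algebra_simps\<close>)
  also have "\<dots> = real (card A) * card B - m" unfolding m_def by (simp add: sum_subtractf)
  finally have "lam * lam \<le> real (\<Sum>v\<in>A. card (nbrs E A v)) + (real (card A) * card B - m)" .
  moreover have "real (\<Sum>v\<in>A. card (nbrs E A v)) < \<tau>\<^sup>2"
    by (rule no_dense_pair_in_nbrs[OF kst, where h = u]) (auto simp: A_def)
  moreover have "n / 2 * (n / 2) \<le> lam * lam" using lam n unfolding n_def by (intro mult_mono) auto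
  \<comment> \<open>Completing the square makes one inequality bound both the missing edges
    \<open>m\<close> and the imbalance.\<close>
  moreover have "real (card A) * card B = n / 2 * (n / 2) - (card A - n / 2)\<^sup>2"
    using cAB by (simp add: power2_eq_square algebra_simps flip: cAB)
  ultimately have main: "m + (card A - n / 2)\<^sup>2 \<le> \<tau>\<^sup>2" by linarith
  have m: "m \<le> \<tau>\<^sup>2" using main by (smt (verit) zero_le_power2)
  have "(card A - n / 2)\<^sup>2 \<le> \<tau>\<^sup>2" using main m0 by linarith
  then have "\<bar>card A - n / 2\<bar> \<le> \<tau>" using \<tau>(1) by (simp add: abs_le_square_iff[symmetric])
  then have cA: "n / 2 - \<tau> \<le> card A" "card A \<le> n / 2 + \<tau>"
    and cB: "n / 2 - \<tau> \<le> card B" "card B \<le> n / 2 + \<tau>" using cAB by linarith+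
  have mB: "m = real (\<Sum>v\<in>B. card (non_nbrs E A v))"
    unfolding m_def non_nbrs_def using sum_card_nbrs_swap[OF f(2,3), of "\<lambda>a b. \<not> E a b"] rel_graph_sym[OF graph]
    unfolding nbrs_def by simp
  define A' B' where "A' = {v \<in> A. \<tau> < card (non_nbrs E B v)}" and "B' = {v \<in> B. \<tau> < card (non_nbrs E A v)}"
  have cA': "real (card A') \<le> \<tau>" unfolding A'_def by (rule card_exceeding_le) (use f m \<tau> in \<open>auto simp: m_def\<close>)
  have cB': "real (card B') \<le> \<tau>" unfolding B'_def by (rule card_exceeding_le) (use f m \<tau> in \<open>auto simp: mB\<close>)
  have fA': "finite A'" "finite B'" using f unfolding A'_def B'_def by auto
  have xlow: "1 - 3 * \<tau> / n \<le> x v" if v: "v \<in> V" for v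
  proof -
    have "(2 * k + 1) * (\<tau> + 1) \<le> (3 * real k) * (2 * \<tau>)" using \<tau>(1) k3 by (intro mult_mono) auto
    also have "\<dots> \<le> 6 / 100 * n" using \<tau>(2) unfolding n_def by (simp add: mult_ac)
    also have "\<dots> < card B" using cB n by linarith
    finally have "sum x ((A - A') - {v}) \<le> lam * x v"
      by (intro sum_le_of_common_nbrs[where B = B and \<mu> = \<tau>])
         (use AB v lam0 \<tau> in \<open>auto simp: A'_def non_nbrs_def not_less\<close>)
    moreover have "sum x A = sum x ((A - A') - {v}) + sum x (A \<inter> (A' \<union> {v}))"
    proof -
      have "A = ((A - A') - {v}) \<union> (A \<inter> (A' \<union> {v}))" by blast
      then have "sum x A = sum x (((A - A') - {v}) \<union> (A \<inter> (A' \<union> {v})))" by simp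
      also have "\<dots> = sum x ((A - A') - {v}) + sum x (A \<inter> (A' \<union> {v}))"
        by (rule sum.union_disjoint) (use f in auto)
      finally show ?thesis .
    qed
    moreover have "sum x (A \<inter> (A' \<union> {v})) \<le> (\<Sum>w\<in>A \<inter> (A' \<union> {v}). 1)"
      by (rule sum_mono) (use x_le_1 AB in auto)
    moreover have "card (A \<inter> (A' \<union> {v})) \<le> card (A' \<union> {v})" using fA' by (intro card_mono) auto
    moreover have "card (A' \<union> {v}) \<le> card A' + 1" using fA' by (simp add: card_insert_if)
    ultimately have "lam - (\<tau> + 1) \<le> lam * x v" using sA cA' by simp
    then have "lam * (1 - x v) \<le> \<tau> + 1" by (simp add: algebra_simps)
    moreover have "n / 2 * (1 - x v) \<le> lam * (1 - x v)"
      using lam x_le_1[OF v] unfolding n_def by (intro mult_right_mono) auto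
    ultimately have "n * (1 - x v) \<le> 3 * \<tau>" using \<tau>(1) by linarith
    then have "1 - x v \<le> 3 * \<tau> / n" using n(3) by (simp add: field_simps)
    then show ?thesis by linarith
  qed
  have dlow: "n / 2 - 2 * \<tau> \<le> real (card (nbrs E A v)) + card (nbrs E B v)" if v: "v \<in> V" for v
  proof -
    have "n / 2 * (1 - 3 * \<tau> / n) \<le> lam * x v"
      using lam xlow[OF v] n \<tau> lam0 unfolding n_def[symmetric] by (intro mult_mono) (auto simp: field_simps)
    moreover have "n / 2 * (1 - 3 * \<tau> / n) = n / 2 - 3 * \<tau> / 2" using n by (simp add: field_simps)
    ultimately show ?thesis using deg_ge[OF v] deg_split[of v] \<tau>(1) by linarith
  qed
  \<comment> \<open>Otherwise the two neighbourhoods span at least \<open>4 * \<tau>\<^sup>2\<close>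
    pairs, of which at most \<open>\<tau>\<^sup>2\<close> are missing: too many edges inside the
    neighbourhood of \<open>v\<close>.\<close>
  have dich: "card (nbrs E A v) < 2 * \<tau> \<or> card (nbrs E B v) < 2 * \<tau>" if v: "v \<in> V" for v
  proof (rule ccontr)
    assume "\<not> ?thesis"
    then have big: "2 * \<tau> \<le> card (nbrs E A v)" "2 * \<tau> \<le> card (nbrs E B v)" by auto
    let ?X = "nbrs E A v" and ?Y = "nbrs E B v"
    have fXY: "finite ?X" "finite ?Y" using f by auto
    have "real (\<Sum>w\<in>?X. card (nbrs E ?Y w)) = (\<Sum>w\<in>?X. card ?Y - real (card (non_nbrs E ?Y w)))"
      unfolding of_nat_sum
      by (rule sum.cong) (use card_nbrs_non_nbrs[OF fXY(2), of E] in \<open>auto simp: algebra_simps\<close>)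
    also have "\<dots> = real (card ?X) * card ?Y - (\<Sum>w\<in>?X. real (card (non_nbrs E ?Y w)))"
      by (simp add: sum_subtractf)
    finally have 1: "real (\<Sum>w\<in>?X. card (nbrs E ?Y w)) = real (card ?X) * card ?Y - (\<Sum>w\<in>?X. real (card (non_nbrs E ?Y w)))" .
    have "(\<Sum>w\<in>?X. real (card (non_nbrs E ?Y w))) \<le> (\<Sum>w\<in>?X. real (card (non_nbrs E B w)))"
      by (intro sum_mono of_nat_mono card_mono) (use f in \<open>auto simp: non_nbrs_def\<close>)
    also have "\<dots> \<le> (\<Sum>w\<in>A. real (card (non_nbrs E B w)))"
      by (rule sum_mono2) (use f nbrs_subset in auto)
    finally have 2: "(\<Sum>w\<in>?X. real (card (non_nbrs E ?Y w))) \<le> \<tau>\<^sup>2" using m unfolding m_def by simp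
    have 3: "2 * \<tau> * (2 * \<tau>) \<le> real (card ?X) * card ?Y" using big \<tau>(1) by (intro mult_mono) auto
    have "real (\<Sum>w\<in>?X. card (nbrs E ?Y w)) < \<tau>\<^sup>2"
      by (rule no_dense_pair_in_nbrs[OF kst, where h = v]) (use AB in \<open>auto simp: nbrs_def\<close>)
    moreover have "4 * \<tau>\<^sup>2 \<le> real (card ?X) * card ?Y" using 3 by (simp add: power2_eq_square)
    moreover have "0 \<le> \<tau>\<^sup>2" by simp
    ultimately show False using 1 2 by linarith
  qed
  define L R where "L = {v \<in> V. card (nbrs E A v) < 2 * \<tau>}" and "R = {v \<in> V. \<not> card (nbrs E A v) < 2 * \<tau>}"
  have LR: "L \<union> R = V" "L \<inter> R = {}" unfolding L_def R_def by auto
  have fLR: "finite L" "finite R" using LR f by (metis finite_Un)+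
  have dB: "card (nbrs E B v) \<ge> card B - \<tau>" if "v \<in> A - A'" for v
    using that card_nbrs_non_nbrs[OF f(3), of E v] unfolding A'_def by auto
  have dA: "card (nbrs E A v) \<ge> card A - \<tau>" if "v \<in> B - B'" for v
    using that card_nbrs_non_nbrs[OF f(2), of E v] unfolding B'_def by auto
  have AL: "A - A' \<subseteq> L"
  proof
    fix v assume v: "v \<in> A - A'"
    then have "\<not> card (nbrs E B v) < 2 * \<tau>" using dB[OF v] cB n by auto
    then show "v \<in> L" using dich[of v] v AB unfolding L_def by auto
  qed
  have BR: "B - B' \<subseteq> R"
  proof
    fix v assume v: "v \<in> B - B'"
    then have "\<not> card (nbrs E A v) < 2 * \<tau>" using dA[OF v] cA n by auto
    then show "v \<in> R" using v AB unfolding R_def by auto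
  qed
  have cL: "n / 3 \<le> card L"
  proof -
    have "card A - card A' \<le> card (A - A')" using diff_card_le_card_Diff[OF fA'(1)] by blast
    also have "\<dots> \<le> card L" by (rule card_mono[OF fLR(1) AL])
    finally show ?thesis using cA cA' n by linarith
  qed
  have cR: "n / 3 \<le> card R"
  proof -
    have "card B - card B' \<le> card (B - B')" using diff_card_le_card_Diff[OF fA'(2)] by blast
    also have "\<dots> \<le> card R" by (rule card_mono[OF fLR(2) BR])
    finally show ?thesis using cB cB' n by linarith
  qed
  \<comment> \<open>At most \<open>5 * \<tau>\<close> non-neighbours lie in \<open>B\<close>; the
    rest of \<open>R\<close> lies in \<open>A'\<close>, which adds at most
    \<open>\<tau>\<close>.\<close>
  have mL: "real (card (non_nbrs E R v)) \<le> 6 * \<tau>" if v: "v \<in> L" for v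
  proof -
    have vV: "v \<in> V" and "card (nbrs E A v) < 2 * \<tau>" using v unfolding L_def by auto
    then have "real (card (non_nbrs E B v)) \<le> 5 * \<tau>"
      using dlow[OF vV] card_nbrs_non_nbrs[OF f(3), of E v] cB by linarith
    moreover have "card (non_nbrs E R v) \<le> card (non_nbrs E B v \<union> A')"
      using AL LR AB by (intro card_mono) (use f fA' in \<open>auto simp: non_nbrs_def\<close>)
    moreover have "card (non_nbrs E B v \<union> A') \<le> card (non_nbrs E B v) + card A'" by (rule card_Un_le)
    ultimately show ?thesis using cA' by linarith
  qed
  have mR: "real (card (non_nbrs E L v)) \<le> 6 * \<tau>" if v: "v \<in> R" for v
  proof -
    have vV: "v \<in> V" and "\<not> card (nbrs E A v) < 2 * \<tau>" using v unfolding R_def by auto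
    then have "real (card (non_nbrs E A v)) \<le> 5 * \<tau>"
      using dich[OF vV] dlow[OF vV] card_nbrs_non_nbrs[OF f(2), of E v] cA by linarith
    moreover have "card (non_nbrs E L v) \<le> card (non_nbrs E A v \<union> B')"
      using BR LR AB by (intro card_mono) (use f fA' in \<open>auto simp: non_nbrs_def\<close>)
    moreover have "card (non_nbrs E A v \<union> B') \<le> card (non_nbrs E A v) + card B'" by (rule card_Un_le)
    ultimately show ?thesis using cB' by linarith
  qed
  have "L \<union> R = V \<and> L \<inter> R = {} \<and> real (card V) / 3 \<le> card L \<and> real (card V) / 3 \<le> card R \<and>
    (\<forall>v\<in>L. real (card (non_nbrs E R v)) \<le> 6 * \<tau>) \<and> (\<forall>v\<in>R. real (card (non_nbrs E L v)) \<le> 6 * \<tau>) \<and>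
    (\<forall>v\<in>V. 1 - 3 * \<tau> / card V \<le> x v)"
    unfolding n_def[symmetric]
    by (intro conjI ballI) (fact LR cL cR mL mR xlow)+
  then show ?thesis by (intro exI)
qed

end

section \<open>Degrees and entries of the Perron vector\<close>

text \<open>The assumptions are symmetric in \<open>L\<close> and \<open>R\<close>, so results for
  one part pass to the other through \<open>bipartition_swap\<close>. The error
  \<open>\<tau>\<close> may still be as large as \<open>card V / (100 * k)\<close>; the aim is to
  replace it by bounds in \<open>k\<close> alone.\<close>

locale bipartition = extremal +
  fixes L R :: "'a set" and \<tau> :: real
  assumes LR: "L \<union> R = V" "L \<inter> R = {}"
    and \<tau>: "0 \<le> \<tau>" "100 * k * \<tau> \<le> card V"
    and third: "real (card V) / 3 \<le> card L" "real (card V) / 3 \<le> card R"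
    and few_non_nbrs: "v \<in> L \<Longrightarrow> real (card (non_nbrs E R v)) \<le> 6 * \<tau>"
      "v \<in> R \<Longrightarrow> real (card (non_nbrs E L v)) \<le> 6 * \<tau>"
    and x_low: "v \<in> V \<Longrightarrow> 1 - 3 * \<tau> / card V \<le> x v"
    and large: "1000 * k ^ 6 \<le> card V"
begin

lemma bipartition_swap: "bipartition k V E lam x R L \<tau>"
  by unfold_locales (use LR \<tau> third few_non_nbrs x_low large in auto)

lemma finite_LR: "finite L" "finite R"
  using LR(1) E_D(1) by (metis finite_Un)+

lemma LR_V: "v \<in> L \<Longrightarrow> v \<in> V" "v \<in> R \<Longrightarrow> v \<in> V"
  using LR by auto

lemma card_LR: "card L + card R = card V"
  using card_Un_disjoint[OF finite_LR LR(2)] LR(1) by simp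

lemma large_k: "243000 * real k \<le> card V" "0 < real (card V)"
proof -
  have "243 \<le> k ^ 5" using power_mono[OF k3, of 5] by simp
  then have "243 * k \<le> k ^ 5 * k" by (rule mult_le_mono1)
  also have "k ^ 5 * k = k ^ 6" using power_Suc2[of k 5] by simp
  finally have "243000 * k \<le> 1000 * k ^ 6" by linarith
  then have "243000 * k \<le> card V" using large by linarith
  then have "real (243000 * k) \<le> real (card V)" by (simp only: of_nat_le_iff)
  then show "243000 * real k \<le> card V" by simp
  then show "0 < real (card V)" using k3 by simp
qed

lemma lam_low: "(real (card V) + real (k - 1)) / 2 < lam"
  by (rule lam_gt) (rule less_le_trans[OF target_size[OF k3] large])

lemma lam_pos: "0 < lam"
  using lam_low large_k by simp

text \<open>The vertex \<open>v\<close> and \<open>k\<close> of its neighbours in \<open>L\<close>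
  together miss only a small part of \<open>R\<close>, so more than \<open>2 * k\<close> common
  neighbours would remain for a biclique in the neighbourhood of \<open>v\<close>.\<close>

lemma own_degree_le:
  assumes v: "v \<in> L"
  shows "card (nbrs E L v) \<le> k - 1"
proof (rule ccontr)
  assume "\<not> ?thesis"
  then have "k \<le> card (nbrs E L v)" by simp
  then obtain A where A: "A \<subseteq> nbrs E L v" "card A = k" "finite A" using obtain_subset_with_card_n by blast
  define B where "B = R - (\<Union>w\<in>insert v A. non_nbrs E R w)"
  have fi: "finite (\<Union>w\<in>insert v A. non_nbrs E R w)" using A(3) finite_LR by (simp add: non_nbrs_def)
  have "real (card (\<Union>w\<in>insert v A. non_nbrs E R w)) \<le> real (\<Sum>w\<in>insert v A. card (non_nbrs E R w))"
    unfolding of_nat_le_iff by (rule card_UN_le) (use A in simp)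
  also have "\<dots> = (\<Sum>w\<in>insert v A. real (card (non_nbrs E R w)))" by simp
  also have "\<dots> \<le> (\<Sum>w\<in>insert v A. 6 * \<tau>)" by (rule sum_mono, rule few_non_nbrs(1)) (use A v in auto)
  also have "\<dots> \<le> (real k + 1) * (6 * \<tau>)"
  proof -
    have "card (insert v A) \<le> k + 1" using A by (simp add: card_insert_if)
    then have "real (card (insert v A)) \<le> real k + 1" by linarith
    then show ?thesis using \<tau> unfolding sum_constant by (intro mult_right_mono) auto
  qed
  also have "\<dots> \<le> (2 * real k) * (6 * \<tau>)" using k3 \<tau> by (intro mult_right_mono) auto
  also have "\<dots> \<le> 12 / 100 * card V" using \<tau> by (simp add: mult_ac)
  finally have "real (card (\<Union>w\<in>insert v A. non_nbrs E R w)) \<le> 12 / 100 * card V" .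
  moreover have "card R - card (\<Union>w\<in>insert v A. non_nbrs E R w) \<le> card B"
    unfolding B_def by (rule diff_card_le_card_Diff[OF fi])
  ultimately have "2 * real k < card B" using third(2) large_k k3 by linarith
  then have cB: "2 * k < card B" by linarith
  have nb: "E w b" if "w \<in> insert v A" "b \<in> B" for w b
    using that unfolding B_def non_nbrs_def by blast
  show False
  proof (rule wheel_from_biclique[OF wf graph _ A(3,2) _ cB, of v])
    show "1 \<le> k" using k3 by simp
    show "finite B" using finite_LR unfolding B_def by simp
    show "E a b" if "a \<in> A" "b \<in> B" for a b using nb that by simp
    show "E v b" if "b \<in> B" for b using nb that by simp
    show "E v a" if "a \<in> A" for a using that A(1) by (meson in_nbrs subsetD)
  qed
qed

lemma sum_R_le:
  assumes v: "v \<in> V"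
  shows "sum x (R - {v}) \<le> lam * x v"
proof (rule sum_le_of_common_nbrs[where B = L and \<mu> = "6 * \<tau>"])
  have "(2 * real k + 1) * (6 * \<tau> + 1) \<le> (3 * real k) * (6 * \<tau> + 1)" using k3 \<tau> by (intro mult_right_mono) auto
  also have "\<dots> = 18 * (k * \<tau>) + 3 * k" by (simp add: algebra_simps)
  also have "\<dots> < card V / 3" using \<tau> large_k by simp
  finally have "(2 * real k + 1) * (6 * \<tau> + 1) < card L" using third(1) by linarith
  then show "(2 * k + 1) * (6 * \<tau> + 1) < card L" by (simp add: add.commute)
  show "real (card {b \<in> L. \<not> E w b}) \<le> 6 * \<tau>" if "w \<in> R" for w
    using few_non_nbrs(2)[OF that] unfolding non_nbrs_def .
qed (use LR v \<tau> lam_pos in auto)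

lemma sum_nbrs_V: "sum x (nbrs E V v) = sum x (nbrs E L v) + sum x (nbrs E R v)"
  unfolding LR(1)[symmetric] nbrs_Un
  by (rule sum.union_disjoint) (use finite_LR LR(2) in auto)

lemma sum_nbrs_own_le:
  assumes v: "v \<in> L"
  shows "sum x (nbrs E L v) \<le> real (k - 1)"
proof -
  have "sum x (nbrs E L v) \<le> (\<Sum>w\<in>nbrs E L v. 1)" by (rule sum_mono) (use x_le_1 LR in auto)
  also have "\<dots> \<le> real (k - 1)" using own_degree_le[OF v] by (simp del: of_nat_diff)
  finally show ?thesis .
qed

lemma sum_R_nbrs: "sum x R = sum x (nbrs E R v) + sum x (non_nbrs E R v)"
proof -
  have "R = nbrs E R v \<union> non_nbrs E R v" unfolding nbrs_def non_nbrs_def by blast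
  then have "sum x R = sum x (nbrs E R v \<union> non_nbrs E R v)" by simp
  also have "\<dots> = sum x (nbrs E R v) + sum x (non_nbrs E R v)"
    by (rule sum.union_disjoint) (use finite_LR in \<open>auto simp: nbrs_def non_nbrs_def\<close>)
  finally show ?thesis .
qed

text \<open>Comparing \<open>sum x R \<le> lam * x v\<close> with the eigenvalue equation at
  \<open>v\<close> cancels the neighbours in \<open>R\<close>: the missed vertices weigh at most as
  much as the neighbours in \<open>L\<close>, hence at most \<open>k - 1\<close>.\<close>

lemma non_nbrs_le:
  assumes v: "v \<in> L"
  shows "card (non_nbrs E R v) \<le> k - 1"
proof -
  have vV: "v \<in> V" "R - {v} = R" using v LR by auto
  have "sum x (non_nbrs E R v) \<le> real (k - 1)"
    using sum_R_le[OF vV(1)] eig[OF vV(1)] sum_nbrs_V[of v] sum_nbrs_own_le[OF v] sum_R_nbrs[of v] vV(2) by simp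
  moreover have "(\<Sum>w\<in>non_nbrs E R v. 1 - 3 * \<tau> / card V) \<le> sum x (non_nbrs E R v)"
    by (rule sum_mono) (use x_low LR in \<open>auto simp: non_nbrs_def\<close>)
  ultimately have 1: "card (non_nbrs E R v) * (1 - 3 * \<tau> / card V) \<le> real (k - 1)" by simp
  show ?thesis
  proof (rule ccontr)
    assume "\<not> ?thesis"
    then have ge: "real k \<le> card (non_nbrs E R v)" by simp
    \<comment> \<open>Thus \<open>k\<close> missed vertices would weigh at least
      \<open>k - 3 / 100\<close>, more than \<open>k - 1\<close>.\<close>
    have 2: "k * (3 * \<tau> / card V) \<le> 3 / 100" using \<tau> large_k by (simp add: field_simps)
    then have "3 * (3 * \<tau> / card V) \<le> 3 / 100"
      using mult_right_mono[of 3 "real k" "3 * \<tau> / card V"] k3 \<tau> by simp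
    then have "k * (1 - 3 * \<tau> / card V) \<le> card (non_nbrs E R v) * (1 - 3 * \<tau> / card V)"
      using ge by (intro mult_right_mono) auto
    then have "real k - k * (3 * \<tau> / card V) \<le> real (k - 1)" using 1 by (simp add: right_diff_distrib)
    then show False using 2 k3 by simp
  qed
qed

text \<open>The eigenvalue equation at \<open>u\<close> shows that \<open>R\<close> has weight at
  least \<open>lam - (k - 1)\<close>. The rejoining inequality transfers this to
  \<open>lam * x v\<close>, losing at most 1 if \<open>v\<close> itself lies in
  \<open>R\<close>.\<close>

lemma lam_minus_le_of_L:
  assumes "u \<in> L" "x u = 1" "v \<in> V"
  shows "lam - k \<le> lam * x v"
proof -
  have uV: "u \<in> V" using assms LR by auto
  have nn: "0 \<le> sum x (non_nbrs E R u)" by (rule sum_nonneg) (use x_nonneg LR in \<open>auto simp: non_nbrs_def\<close>)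
  have "lam \<le> sum x R + real (k - 1)"
    using eig[OF uV] assms(2) sum_nbrs_V[of u] sum_nbrs_own_le[OF assms(1)] sum_R_nbrs[of u] nn by simp
  moreover have "sum x R \<le> sum x (R - {v}) + 1"
    using finite_LR x_le_1[OF assms(3)] by (simp add: sum_diff1)
  ultimately show ?thesis using sum_R_le[OF assms(3)] k3 by simp
qed

lemma lam_minus_le: "v \<in> V \<Longrightarrow> lam - k \<le> lam * x v"
  using x_max lam_minus_le_of_L bipartition.lam_minus_le_of_L[OF bipartition_swap] LR(1) by blast

text \<open>The earlier error \<open>3 * \<tau> / card V\<close> need not tend to 0; this one does,
  which permits comparisons accurate to a single edge.\<close>

lemma x_ge:
  assumes v: "v \<in> V"
  shows "1 - 2 * k / card V \<le> x v"
proof -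
  have "lam * (1 - x v) \<le> k" using lam_minus_le[OF v] by (simp add: algebra_simps)
  moreover have "card V / 2 * (1 - x v) \<le> lam * (1 - x v)"
    using lam_low x_le_1[OF v] by (intro mult_right_mono) auto
  ultimately have "card V * (1 - x v) \<le> 2 * k" by linarith
  then have "1 - x v \<le> 2 * k / card V" using large_k by (simp add: field_simps)
  then show ?thesis by linarith
qed

lemma lam_le_card_R: "lam \<le> card R + real k + real (k - 1)"
proof -
  have "L \<noteq> {}" using third(1) large_k by auto
  then obtain v where v: "v \<in> L" by blast
  have "sum x (nbrs E R v) \<le> (\<Sum>w\<in>R. 1)"
    by (rule order_trans[OF sum_mono2 sum_mono]) (use finite_LR x_nonneg x_le_1 LR in auto)
  then have "lam * x v \<le> card R + real (k - 1)"
    using eig[of v] sum_nbrs_V[of v] sum_nbrs_own_le[OF v] v LR by auto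
  then show ?thesis using lam_minus_le[of v] v LR by auto
qed

lemma card_R_ge: "card V / 2 - 2 * k \<le> card R"
  using lam_le_card_R lam_low by simp

lemma card_L_ge: "card V / 2 - 2 * k \<le> card L"
  using bipartition.card_R_ge[OF bipartition_swap] by simp

lemma card_L_le: "card L \<le> card V / 2 + 2 * k" and card_R_le: "card R \<le> card V / 2 + 2 * k"
proof -
  have "real (card L) + card R = card V" using card_LR by (simp flip: of_nat_add)
  then show "card L \<le> card V / 2 + 2 * k" "card R \<le> card V / 2 + 2 * k"
    using card_L_ge card_R_ge by linarith+
qed

text \<open>Summing the eigenvalue equations makes the total of \<open>(?d v - lam) * x v\<close>
  vanish. Replacing the weight \<open>x v\<close> by 1 lowers the total by at most
  \<open>2 * k^2\<close>, because \<open>?d v \<ge> lam - k\<close> and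
  \<open>1 - x v \<le> 2 * k / card V\<close>. Hence the degree sum is at least
  \<open>card V * lam - 2 * k^2\<close>, and the edges across account for at most half of
  \<open>(card V)^2\<close> of it.\<close>

lemma edge_count:
  "real (k - 1) * card V / 2 - 2 * k\<^sup>2 \<le> (\<Sum>v\<in>L. real (card (nbrs E L v))) + (\<Sum>v\<in>R. real (card (nbrs E R v)))
     - 2 * (\<Sum>v\<in>L. real (card (non_nbrs E R v)))"
proof -
  let ?d = "\<lambda>v. real (card (nbrs E V v))"
  define n where "n = real (card V)"
  have n0: "0 < n" using large_k unfolding n_def by simp
  have "(\<Sum>v\<in>V. 1 * (\<Sum>w\<in>nbrs E V v. x w)) = (\<Sum>w\<in>V. x w * (\<Sum>v\<in>nbrs E V w. 1))"
    by (rule sum_nbrs_swap) (use E_D in auto)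
  then have s: "(\<Sum>v\<in>V. lam * x v) = (\<Sum>v\<in>V. x v * ?d v)" using eig by simp
  have "(\<Sum>v\<in>V. (?d v - lam) * x v) = (\<Sum>v\<in>V. x v * ?d v - lam * x v)"
    by (rule sum.cong) (auto simp: algebra_simps)
  then have s0: "(\<Sum>v\<in>V. (?d v - lam) * x v) = 0" using s by (simp add: sum_subtractf)
  have d_ge: "lam - k \<le> ?d v" if v: "v \<in> V" for v
  proof -
    have "(\<Sum>w\<in>nbrs E V v. x w) \<le> (\<Sum>w\<in>nbrs E V v. 1)" by (rule sum_mono) (use x_le_1 in auto)
    then show ?thesis using eig[OF v] lam_minus_le[OF v] by simp
  qed
  have "- (2 * (real k)\<^sup>2) = (\<Sum>v\<in>V. - real k * (2 * k / n))"
    using n0 unfolding n_def by (simp add: power2_eq_square)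
  also have "\<dots> \<le> (\<Sum>v\<in>V. (?d v - lam) * (1 - x v))"
  proof (rule sum_mono)
    fix v assume v: "v \<in> V"
    have "real k * (1 - x v) \<le> real k * (2 * k / n)" using x_ge[OF v] unfolding n_def by (intro mult_left_mono) auto
    moreover have "- real k * (1 - x v) \<le> (?d v - lam) * (1 - x v)"
      using d_ge[OF v] x_le_1[OF v] by (intro mult_right_mono) auto
    ultimately show "- real k * (2 * k / n) \<le> (?d v - lam) * (1 - x v)" by simp
  qed
  also have "\<dots> = (\<Sum>v\<in>V. ?d v - lam) - (\<Sum>v\<in>V. (?d v - lam) * x v)"
    by (simp add: sum_subtractf[symmetric] right_diff_distrib)
  also have "\<dots> = (\<Sum>v\<in>V. ?d v) - n * lam" unfolding s0 n_def by (simp add: sum_subtractf)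
  finally have 1: "n * lam - 2 * (real k)\<^sup>2 \<le> (\<Sum>v\<in>V. ?d v)" by simp
  have "n * ((n + real (k - 1)) / 2) \<le> n * lam" using lam_low n0 unfolding n_def by (intro mult_left_mono) auto
  then have 2: "n * n / 2 + real (k - 1) * n / 2 - 2 * (real k)\<^sup>2 \<le> (\<Sum>v\<in>V. ?d v)" using 1 by (simp add: field_simps)
  have dV: "?d v = real (card (nbrs E L v)) + real (card (nbrs E R v))" for v
  proof -
    have "card (nbrs E L v \<union> nbrs E R v) = card (nbrs E L v) + card (nbrs E R v)"
      by (rule card_Un_disjoint) (use finite_LR LR(2) in auto)
    then show ?thesis unfolding LR(1)[symmetric] nbrs_Un by simp
  qed
  have "(\<Sum>v\<in>V. ?d v) = (\<Sum>v\<in>L. ?d v) + (\<Sum>v\<in>R. ?d v)"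
    unfolding LR(1)[symmetric] by (rule sum.union_disjoint) (use finite_LR LR(2) in auto)
  then have 3: "(\<Sum>v\<in>V. ?d v) = (\<Sum>v\<in>L. real (card (nbrs E L v))) + (\<Sum>v\<in>R. real (card (nbrs E R v)))
      + (\<Sum>v\<in>L. real (card (nbrs E R v))) + (\<Sum>v\<in>R. real (card (nbrs E L v)))"
    unfolding dV by (simp add: sum.distrib)
  have "(\<Sum>v\<in>R. 1 * (\<Sum>w\<in>nbrs E L v. 1)) = (\<Sum>w\<in>L. 1 * (\<Sum>v\<in>nbrs E R w. (1::real)))"
    by (rule sum_nbrs_swap) (use finite_LR E_D(5) in auto)
  then have 4: "(\<Sum>v\<in>R. real (card (nbrs E L v))) = (\<Sum>v\<in>L. real (card (nbrs E R v)))" by simp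
  have "(\<Sum>v\<in>L. real (card (nbrs E R v))) = (\<Sum>v\<in>L. real (card R) - real (card (non_nbrs E R v)))"
    by (rule sum.cong) (use card_nbrs_non_nbrs[OF finite_LR(2), of E] in \<open>auto simp: algebra_simps\<close>)
  then have 5: "(\<Sum>v\<in>L. real (card (nbrs E R v))) = real (card L) * card R - (\<Sum>v\<in>L. real (card (non_nbrs E R v)))"
    by (simp add: sum_subtractf)
  have "n = real (card L) + card R" unfolding n_def using card_LR by (simp flip: of_nat_add)
  then have "n * n = (real (card L) - card R)\<^sup>2 + 4 * (real (card L) * card R)" by (simp add: power2_eq_square algebra_simps)
  then have 6: "4 * (real (card L) * card R) \<le> n * n" by simp
  show ?thesis using 2 3 4 5 6 unfolding n_def[symmetric] by simp
qed

end

section \<open>Typical degrees inside the parts\<close>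

lemma two_elements:
  assumes "2 \<le> card S"
  obtains a b where "a \<in> S" "b \<in> S" "a \<noteq> b"
proof -
  obtain T where "T \<subseteq> S" "card T = 2" "finite T" using obtain_subset_with_card_n[OF assms] by blast
  then show ?thesis using that by (metis card_2_iff insert_subset)
qed

context bipartition
begin

lemma own_degree_R_le: "v \<in> R \<Longrightarrow> card (nbrs E R v) \<le> k - 1"
  using bipartition.own_degree_le[OF bipartition_swap] by simp

text \<open>Degrees inside \<open>R\<close> are below \<open>k\<close>, so \<open>F\<close> together
  with its neighbours in \<open>R\<close> has at most \<open>f * k\<close> elements.\<close>

lemma exists_far:
  assumes F: "finite F" "card F \<le> f" and Z: "Z \<subseteq> R" "f * k < card Z"
  obtains v where "v \<in> Z" "v \<notin> F" "\<And>w. w \<in> nbrs E R v \<Longrightarrow> w \<notin> F"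
proof -
  define X where "X = F \<union> (\<Union>w\<in>F \<inter> R. nbrs E R w)"
  have fX: "finite X" unfolding X_def using F finite_LR by simp
  have "card X \<le> card F + card (\<Union>w\<in>F \<inter> R. nbrs E R w)" unfolding X_def by (rule card_Un_le)
  also have "card (\<Union>w\<in>F \<inter> R. nbrs E R w) \<le> (\<Sum>w\<in>F \<inter> R. card (nbrs E R w))"
    by (rule card_UN_le) (use F in simp)
  also have "\<dots> \<le> (\<Sum>w\<in>F \<inter> R. k - 1)" by (rule sum_mono) (use own_degree_R_le in auto)
  also have "\<dots> \<le> card F * (k - 1)" using F by (simp add: card_mono)
  also have "card F + card F * (k - 1) = card F * k" using k3 by (cases k) auto
  also have "\<dots> \<le> f * k" using F(2) by (rule mult_le_mono1)
  finally have "card X < card Z" using Z(2) by linarith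
  then have "\<not> Z \<subseteq> X" using card_mono[OF fX] by (meson not_le)
  then obtain v where v: "v \<in> Z" "v \<notin> X" by blast
  have "w \<notin> F" if "w \<in> nbrs E R v" for w
    using that v Z(1) E_D(5) unfolding X_def nbrs_def by blast
  then show ?thesis using that v unfolding X_def by blast
qed

lemma path_supply_2:
  assumes "f * k < card {v \<in> R. 1 \<le> card (nbrs E R v)}"
  shows "path_supply E R 2 f"
  unfolding path_supply_def
proof (intro allI impI)
  fix F :: "'a set" assume F: "finite F \<and> card F \<le> f"
  then obtain v where v: "v \<in> {v \<in> R. 1 \<le> card (nbrs E R v)}" "v \<notin> F" "\<And>w. w \<in> nbrs E R v \<Longrightarrow> w \<notin> F"
    using exists_far[of F f, OF _ _ _ assms] by auto
  then have "nbrs E R v \<noteq> {}" by (metis (no_types, lifting) card.empty mem_Collect_eq not_one_le_zero)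
  then obtain w where w: "w \<in> nbrs E R v" by blast
  then have "distinct [v, w] \<and> length [v, w] = 2 \<and> set [v, w] \<subseteq> R - F \<and> successively E [v, w]"
    using v E_D(4)[of v] by auto
  then show "\<exists>p. distinct p \<and> length p = 2 \<and> set p \<subseteq> R - F \<and> successively E p" by (rule exI)
qed

lemma path_supply_3:
  assumes "f * k < card {v \<in> R. 2 \<le> card (nbrs E R v)}"
  shows "path_supply E R 3 f"
  unfolding path_supply_def
proof (intro allI impI)
  fix F :: "'a set" assume F: "finite F \<and> card F \<le> f"
  then obtain v where v: "v \<in> {v \<in> R. 2 \<le> card (nbrs E R v)}" "v \<notin> F" "\<And>w. w \<in> nbrs E R v \<Longrightarrow> w \<notin> F"
    using exists_far[of F f, OF _ _ _ assms] by auto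
  then have "2 \<le> card (nbrs E R v)" by simp
  then obtain u w where w: "u \<in> nbrs E R v" "w \<in> nbrs E R v" "u \<noteq> w" by (rule two_elements)
  then have "distinct [u, v, w] \<and> length [u, v, w] = 3 \<and> set [u, v, w] \<subseteq> R - F \<and> successively E [u, v, w]"
    using v E_D(4)[of v] E_D(5) by auto
  then show "\<exists>p. distinct p \<and> length p = 3 \<and> set p \<subseteq> R - F \<and> successively E p" by (rule exI)
qed

text \<open>A fourth vertex requires control of the degree of a neighbour, so vertices of low degree
  must be few and are avoided along with \<open>F\<close>. Working with the closed neighbourhood
  \<open>F2\<close> keeps also \<open>z\<close>, two steps from \<open>v\<close>, out of
  \<open>F\<close>.\<close>

lemma path_supply_4:
  assumes "3 \<le> b" and "(f + card {v \<in> R. card (nbrs E R v) < b}) * k * k < card R"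
  shows "path_supply E R 4 f"
  unfolding path_supply_def
proof (intro allI impI)
  fix F :: "'a set" assume F: "finite F \<and> card F \<le> f"
  define D where "D = {v \<in> R. card (nbrs E R v) < b}"
  define F1 where "F1 = F \<union> D"
  define F2 where "F2 = F1 \<union> (\<Union>w\<in>F1 \<inter> R. nbrs E R w)"
  have f1: "finite F1" "card F1 \<le> f + card D"
    using F finite_LR card_Un_le[of F D] unfolding F1_def D_def by auto
  have f2: "finite F2" unfolding F2_def using f1 finite_LR by simp
  have "card F2 \<le> card F1 + card (\<Union>w\<in>F1 \<inter> R. nbrs E R w)" unfolding F2_def by (rule card_Un_le)
  also have "card (\<Union>w\<in>F1 \<inter> R. nbrs E R w) \<le> (\<Sum>w\<in>F1 \<inter> R. card (nbrs E R w))"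
    by (rule card_UN_le) (use f1 in simp)
  also have "\<dots> \<le> (\<Sum>w\<in>F1 \<inter> R. k - 1)" by (rule sum_mono) (use own_degree_R_le in auto)
  also have "\<dots> \<le> card F1 * (k - 1)" using f1 by (simp add: card_mono)
  also have "card F1 + card F1 * (k - 1) = card F1 * k" using k3 by (cases k) auto
  also have "\<dots> \<le> (f + card D) * k" using f1(2) by (rule mult_le_mono1)
  finally have c2: "card F2 \<le> (f + card D) * k" by simp
  obtain v where v: "v \<in> R" "v \<notin> F2" "\<And>w. w \<in> nbrs E R v \<Longrightarrow> w \<notin> F2"
    by (rule exists_far[OF f2 c2, of R]) (use assms(2) in \<open>auto simp: D_def\<close>)
  have "v \<notin> D" using v(2) unfolding F2_def F1_def by blast
  then have "2 \<le> card (nbrs E R v)" using v(1) assms(1) unfolding D_def by simp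
  then obtain u w where w: "u \<in> nbrs E R v" "w \<in> nbrs E R v" "u \<noteq> w" by (rule two_elements)
  have "w \<notin> D" using v(3)[OF w(2)] unfolding F2_def F1_def by blast
  then have "3 \<le> card (nbrs E R w)" using w(2) assms(1) unfolding D_def by simp
  moreover have "card (nbrs E R w) \<le> card (nbrs E R w - {u, v}) + card {u, v}"
    by (rule order_trans[OF card_mono card_Un_le]) (use finite_LR in auto)
  moreover have "card {u, v} \<le> 2" by (simp add: card_insert_if)
  ultimately have "card (nbrs E R w - {u, v}) \<noteq> 0" by linarith
  then have "nbrs E R w - {u, v} \<noteq> {}" by (metis card.empty)
  then obtain z where z: "z \<in> nbrs E R w" "z \<noteq> u" "z \<noteq> v" by blast
  have "z \<notin> F" using v(3)[OF w(2)] z(1) w(2) E_D(5) unfolding F2_def F1_def by auto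
  moreover have "u \<notin> F" "w \<notin> F" "v \<notin> F" using v(2) v(3) w unfolding F2_def F1_def by blast+
  ultimately have "distinct [u, v, w, z] \<and> length [u, v, w, z] = 4 \<and> set [u, v, w, z] \<subseteq> R - F \<and> successively E [u, v, w, z]"
    using v(1) w z E_D(4) E_D(5) by auto
  then show "\<exists>p. distinct p \<and> length p = 4 \<and> set p \<subseteq> R - F \<and> successively E p" by (rule exI)
qed

text \<open>All neighbours of \<open>v\<close> in \<open>L\<close> serve as connectors. At most
  \<open>k * k\<close> vertices of \<open>R\<close> miss one of them or \<open>v\<close>; with the
  \<open>2 * k\<close> rim vertices this stays within the budget \<open>4 * k * k\<close>.\<close>

lemma degree_lt_of_supply:
  assumes v: "v \<in> L" "1 \<le> card (nbrs E L v)" and ps: "path_supply E R t (4 * k * k)"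
  shows "card (nbrs E L v) * (t + 1) < 2 * k"
proof (rule ccontr)
  assume "\<not> ?thesis"
  then have ge: "2 * k \<le> card (nbrs E L v) * (t + 1)" by simp
  let ?A = "nbrs E L v"
  define F where "F = (\<Union>w\<in>insert v ?A. non_nbrs E R w)"
  have fA: "finite ?A" using finite_LR by simp
  have "card F \<le> (\<Sum>w\<in>insert v ?A. card (non_nbrs E R w))" unfolding F_def by (rule card_UN_le) (use fA in simp)
  also have "\<dots> \<le> (\<Sum>w\<in>insert v ?A. k - 1)" by (rule sum_mono, rule non_nbrs_le) (use v in auto)
  also have "\<dots> = card (insert v ?A) * (k - 1)" by simp
  also have "\<dots> \<le> k * k"
  proof (rule mult_le_mono)
    have "card (insert v ?A) \<le> card ?A + 1" using fA by (simp only: card_insert_if) simp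
    then show "card (insert v ?A) \<le> k" using own_degree_le[OF v(1)] k3 by linarith
  qed simp
  finally have "card F \<le> k * k" .
  moreover have "2 * k \<le> k * k" using k3 by (intro mult_le_mono1) simp
  ultimately have cF: "card F + 2 * k \<le> 4 * k * k" unfolding mult.assoc by linarith
  show False
  proof (rule wheel_from_supply[OF wf graph fA v(2) _ ge ps _ cF, of v])
    show "card ?A \<le> k" using own_degree_le[OF v(1)] by simp
    show "finite F" unfolding F_def using fA finite_LR by (simp add: non_nbrs_def)
    show "E v r" if "r \<in> R - F" for r using that unfolding F_def non_nbrs_def by blast
    show "E a r" if "a \<in> ?A" "r \<in> R - F" for a r using that unfolding F_def non_nbrs_def by blast
    show "?A \<inter> R = {}" using LR(2) nbrs_def by auto
  qed auto
qed

end

text \<open>The threshold is \<open>k\<close> times the budget \<open>4 * k * k\<close>, which is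
  what \<open>exists_far\<close> needs to supply short paths through vertices of degree at least
  \<open>a\<close>.\<close>

definition typical_degree :: "nat \<Rightarrow> ('a \<Rightarrow> 'a \<Rightarrow> bool) \<Rightarrow> 'a set \<Rightarrow> nat \<Rightarrow> bool" where
  "typical_degree k E S a \<longleftrightarrow> 4 * k * k * k < card {v \<in> S. a \<le> card (nbrs E S v)} \<and>
     card {v \<in> S. a + 1 \<le> card (nbrs E S v)} \<le> 4 * k * k * k"

context bipartition
begin

lemma ex_typical_degree: "\<exists>a\<le>k - 1. typical_degree k E L a"
proof -
  let ?P = "\<lambda>i. 4 * k * k * k < card {v \<in> L. i \<le> card (nbrs E L v)}"
  have "4 * k * k * k < card L"
  proof -
    have "k ^ 3 \<le> k ^ 6" using k3 by (intro power_increasing) auto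
    moreover have "4 * k * k * k = 4 * k ^ 3" by (simp add: power3_eq_cube)
    moreover have "0 < k ^ 6" using k3 by simp
    ultimately have "12 * (4 * k * k * k) < 1000 * k ^ 6" by linarith
    then have "12 * (4 * k * k * k) < card V" using large by linarith
    then have "12 * real (4 * k * k * k) < real (card V)" by (metis of_nat_less_iff of_nat_mult of_nat_numeral)
    then have "real (4 * k * k * k) < real (card L)" using third(1) by linarith
    then show ?thesis by (simp only: of_nat_less_iff)
  qed
  then have P0: "?P 0" by simp
  have e: "{v \<in> L. k \<le> card (nbrs E L v)} = {}" using own_degree_le k3 by fastforce
  have Pk: "\<not> ?P k" unfolding e by simp
  define a where "a = (GREATEST i. ?P i)"
  have bd: "i \<le> k - 1" if "?P i" for i
  proof (rule ccontr)
    assume "\<not> i \<le> k - 1"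
    then have "{v \<in> L. i \<le> card (nbrs E L v)} \<subseteq> {v \<in> L. k \<le> card (nbrs E L v)}" by auto
    then have "card {v \<in> L. i \<le> card (nbrs E L v)} \<le> card {v \<in> L. k \<le> card (nbrs E L v)}"
      by (rule card_mono[rotated]) (use finite_LR in simp)
    then show False using that Pk by linarith
  qed
  have "?P a" unfolding a_def by (rule GreatestI_nat[where P = ?P, OF P0 bd])
  moreover have "\<not> ?P (a + 1)"
    using Greatest_le_nat[where P = ?P and k = "a + 1", OF _ bd] unfolding a_def[symmetric] by auto
  ultimately show ?thesis using bd[of a] unfolding typical_degree_def by auto
qed

text \<open>Vertices above degree \<open>a\<close> add at most \<open>4 * k ^ 4\<close>. The number
  of vertices below \<open>a\<close> is kept on the left so that a matching lower bound on the
  degree sum bounds it.\<close>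

lemma sum_degree_le:
  assumes "typical_degree k E L a"
  shows "(\<Sum>v\<in>L. card (nbrs E L v)) + card {v \<in> L. card (nbrs E L v) < a} \<le> a * card L + 4 * k ^ 4"
proof -
  let ?d = "\<lambda>v. card (nbrs E L v)"
  have "(\<Sum>v\<in>L. ?d v) + card {v \<in> L. ?d v < a} = (\<Sum>v\<in>L. ?d v + (if ?d v < a then 1 else 0))"
    using finite_LR by (simp add: sum.distrib flip: sum.inter_filter)
  also have "\<dots> \<le> (\<Sum>v\<in>L. a + (if a + 1 \<le> ?d v then k else 0))"
  proof (rule sum_mono)
    fix v assume "v \<in> L"
    then have "?d v \<le> k - 1" by (rule own_degree_le)
    then show "?d v + (if ?d v < a then 1 else 0) \<le> a + (if a + 1 \<le> ?d v then k else 0)" by auto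
  qed
  also have "\<dots> = a * card L + card {v \<in> L. a + 1 \<le> ?d v} * k"
    using finite_LR by (simp add: sum.distrib flip: sum.inter_filter)
  also have "card {v \<in> L. a + 1 \<le> ?d v} * k \<le> (4 * k * k * k) * k"
    using assms unfolding typical_degree_def by (intro mult_le_mono1) auto
  also have "(4 * k * k * k) * k = 4 * k ^ 4" by (simp add: power4_eq_xxxx)
  finally show ?thesis by simp
qed

lemma typical_degree_vertex:
  assumes "typical_degree k E L a"
  obtains v where "v \<in> L" "a \<le> card (nbrs E L v)"
proof -
  have "{v \<in> L. a \<le> card (nbrs E L v)} \<noteq> {}" using assms unfolding typical_degree_def
    by (metis card.empty not_less_zero)
  then show ?thesis using that by blast
qed

lemma power_bounds: "1 \<le> k" "k \<le> k ^ 4" "k ^ 2 \<le> k ^ 4" "k ^ 4 \<le> k ^ 6" "k ^ 2 * k ^ 2 = k ^ 4" "k * k = k ^ 2"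
  "k ^ 4 * k * k = k ^ 6" "3 * k \<le> k ^ 2"
proof -
  show "1 \<le> k" using k3 by simp
  then show "k \<le> k ^ 4" "k ^ 2 \<le> k ^ 4" "k ^ 4 \<le> k ^ 6"
    using power_increasing[of 1 4 k] by (auto intro: power_increasing)
  show "k ^ 2 * k ^ 2 = k ^ 4" by (simp flip: power_add)
  show "k * k = k ^ 2" by (simp add: power2_eq_square)
  show "k ^ 4 * k * k = k ^ 6" by (simp add: power_numeral_reduce mult_ac)
  show "3 * k \<le> k ^ 2" unfolding power2_eq_square using k3 by (rule mult_le_mono1)
qed

lemma large_real: "1000 * real k ^ 6 \<le> card V" "real k ^ 4 \<le> real k ^ 6" "real k ^ 2 \<le> real k ^ 4" "real k \<le> real k ^ 4"
proof -
  have "real (1000 * k ^ 6) \<le> real (card V)" using large by (simp only: of_nat_le_iff)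
  then show "1000 * real k ^ 6 \<le> card V" by simp
  show "real k ^ 4 \<le> real k ^ 6" "real k ^ 2 \<le> real k ^ 4" "real k \<le> real k ^ 4"
    using power_bounds by (metis of_nat_le_iff of_nat_power)+
qed

text \<open>Otherwise the degree sums inside the parts fall short of \<open>edge_count\<close> by
  about \<open>card V / 2\<close>, which terms bounded in \<open>k\<close> cannot cover.\<close>

lemma typical_sum_ge:
  assumes a: "typical_degree k E L a" and b: "typical_degree k E R b"
  shows "k - 1 \<le> a + b"
proof (rule ccontr)
  assume "\<not> ?thesis"
  then have "a + b + 1 \<le> k - 1" by simp
  then have ab: "real a + real b + 1 \<le> real (k - 1)" using of_nat_mono[where 'a = real] by fastforce
  have akb: "real a \<le> k" "real b \<le> k" using \<open>a + b + 1 \<le> k - 1\<close> by auto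
  have sL: "(\<Sum>v\<in>L. real (card (nbrs E L v))) \<le> real a * card L + 4 * real k ^ 4"
    using of_nat_mono[where 'a = real, OF order_trans[OF le_add1 sum_degree_le[OF a]]] by simp
  have sR: "(\<Sum>v\<in>R. real (card (nbrs E R v))) \<le> real b * card R + 4 * real k ^ 4"
    using of_nat_mono[where 'a = real, OF order_trans[OF le_add1 bipartition.sum_degree_le[OF bipartition_swap b]]] by simp
  have M: "0 \<le> (\<Sum>v\<in>L. real (card (non_nbrs E R v)))" by (rule sum_nonneg) simp
  have "real a * card L \<le> real a * (card V / 2 + 2 * k)" using card_L_le by (intro mult_left_mono) auto
  moreover have "real b * card R \<le> real b * (card V / 2 + 2 * k)" using card_R_le by (intro mult_left_mono) auto
  moreover have "real a * (2 * k) \<le> k * (2 * k)" "real b * (2 * k) \<le> k * (2 * k)"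
    using akb by (auto intro!: mult_right_mono)
  moreover have "(real a + real b + 1) * card V \<le> real (k - 1) * card V" using ab by (rule mult_right_mono) simp
  ultimately have "card V / 2 \<le> 4 * (real k * k) + 8 * real k ^ 4 + 2 * real k ^ 2"
    using edge_count sL sR M by (simp add: algebra_simps)
  then have "card V \<le> 100 * real k ^ 6" using large_real by (simp add: power2_eq_square)
  moreover have "0 < real k ^ 6" using k3 by simp
  ultimately show False using large_real(1) by linarith
qed

text \<open>Longer paths are unlocked one at a time. Edges in \<open>R\<close> give
  \<open>3 * a < 2 * k\<close>, so \<open>b \<ge> 2\<close>; then \<open>4 * a < 2 * k\<close>
  forces \<open>a = b\<close> and \<open>k - 1 = 2 * a\<close>. This equality in
  \<open>a + b \<ge> k - 1\<close> leaves few vertices below the typical degree, so paths on four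
  vertices exist and \<open>5 * a < 2 * k\<close> is contradictory.\<close>

lemma typical_both_positive:
  assumes a: "typical_degree k E L a" and b: "typical_degree k E R b" and ab: "b \<le> a" "1 \<le> b"
    and k45: "k \<noteq> 4" "k \<noteq> 5"
  shows "k = 3"
proof (rule ccontr)
  assume "k \<noteq> 3"
  then have k6: "6 \<le> k" using k3 k45 by auto
  have sum: "k - 1 \<le> a + b" by (rule typical_sum_ge[OF a b])
  obtain v where v: "v \<in> L" "a \<le> card (nbrs E L v)" using a by (rule typical_degree_vertex)
  have v1: "1 \<le> card (nbrs E L v)" using v(2) ab by simp
  have lt: "a * (t + 1) < 2 * k" if "path_supply E R t (4 * k * k)" for t
    using degree_lt_of_supply[OF v(1) v1 that] v(2) by (meson le_less_trans mult_le_mono1)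
  have bR: "4 * k * k * k < card {v \<in> R. b \<le> card (nbrs E R v)}" using b unfolding typical_degree_def by blast
  have mono: "card {v \<in> R. b \<le> card (nbrs E R v)} \<le> card {v \<in> R. i \<le> card (nbrs E R v)}" if "i \<le> b" for i
    by (rule card_mono) (use finite_LR that in auto)
  have "path_supply E R 2 (4 * k * k)"
    by (rule path_supply_2) (use bR mono[OF ab(2)] in linarith)
  then have a3: "3 * a < 2 * k" using lt[of 2] by simp
  then have b2: "2 \<le> b" using sum k6 by linarith
  have "path_supply E R 3 (4 * k * k)"
    by (rule path_supply_3) (use bR mono[OF b2] in linarith)
  then have "4 * a < 2 * k" using lt[of 3] by simp
  then have eq: "b = a" "k - 1 = 2 * a" using sum ab k6 by linarith+
  then have a3: "3 \<le> a" using k6 by linarith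
  define D where "D = card {v \<in> R. card (nbrs E R v) < a}"
  have sL: "(\<Sum>v\<in>L. real (card (nbrs E L v))) \<le> real a * card L + 4 * real k ^ 4"
    using of_nat_mono[where 'a = real, OF order_trans[OF le_add1 sum_degree_le[OF a]]] by simp
  have sR: "(\<Sum>v\<in>R. real (card (nbrs E R v))) + real D \<le> real a * card R + 4 * real k ^ 4"
    using of_nat_mono[where 'a = real, OF bipartition.sum_degree_le[OF bipartition_swap b]] unfolding D_def eq(1) by simp
  have M: "0 \<le> (\<Sum>v\<in>L. real (card (non_nbrs E R v)))" by (rule sum_nonneg) simp
  have "real (k - 1) = 2 * real a" unfolding eq(2) by simp
  moreover have "real a * card L + real a * card R = real a * card V"
    using card_LR by (simp flip: of_nat_add distrib_left)
  ultimately have "real D \<le> 8 * real k ^ 4 + 2 * real k ^ 2" using edge_count sL sR M by simp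
  then have "real D \<le> 10 * real k ^ 4" using large_real by linarith
  then have "real D \<le> real (10 * k ^ 4)" by simp
  then have D: "D \<le> 10 * k ^ 4" by (simp only: of_nat_le_iff)
  have "(4 * k * k + D) * k * k \<le> (14 * k ^ 4) * k * k"
  proof (intro mult_le_mono1)
    show "4 * k * k + D \<le> 14 * k ^ 4" using D power_bounds(3,6) by (simp add: mult.assoc)
  qed
  also have "\<dots> = 14 * k ^ 6" using power_bounds(7) by simp
  also have "\<dots> < card R"
  proof -
    have "0 < k ^ 6" using k3 by simp
    then have "3 * (14 * k ^ 6) < card V" using large by linarith
    then have "3 * real (14 * k ^ 6) < real (card V)" by (metis of_nat_less_iff of_nat_mult of_nat_numeral)
    then have "real (14 * k ^ 6) < real (card R)" using third(2) by linarith
    then show ?thesis by (simp only: of_nat_less_iff)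
  qed
  finally have "path_supply E R 4 (4 * k * k)"
    by (intro path_supply_4[OF a3]) (simp add: D_def)
  then have "5 * a < 2 * k" using lt[of 4] by simp
  then show False using eq a3 k6 by linarith
qed

text \<open>The supply of edges in \<open>R\<close> gives \<open>3 * d < 6\<close> for the degree
  \<open>d\<close> of every vertex of \<open>L\<close>, not only of most of them.\<close>

lemma degrees_le_1_of_typical:
  assumes b: "typical_degree k E R b" "1 \<le> b" and k: "k = 3" and v: "v \<in> L"
  shows "card (nbrs E L v) \<le> 1"
proof (rule ccontr)
  assume n: "\<not> ?thesis"
  have "path_supply E R 2 (4 * k * k)"
  proof (rule path_supply_2)
    have "card {v \<in> R. b \<le> card (nbrs E R v)} \<le> card {v \<in> R. 1 \<le> card (nbrs E R v)}"
      by (rule card_mono) (use finite_LR b in auto)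
    then show "4 * k * k * k < card {v \<in> R. 1 \<le> card (nbrs E R v)}"
      using b(1) unfolding typical_degree_def by linarith
  qed
  then have "card (nbrs E L v) * (2 + 1) < 2 * k" by (intro degree_lt_of_supply[OF v]) (use n in auto)
  then show False using k n by simp
qed

text \<open>This is the case of typical degrees \<open>k - 1\<close> in \<open>L\<close> and 0 in
  \<open>R\<close>, expressed by totals of the three kinds of defects.\<close>

definition concentrated :: bool where
  "concentrated \<longleftrightarrow> (\<Sum>v\<in>R. real (card (nbrs E R v))) \<le> 10 * real k ^ 4 \<and>
    real (k - 1) * card L - (\<Sum>v\<in>L. real (card (nbrs E L v))) \<le> 10 * real k ^ 4 \<and>
    (\<Sum>v\<in>L. real (card (non_nbrs E R v))) \<le> 10 * real k ^ 4"

lemma concentrated_of_typical: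
  assumes a: "typical_degree k E L a" and b: "typical_degree k E R 0" and ak: "a \<le> k - 1"
  shows concentrated
proof -
  have eq: "a = k - 1" using typical_sum_ge[OF a b] ak by simp
  have sL: "(\<Sum>v\<in>L. real (card (nbrs E L v))) \<le> real (k - 1) * card L"
  proof -
    have "(\<Sum>v\<in>L. real (card (nbrs E L v))) \<le> (\<Sum>v\<in>L. real (k - 1))"
      by (rule sum_mono) (use own_degree_le in \<open>auto simp del: of_nat_diff\<close>)
    then show ?thesis by (simp add: mult.commute)
  qed
  have sR: "(\<Sum>v\<in>R. real (card (nbrs E R v))) \<le> 4 * real k ^ 4"
    using of_nat_mono[where 'a = real, OF order_trans[OF le_add1 bipartition.sum_degree_le[OF bipartition_swap b]]] by simp
  have M: "0 \<le> (\<Sum>v\<in>L. real (card (non_nbrs E R v)))" by (rule sum_nonneg) simp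
  have "real (k - 1) * card L \<le> real (k - 1) * (card V / 2 + 2 * k)" using card_L_le by (intro mult_left_mono) auto
  moreover have "real (k - 1) * (2 * real k) \<le> real k * (2 * real k)" by (intro mult_right_mono) auto
  ultimately have L1: "real (k - 1) * card L \<le> real (k - 1) * card V / 2 + 2 * real k ^ 2"
    by (simp add: algebra_simps power2_eq_square)
  show ?thesis unfolding concentrated_def
    using edge_count sL sR M L1 large_real(2-4) by auto
qed

theorem concentrated_cases:
  assumes "k \<noteq> 4" "k \<noteq> 5"
  shows "concentrated \<or> bipartition.concentrated k E R L \<or>
    (k = 3 \<and> (\<forall>v\<in>L. card (nbrs E L v) \<le> 1) \<and> (\<forall>v\<in>R. card (nbrs E R v) \<le> 1))"
proof -
  note sw = bipartition_swap
  obtain a where a: "a \<le> k - 1" "typical_degree k E L a" using ex_typical_degree by blast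
  obtain b where b: "b \<le> k - 1" "typical_degree k E R b" using bipartition.ex_typical_degree[OF sw] by blast
  consider "a = 0" | "b = 0" | "1 \<le> a" "1 \<le> b" by linarith
  then show ?thesis
  proof cases
    case 1
    then show ?thesis using bipartition.concentrated_of_typical[OF sw b(2) _ b(1)] a by simp
  next
    case 2
    then show ?thesis using concentrated_of_typical[OF a(2) _ a(1)] b by simp
  next
    case 3
    have k: "k = 3"
    proof (cases "b \<le> a")
      case True
      then show ?thesis using typical_both_positive[OF a(2) b(2) _ 3(2)] assms by simp
    next
      case False
      then show ?thesis using bipartition.typical_both_positive[OF sw b(2) a(2) _ 3(1)] assms by simp
    qed
    then show ?thesis
      using degrees_le_1_of_typical[OF b(2) 3(2)] bipartition.degrees_le_1_of_typical[OF sw a(2) 3(1)] by simp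
  qed
qed

end

section \<open>Exact structure\<close>

lemma handshake:
  assumes "finite W" "\<And>u v. U u v \<Longrightarrow> U v u" "\<And>u. \<not> U u u"
  shows "even (\<Sum>v\<in>W. card (nbrs U W v))"
  using assms(1)
proof induction
  case (insert w W)
  have n: "card (nbrs U (insert w W) v) = card (nbrs U W v) + (if U w v then 1 else 0)" if "v \<in> W" for v
  proof -
    have "nbrs U (insert w W) v = (if U w v then insert w (nbrs U W v) else nbrs U W v)"
      using assms(2) unfolding nbrs_def by auto
    then show ?thesis using insert by simp
  qed
  have "nbrs U (insert w W) w = nbrs U W w" using assms(3) unfolding nbrs_def by auto
  moreover have "(\<Sum>v\<in>W. card (nbrs U (insert w W) v)) = (\<Sum>v\<in>W. card (nbrs U W v)) + card (nbrs U W w)"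
    using n insert(1) by (simp add: sum.distrib nbrs_def flip: sum.inter_filter)
  ultimately show ?case using insert by simp
qed simp

text \<open>Writing \<open>x = 1 - (1 - x)\<close> separates a term linear in the degrees from one
  of second order in \<open>1 - x\<close>. The latter is nonnegative for \<open>x \<le> 1\<close>
  and O(1/n) for bounded degrees.\<close>

lemma quad_part_expand:
  fixes x :: "'a \<Rightarrow> real"
  assumes "finite W" "\<And>u v. U u v \<Longrightarrow> U v u"
  shows "(\<Sum>u\<in>W. x u * (\<Sum>w\<in>nbrs U W u. x w)) = (\<Sum>u\<in>W. (2 * x u - 1) * card (nbrs U W u))
     + (\<Sum>u\<in>W. (1 - x u) * (\<Sum>w\<in>nbrs U W u. 1 - x w))"
proof -
  have sw: "(\<Sum>u\<in>W. 1 * (\<Sum>w\<in>nbrs U W u. x w)) = (\<Sum>w\<in>W. x w * (\<Sum>u\<in>nbrs U W w. 1))"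
    by (rule sum_nbrs_swap[OF assms(1,1)]) (use assms(2) in blast)
  have "(\<Sum>u\<in>W. (1 - x u) * (\<Sum>w\<in>nbrs U W u. 1 - x w)) =
     (\<Sum>u\<in>W. (1 - x u) * card (nbrs U W u) - (\<Sum>w\<in>nbrs U W u. x w) + x u * (\<Sum>w\<in>nbrs U W u. x w))"
    by (rule sum.cong) (auto simp: sum_subtractf algebra_simps)
  also have "\<dots> = (\<Sum>u\<in>W. (1 - x u) * card (nbrs U W u)) - (\<Sum>u\<in>W. x u * card (nbrs U W u))
     + (\<Sum>u\<in>W. x u * (\<Sum>w\<in>nbrs U W u. x w))"
    using sw by (simp add: sum.distrib sum_subtractf)
  also have "(\<Sum>u\<in>W. (1 - x u) * card (nbrs U W u)) - (\<Sum>u\<in>W. x u * card (nbrs U W u))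
     = - (\<Sum>u\<in>W. (2 * x u - 1) * card (nbrs U W u))"
    by (simp add: sum_subtractf[symmetric] sum_negf[symmetric] algebra_simps)
  finally show ?thesis by simp
qed

context bipartition
begin

lemma less_card_L: "3 * m < card V \<Longrightarrow> m < card L"
  using third(1) by linarith

text \<open>With \<open>k - 1\<close> connectors the rim needs \<open>k + 1\<close> vertices of
  \<open>R\<close>, two more than one per segment. The list \<open>ss0\<close> provides this
  surplus, either by a path on three vertices or by two disjoint edges; single vertices complete the
  rim.\<close>

lemma wheel_from_two_edges:
  assumes v: "v \<in> L" "card (nbrs E L v) = k - 1"
    and full: "\<And>w r. w \<in> insert v (nbrs E L v) \<Longrightarrow> r \<in> R \<Longrightarrow> E w r"
    and ss0: "distinct (concat ss0)" "set (concat ss0) \<subseteq> R" "\<And>s. s \<in> set ss0 \<Longrightarrow> s \<noteq> [] \<and> successively E s"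
    and len: "length (concat ss0) = length ss0 + 2" "length ss0 \<le> 2"
  shows False
proof -
  let ?A = "nbrs E L v"
  have fA: "finite ?A" using finite_LR by simp
  have "length (concat ss0) + (k - 1 - length ss0) \<le> 4 + k" using len by linarith
  then have "real (length (concat ss0) + (k - 1 - length ss0)) \<le> 4 + real k" by linarith
  also have "\<dots> \<le> card R" using third(2) large_k k3 by linarith
  finally have "length (concat ss0) + (k - 1 - length ss0) \<le> card R" by (simp only: of_nat_le_iff)
  moreover have "card (set (concat ss0)) = length (concat ss0)" using ss0(1) by (rule distinct_card)
  moreover have "card (R - set (concat ss0)) = card R - card (set (concat ss0))"
    using ss0(2) by (intro card_Diff_subset) auto
  ultimately have "k - 1 - length ss0 \<le> card (R - set (concat ss0))" by linarith
  then obtain S where S: "S \<subseteq> R - set (concat ss0)" "card S = k - 1 - length ss0" "finite S"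
    using obtain_subset_with_card_n by blast
  obtain rs where rs: "set rs = S" "distinct rs" using finite_distinct_list[OF S(3)] by blast
  obtain as where as: "set as = ?A" "distinct as" using finite_distinct_list[OF fA] by blast
  have lrs: "length rs = k - 1 - length ss0" using distinct_card[OF rs(2)] rs(1) S(2) by simp
  have las: "length as = k - 1" using distinct_card[OF as(2)] as(1) v(2) by simp
  define ss where "ss = ss0 @ map (\<lambda>r. [r]) rs"
  have cs: "concat ss = concat ss0 @ rs" unfolding ss_def by simp
  have R: "set (concat ss) \<subseteq> R" unfolding cs using ss0(2) S(1) rs(1) by auto
  show False
  proof (rule wheel_from_segments[OF wf, of as ss v])
    show "length as = length ss" unfolding ss_def using las lrs len(2) k3 by simp
    show "as \<noteq> []" using las k3 by auto
    show "distinct (concat ss)" unfolding cs using ss0(1) rs S(1) by auto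
    show "set as \<inter> set (concat ss) = {}" using as(1) R LR(2) nbrs_subset[of E L v] by blast
    show "s \<noteq> [] \<and> successively E s" if "s \<in> set ss" for s using that ss0(3) unfolding ss_def by auto
    show "E a r \<and> E r a" if "a \<in> set as" "r \<in> set (concat ss)" for a r
      using full[of a r] that as(1) R E_D(5) by blast
    show "E v w" if "w \<in> set as" for w using that as(1) by simp
    show "E v r" if "r \<in> set (concat ss)" for r using full[of v r] that R by blast
    show "length as + length (concat ss) = 2 * k" unfolding cs using las lrs len k3 by simp
  qed (rule as(2))
qed

lemma nat_bounds_of_concentrated:
  assumes c: concentrated
  shows "card {v \<in> L. card (nbrs E L v) < k - 1} \<le> 10 * k ^ 4"
    and "card {v \<in> L. non_nbrs E R v \<noteq> {}} \<le> 10 * k ^ 4"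
proof -
  have "real (card {v \<in> L. card (nbrs E L v) < k - 1}) = (\<Sum>v\<in>L. if card (nbrs E L v) < k - 1 then 1 else 0)"
    using finite_LR by (simp flip: sum.inter_filter)
  also have "\<dots> \<le> (\<Sum>v\<in>L. real (k - 1) - card (nbrs E L v))"
  proof (rule sum_mono)
    fix v assume "v \<in> L"
    then have "card (nbrs E L v) \<le> k - 1" by (rule own_degree_le)
    then show "(if card (nbrs E L v) < k - 1 then 1 else 0) \<le> real (k - 1) - card (nbrs E L v)" by auto
  qed
  also have "\<dots> = real (k - 1) * card L - (\<Sum>v\<in>L. real (card (nbrs E L v)))" by (simp add: sum_subtractf)
  also have "\<dots> \<le> real (10 * k ^ 4)" using c unfolding concentrated_def by simp
  finally show "card {v \<in> L. card (nbrs E L v) < k - 1} \<le> 10 * k ^ 4" by (simp only: of_nat_le_iff)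
  have "real (card {v \<in> L. non_nbrs E R v \<noteq> {}}) = (\<Sum>v\<in>L. if non_nbrs E R v \<noteq> {} then 1 else 0)"
    using finite_LR by (simp flip: sum.inter_filter)
  also have "\<dots> \<le> (\<Sum>v\<in>L. real (card (non_nbrs E R v)))"
  proof (rule sum_mono)
    fix v assume "v \<in> L"
    have "finite (non_nbrs E R v)" unfolding non_nbrs_def using finite_LR by simp
    then show "(if non_nbrs E R v \<noteq> {} then 1 else 0) \<le> real (card (non_nbrs E R v))"
      by (simp add: Suc_le_eq card_gt_0_iff)
  qed
  also have "\<dots> \<le> real (10 * k ^ 4)" using c unfolding concentrated_def by simp
  finally show "card {v \<in> L. non_nbrs E R v \<noteq> {}} \<le> 10 * k ^ 4" by (simp only: of_nat_le_iff)
qed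

text \<open>As defects are few, some \<open>v\<close> of full degree in \<open>L\<close> is joined
  to all of \<open>R\<close> together with its neighbours in \<open>L\<close>. Two different edges
  inside \<open>R\<close> either share a vertex or are disjoint, and both situations supply the
  surplus for a rim.\<close>

lemma edge_in_R_unique:
  assumes c: concentrated and e: "E a b" "E c' d" "a \<in> R" "b \<in> R" "c' \<in> R" "d \<in> R"
  shows "{a, b} = {c', d}"
proof (rule ccontr)
  assume ne: "{a, b} \<noteq> {c', d}"
  define X where "X = {v \<in> L. non_nbrs E R v \<noteq> {}}"
  define Z where "Z = L - {v \<in> L. card (nbrs E L v) < k - 1}"
  have X: "finite X" "card X \<le> 10 * k ^ 4" using finite_LR nat_bounds_of_concentrated(2)[OF c] unfolding X_def by auto
  have "k ^ 4 * k * 1 \<le> k ^ 4 * k * k" by (rule mult_le_mono2) (use k3 in simp)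
  then have k5: "k ^ 4 * k \<le> k ^ 6" "k ^ 4 \<le> k ^ 6" "0 < k ^ 6" using power_bounds(4,7) k3 by auto
  have "10 * k ^ 4 * k < card Z"
  proof -
    have "3 * (10 * k ^ 4 * k + 10 * k ^ 4) < card V"
      using large k5 unfolding mult.assoc add_mult_distrib2 by linarith
    then have "10 * k ^ 4 * k + 10 * k ^ 4 < card L" by (rule less_card_L)
    moreover have "card L - card {v \<in> L. card (nbrs E L v) < k - 1} \<le> card Z"
      unfolding Z_def by (rule diff_card_le_card_Diff) (use finite_LR in simp)
    ultimately show ?thesis using nat_bounds_of_concentrated(1)[OF c] by linarith
  qed
  then obtain v where v: "v \<in> Z" "v \<notin> X" "\<And>w. w \<in> nbrs E L v \<Longrightarrow> w \<notin> X"
    using bipartition.exists_far[OF bipartition_swap X, of Z] unfolding Z_def by blast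
  have vL: "v \<in> L" using v unfolding Z_def by blast
  have dv: "card (nbrs E L v) = k - 1" using v(1) own_degree_le[OF vL] unfolding Z_def by simp
  have full: "E w r" if "w \<in> insert v (nbrs E L v)" "r \<in> R" for w r
  proof -
    have "w \<in> L" "w \<notin> X" using that(1) v(2,3) vL by auto
    then show ?thesis using that(2) unfolding X_def non_nbrs_def by blast
  qed
  note wheel = wheel_from_two_edges[OF vL dv full]
  have path3: False if "E p q" "E q r" "p \<noteq> r" "p \<in> R" "q \<in> R" "r \<in> R" for p q r
  proof (rule wheel[of "[[p, q, r]]"])
    have "p \<noteq> q" "q \<noteq> r" using that E_D(4) by auto
    then show "distinct (concat [[p, q, r]])" using that by auto
  qed (use that in auto)
  note s = E_D(5)
  have "a \<noteq> b" "c' \<noteq> d" using e E_D(4) by auto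
  consider "a = c'" | "a = d" | "b = c'" | "b = d" | "{a, b} \<inter> {c', d} = {}" by blast
  then show False
  proof cases
    case 1 then show False using path3[of b a d] s e ne by auto
  next
    case 2 then show False using path3[of b a c'] s e ne by (auto simp: insert_commute)
  next
    case 3 then show False using path3[of a b d] s e ne by (auto simp: insert_commute)
  next
    case 4 then show False using path3[of a b c'] s e ne by auto
  next
    case 5
    show False
      by (rule wheel[of "[[a, b], [c', d]]"]) (use 5 e \<open>a \<noteq> b\<close> \<open>c' \<noteq> d\<close> in auto)
  qed
qed

lemma sum_degree_R_le_2:
  assumes c: concentrated
  shows "(\<Sum>v\<in>R. card (nbrs E R v)) \<le> 2"
proof (cases "\<exists>a\<in>R. \<exists>b\<in>R. E a b")
  case True
  then obtain a b where ab: "a \<in> R" "b \<in> R" "E a b" by blast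
  have n: "nbrs E R v \<subseteq> (if v = a then {b} else if v = b then {a} else {})" if "v \<in> R" for v
  proof
    fix w assume w: "w \<in> nbrs E R v"
    then have "{a, b} = {v, w}" using edge_in_R_unique[OF c ab(3), of v w] ab that by auto
    then show "w \<in> (if v = a then {b} else if v = b then {a} else {})" by (auto simp: doubleton_eq_iff)
  qed
  have "(\<Sum>v\<in>R. card (nbrs E R v)) \<le> (\<Sum>v\<in>R. (if v = a then 1 else 0) + (if v = b then 1 else 0))"
  proof (rule sum_mono)
    fix v assume "v \<in> R"
    then have "card (nbrs E R v) \<le> card (if v = a then {b} else if v = b then {a} else {})"
      by (intro card_mono n) auto
    then show "card (nbrs E R v) \<le> (if v = a then 1 else 0) + (if v = b then 1 else 0)"
      by (auto split: if_splits)
  qed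
  also have "\<dots> = 2" using ab finite_LR by (simp add: sum.distrib)
  finally show ?thesis .
next
  case False
  then have "nbrs E R v = {}" if "v \<in> R" for v using that unfolding nbrs_def by blast
  then show ?thesis by simp
qed

text \<open>The competitor \<open>H\<close> is evaluated at the Perron vector of \<open>E\<close>,
  so no information on its own eigenvector is required. In \<open>total\<close> the integers
  \<open>SH - SE\<close>, \<open>2 - SR\<close> and \<open>M\<close> are all nonnegative, and their
  sum with nearly integral weights is at most 1 / 5; hence all of them vanish.\<close>

theorem concentrated_structure:
  assumes c: concentrated
  shows "\<And>u v. u \<in> L \<Longrightarrow> v \<in> R \<Longrightarrow> E u v"
    and "(k - 1) * card L \<le> (\<Sum>v\<in>L. card (nbrs E L v)) + 1"
    and "(\<Sum>v\<in>R. card (nbrs E R v)) = 2"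
proof -
  define n where "n = real (card V)"
  define \<epsilon> where "\<epsilon> = 2 * k / n"
  have n: "243000 * real k \<le> n" "0 < n" using large_k unfolding n_def by auto
  have \<epsilon>: "0 \<le> \<epsilon>" "\<epsilon> \<le> 1 / 100000" unfolding \<epsilon>_def using n by (auto simp: field_simps)
  have xe: "1 - \<epsilon> \<le> x v" if "v \<in> V" for v using x_ge[OF that] unfolding \<epsilon>_def n_def by simp
  have sq: "1 - 2 * \<epsilon> \<le> x u * x v" if "u \<in> V" "v \<in> V" for u v
  proof -
    have "(1 - \<epsilon>) * (1 - \<epsilon>) \<le> x u * x v" using xe that \<epsilon> x_nonneg by (intro mult_mono) auto
    moreover have "(1 - \<epsilon>) * (1 - \<epsilon>) = 1 - 2 * \<epsilon> + \<epsilon> * \<epsilon>" by (simp add: algebra_simps)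
    moreover have "0 \<le> \<epsilon> * \<epsilon>" by simp
    ultimately show ?thesis by linarith
  qed
  have "3 * (k * (2 * k - 2) + k + 1) < card V" using target_size[OF k3] large by (rule less_le_trans)
  then have lL: "k * (2 * k - 2) + k + 1 \<le> card L" by (rule less_imp_le[OF less_card_L])
  have "real 2 \<le> card R" using third(2) large_k k3 by simp
  then have lR: "2 \<le> card R" by (simp only: of_nat_le_iff)
  obtain H where H: "target k L R H" using target_exists[OF k3 finite_LR LR(2) lL lR] by blast
  then have Hg: "rel_graph (L \<union> R) H" "wheel_free k H" "\<And>u v. u \<in> L \<Longrightarrow> v \<in> R \<Longrightarrow> H u v"
    and dH: "\<And>v. v \<in> L \<Longrightarrow> card (nbrs H L v) \<le> k - 1"
    and dL: "(k - 1) * card L \<le> (\<Sum>v\<in>L. card (nbrs H L v)) + 1" unfolding target_def by blast+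
  obtain r1 r2 where r: "r1 \<noteq> r2" "r1 \<in> R" "r2 \<in> R" "\<And>u v. u \<in> R \<Longrightarrow> v \<in> R \<Longrightarrow> H u v \<longleftrightarrow> {u, v} = {r1, r2}"
    using H unfolding target_def by blast
  have nL: "nbrs H R u = R" if "u \<in> L" for u using Hg(3) that unfolding nbrs_def by blast
  have nr: "nbrs H R u = (if u = r1 then {r2} else if u = r2 then {r1} else {})" if "u \<in> R" for u
    using that r by (auto simp: doubleton_eq_iff nbrs_def)
  define Q where "Q G S = (\<Sum>u\<in>S. x u * (\<Sum>v\<in>nbrs G S u. x v))" for G S
  define SE SH SR M where "SE = (\<Sum>v\<in>L. card (nbrs E L v))" and "SH = (\<Sum>v\<in>L. card (nbrs H L v))"
    and "SR = (\<Sum>v\<in>R. card (nbrs E R v))" and "M = (\<Sum>v\<in>L. card (non_nbrs E R v))"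
  have "quad V H x \<le> quad V E x" using maximal[of H x] Hg(1,2) LR(1) quad_x by simp
  then have q: "Q H L + Q H R + 2 * (\<Sum>u\<in>L. x u * sum x R) \<le> Q E L + Q E R + 2 * (\<Sum>u\<in>L. x u * sum x (nbrs E R u))"
    using quad_split[OF Hg(1) LR(2), of x] quad_split[of L R E x] graph LR nL unfolding Q_def by simp
  have "(\<Sum>u\<in>L. x u * sum x R) = (\<Sum>u\<in>L. x u * sum x (nbrs E R u) + x u * sum x (non_nbrs E R u))"
  proof (rule sum.cong[OF refl])
    fix u
    show "x u * sum x R = x u * sum x (nbrs E R u) + x u * sum x (non_nbrs E R u)"
      unfolding sum_R_nbrs[of u] by (rule distrib_left)
  qed
  then have cross: "(\<Sum>u\<in>L. x u * sum x R) = (\<Sum>u\<in>L. x u * sum x (nbrs E R u)) + (\<Sum>u\<in>L. x u * sum x (non_nbrs E R u))"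
    by (simp add: sum.distrib)
  have "(1 - 2 * \<epsilon>) * real M = (\<Sum>u\<in>L. (1 - 2 * \<epsilon>) * real (card (non_nbrs E R u)))"
    unfolding M_def by (simp add: sum_distrib_left)
  also have "\<dots> \<le> (\<Sum>u\<in>L. x u * sum x (non_nbrs E R u))"
  proof (rule sum_mono)
    fix u assume u: "u \<in> L"
    have "(1 - 2 * \<epsilon>) * real (card (non_nbrs E R u)) = (\<Sum>w\<in>non_nbrs E R u. 1 - 2 * \<epsilon>)" by simp
    also have "\<dots> \<le> (\<Sum>w\<in>non_nbrs E R u. x u * x w)"
      by (rule sum_mono) (use sq u LR in \<open>auto simp: non_nbrs_def\<close>)
    finally show "(1 - 2 * \<epsilon>) * real (card (non_nbrs E R u)) \<le> x u * sum x (non_nbrs E R u)"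
      by (simp add: sum_distrib_left)
  qed
  finally have miss: "(1 - 2 * \<epsilon>) * real M \<le> (\<Sum>u\<in>L. x u * sum x (non_nbrs E R u))" .
  have "Q H R = (\<Sum>u\<in>{r1, r2}. x u * (\<Sum>v\<in>nbrs H R u. x v))"
    unfolding Q_def using r nr finite_LR by (intro sum.mono_neutral_right) auto
  then have "Q H R = 2 * (x r1 * x r2)" using r nr by simp
  then have QHR: "2 - 4 * \<epsilon> \<le> Q H R" using sq[of r1 r2] LR_V(2)[OF r(2)] LR_V(2)[OF r(3)] by simp
  have QER: "Q E R \<le> real SR"
    unfolding Q_def SR_def of_nat_sum
  proof (rule sum_mono)
    fix u assume u: "u \<in> R"
    have "sum x (nbrs E R u) \<le> (\<Sum>w\<in>nbrs E R u. 1)" by (rule sum_mono) (use x_le_1 LR in auto)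
    moreover have "0 \<le> sum x (nbrs E R u)" by (rule sum_nonneg) (use x_nonneg LR in auto)
    ultimately have "x u * sum x (nbrs E R u) \<le> 1 * (\<Sum>w\<in>nbrs E R u. 1)"
      using x_le_1 x_nonneg u LR by (intro mult_mono) auto
    then show "x u * sum x (nbrs E R u) \<le> real (card (nbrs E R u))" by simp
  qed
  have QHL: "(\<Sum>u\<in>L. (2 * x u - 1) * card (nbrs H L u)) \<le> Q H L"
  proof -
    have "0 \<le> (\<Sum>u\<in>L. (1 - x u) * (\<Sum>w\<in>nbrs H L u. 1 - x w))"
      by (intro sum_nonneg mult_nonneg_nonneg) (use x_le_1 LR in auto)
    then show ?thesis unfolding Q_def using quad_part_expand[of L H x] finite_LR rel_graphD(5)[OF Hg(1)] by simp
  qed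
  have QEL: "Q E L \<le> (\<Sum>u\<in>L. (2 * x u - 1) * card (nbrs E L u)) + 4 * real k ^ 3 / n"
  proof -
    have "(\<Sum>u\<in>L. (1 - x u) * (\<Sum>w\<in>nbrs E L u. 1 - x w)) \<le> (\<Sum>u\<in>L. \<epsilon> * (real k * \<epsilon>))"
    proof (rule sum_mono)
      fix u assume u: "u \<in> L"
      have "(\<Sum>w\<in>nbrs E L u. 1 - x w) \<le> (\<Sum>w\<in>nbrs E L u. \<epsilon>)"
        by (rule sum_mono) (use xe LR in \<open>fastforce simp: algebra_simps\<close>)
      also have "\<dots> \<le> real k * \<epsilon>" using own_degree_le[OF u] k3 \<epsilon> by (simp add: mult_right_mono)
      finally show "(1 - x u) * (\<Sum>w\<in>nbrs E L u. 1 - x w) \<le> \<epsilon> * (real k * \<epsilon>)"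
        using xe[of u] u LR \<epsilon> x_le_1 by (intro mult_mono sum_nonneg) auto
    qed
    also have "\<dots> = card L * (\<epsilon> * (real k * \<epsilon>))" by simp
    also have "\<dots> \<le> n * (\<epsilon> * (real k * \<epsilon>))"
      using \<epsilon> card_LR unfolding n_def by (intro mult_right_mono) auto
    also have "\<dots> = 4 * real k ^ 3 / n" unfolding \<epsilon>_def using n by (simp add: field_simps power3_eq_cube)
    finally show ?thesis unfolding Q_def using quad_part_expand[of L E x] finite_LR E_D(5) by simp
  qed
  have diff: "real SH - real SE - 20 * real k ^ 5 * 2 / n \<le>
     (\<Sum>u\<in>L. (2 * x u - 1) * card (nbrs H L u)) - (\<Sum>u\<in>L. (2 * x u - 1) * card (nbrs E L u))"
  proof -
    \<comment> \<open>The difference of degrees at \<open>u\<close> is at most the shortfall of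
      \<open>E\<close> at \<open>u\<close>. Shortfalls total at most \<open>10 * k ^ 4\<close>, so
      this error is O(1/n) although the sum runs over all of \<open>L\<close>.\<close>
    have "(\<Sum>u\<in>L. (1 - x u) * (real (card (nbrs H L u)) - card (nbrs E L u))) \<le> (\<Sum>u\<in>L. \<epsilon> * (real (k - 1) - card (nbrs E L u)))"
    proof (rule sum_mono)
      fix u assume u: "u \<in> L"
      have "(1 - x u) * (real (card (nbrs H L u)) - card (nbrs E L u)) \<le> (1 - x u) * (real (k - 1) - card (nbrs E L u))"
        using dH[OF u] x_le_1[of u] u LR by (intro mult_left_mono) auto
      also have "\<dots> \<le> \<epsilon> * (real (k - 1) - card (nbrs E L u))"
        using own_degree_le[OF u] xe[of u] u LR by (intro mult_right_mono) auto
      finally show "(1 - x u) * (real (card (nbrs H L u)) - card (nbrs E L u)) \<le> \<epsilon> * (real (k - 1) - card (nbrs E L u))" .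
    qed
    also have "\<dots> = \<epsilon> * (real (k - 1) * card L - real SE)"
      unfolding SE_def by (simp add: sum_distrib_left[symmetric] sum_subtractf mult.commute)
    also have "\<dots> \<le> \<epsilon> * (10 * real k ^ 4)"
      using c \<epsilon> unfolding concentrated_def SE_def by (intro mult_left_mono) auto
    also have "\<dots> = 20 * real k ^ 5 / n" unfolding \<epsilon>_def by (simp add: eval_nat_numeral)
    finally have *: "(\<Sum>u\<in>L. (1 - x u) * (real (card (nbrs H L u)) - card (nbrs E L u))) \<le> 20 * real k ^ 5 / n" .
    have "(\<Sum>u\<in>L. (2 * x u - 1) * card (nbrs H L u)) - (\<Sum>u\<in>L. (2 * x u - 1) * card (nbrs E L u))
      = (\<Sum>u\<in>L. (real (card (nbrs H L u)) - card (nbrs E L u)) - 2 * ((1 - x u) * (real (card (nbrs H L u)) - card (nbrs E L u))))"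
      unfolding sum_subtractf[symmetric] by (rule sum.cong) (auto simp: algebra_simps)
    also have "\<dots> = real SH - real SE - 2 * (\<Sum>u\<in>L. (1 - x u) * (real (card (nbrs H L u)) - card (nbrs E L u)))"
      unfolding SH_def SE_def by (simp add: sum_subtractf sum_distrib_left)
    finally show ?thesis using * by simp
  qed
  have small: "40 * real k ^ 5 / n + 4 * real k ^ 3 / n \<le> 1 / 10"
  proof -
    have "real k ^ 5 * 3 \<le> real k ^ 6" using k3 power_Suc2[of "real k" 5] by (simp add: mult_left_mono)
    moreover have "real k ^ 3 \<le> real k ^ 6" using k3 by (intro power_increasing) auto
    moreover have "0 < real k ^ 6" using k3 by simp
    ultimately have "40 * real k ^ 5 + 4 * real k ^ 3 \<le> n / 10" using large_real(1) unfolding n_def by linarith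
    then show ?thesis using n by (simp add: field_simps)
  qed
  \<comment> \<open>Both sums are even and \<open>SE \<le> (k - 1) * card L \<le> SH + 1\<close>, so
    the possible shortfall 1 of \<open>H\<close> gives \<open>E\<close> no advantage.\<close>
  have par: "SE \<le> SH"
  proof (rule ccontr)
    assume "\<not> SE \<le> SH"
    moreover have "even SE" "even SH" unfolding SE_def SH_def
      using handshake[OF finite_LR(1)] E_D(4,5) rel_graphD(4,5)[OF Hg(1)] by blast+
    ultimately have "SH + 2 \<le> SE" by presburger
    moreover have "SE \<le> (k - 1) * card L"
      unfolding SE_def using sum_mono[of L "\<lambda>v. card (nbrs E L v)" "\<lambda>v. k - 1"] own_degree_le
      by (simp add: mult.commute)
    ultimately show False using dL unfolding SH_def[symmetric] by linarith
  qed
  have total: "real SH - real SE + 2 - real SR + 2 * ((1 - 2 * \<epsilon>) * real M) \<le> 1 / 5"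
    using q cross miss QHR QER QHL QEL diff small \<epsilon> by simp
  have SR2: "SR \<le> 2" using sum_degree_R_le_2[OF c] unfolding SR_def .
  have real_par: "real SE \<le> real SH" "real SR \<le> 2" using par SR2 by auto
  have M0: "M = 0"
  proof (rule ccontr)
    assume "M \<noteq> 0"
    then have "(1 - 2 * \<epsilon>) * 1 \<le> (1 - 2 * \<epsilon>) * real M" using \<epsilon> by (intro mult_left_mono) auto
    moreover define P where "P = (1 - 2 * \<epsilon>) * real M"
    ultimately have "1 - 2 * \<epsilon> \<le> P" by (simp only: mult_1_right)
    then show False using total[folded P_def] real_par \<epsilon> by linarith
  qed
  then show "E u v" if "u \<in> L" "v \<in> R" for u v
  proof -
    have "card (non_nbrs E R u) = 0" using M0 that(1) finite_LR unfolding M_def by simp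
    then have "non_nbrs E R u = {}" using finite_LR unfolding non_nbrs_def by simp
    then show ?thesis using that(2) unfolding non_nbrs_def by blast
  qed
  have "\<not> real SR \<le> 1" using total real_par M0 by auto
  then have "SR = 2" using SR2 by linarith
  then show "(\<Sum>v\<in>R. card (nbrs E R v)) = 2" unfolding SR_def .
  have "real SH < real SE + 1" using total real_par M0 by simp
  then have "SH \<le> SE" by linarith
  then show "(k - 1) * card L \<le> (\<Sum>v\<in>L. card (nbrs E L v)) + 1"
    using dL unfolding SH_def SE_def by linarith
qed

end

section \<open>Balance of the parts\<close>

text \<open>Degree sum 2 encodes a single edge in \<open>R\<close>; bounded degrees with total
  shortfall at most 1 encode a regular or nearly regular graph in \<open>L\<close>.\<close>

definition good_split :: "nat \<Rightarrow> 'a set \<Rightarrow> ('a \<Rightarrow> 'a \<Rightarrow> bool) \<Rightarrow> 'a set \<Rightarrow> 'a set \<Rightarrow> bool" where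
  "good_split k V E L R \<longleftrightarrow> L \<union> R = V \<and> L \<inter> R = {} \<and> card L \<le> card R + 2 \<and> card R \<le> card L + 2 \<and>
     (\<forall>u\<in>L. \<forall>v\<in>R. E u v) \<and> (\<forall>v\<in>L. card (nbrs E L v) \<le> k - 1) \<and>
     (k - 1) * card L \<le> (\<Sum>v\<in>L. card (nbrs E L v)) + 1 \<and>
     \<not> (\<exists>p. distinct p \<and> length p = 2 * k - 1 \<and> set p \<subseteq> L \<and> successively E p) \<and>
     (\<Sum>v\<in>R. card (nbrs E R v)) = 2"

context bipartition
begin

lemma sum_L_ge: "(1 - 2 * k / card V) * card L \<le> sum x L"
  and sum_L_pos: "0 < sum x L"
proof -
  have e: "2 * k / card V < 1" using large_k k3 by (simp add: field_simps)
  have pos: "0 < sum x S" if "S \<subseteq> V" "card V / 3 \<le> card S" for S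
  proof (rule sum_pos)
    show "finite S" using that E_D(1) finite_subset by blast
    show "S \<noteq> {}" using that(2) large_k(2) by auto
    show "0 < x v" if "v \<in> S" for v using x_ge[of v] e that \<open>S \<subseteq> V\<close> by fastforce
  qed
  show "0 < sum x L" using pos third LR by auto
  have "(\<Sum>v\<in>L. 1 - 2 * k / card V) \<le> sum x L" by (rule sum_mono) (use x_ge LR in auto)
  then show "(1 - 2 * k / card V) * card L \<le> sum x L" by (simp add: mult.commute)
qed

lemma sum_L_le: "lam * sum x L \<le> (\<Sum>w\<in>L. x w * card (nbrs E L w)) + card L * sum x R"
proof -
  have "lam * sum x L = (\<Sum>u\<in>L. sum x (nbrs E L u) + sum x (nbrs E R u))"
    unfolding sum_distrib_left by (rule sum.cong) (use eig sum_nbrs_V LR in auto)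
  also have "\<dots> = (\<Sum>u\<in>L. 1 * (\<Sum>w\<in>nbrs E L u. x w)) + (\<Sum>u\<in>L. sum x (nbrs E R u))"
    by (simp add: sum.distrib)
  also have "(\<Sum>u\<in>L. 1 * (\<Sum>w\<in>nbrs E L u. x w)) = (\<Sum>w\<in>L. x w * (\<Sum>u\<in>nbrs E L w. 1))"
    by (rule sum_nbrs_swap) (use finite_LR E_D(5) in auto)
  also have "(\<Sum>u\<in>L. sum x (nbrs E R u)) \<le> (\<Sum>u\<in>L. sum x R)"
    by (intro sum_mono sum_mono2) (use finite_LR x_nonneg LR in auto)
  finally show ?thesis by simp
qed

lemma sum_L_le_degree:
  assumes "\<And>v. v \<in> L \<Longrightarrow> card (nbrs E L v) \<le> d"
  shows "(lam - d) * sum x L \<le> card L * sum x R"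
proof -
  have "(\<Sum>w\<in>L. x w * card (nbrs E L w)) \<le> (\<Sum>w\<in>L. x w * d)"
    by (intro sum_mono mult_left_mono) (use assms x_nonneg LR in auto)
  also have "\<dots> = d * sum x L" by (simp add: sum_distrib_left mult.commute)
  finally have "lam * sum x L \<le> d * sum x L + card L * sum x R" using sum_L_le by linarith
  then show ?thesis by (simp add: left_diff_distrib)
qed

lemma product_le: "4 * (real (card L) * card R) \<le> real (card V) * card V"
proof -
  have "real (card V) = real (card L) + card R" using card_LR by (simp flip: of_nat_add)
  then have "real (card V) * card V = (real (card L) - card R)\<^sup>2 + 4 * (real (card L) * card R)"
    by (simp add: power2_eq_square algebra_simps)
  then show ?thesis by simp
qed

text \<open>Summing the eigenvalue equations over each part and multiplying gives
  \<open>(lam - 1)^2 \<le> card L * card R\<close>, whereas \<open>lam - 1\<close> exceeds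
  \<open>card V / 2\<close> when \<open>k = 3\<close>.\<close>

lemma not_both_matchings:
  assumes "k = 3" "\<And>v. v \<in> L \<Longrightarrow> card (nbrs E L v) \<le> 1" "\<And>v. v \<in> R \<Longrightarrow> card (nbrs E R v) \<le> 1"
  shows False
proof -
  define m where "m = lam - 1"
  have m: "real (card V) / 2 < m" "0 < m" using lam_low assms(1) large_k unfolding m_def by auto
  have 1: "m * sum x L \<le> card L * sum x R" using sum_L_le_degree[OF assms(2)] unfolding m_def by simp
  have 2: "m * sum x R \<le> card R * sum x L"
    using bipartition.sum_L_le_degree[OF bipartition_swap assms(3)] unfolding m_def by simp
  have "m * m * sum x L \<le> m * (card L * sum x R)" using mult_left_mono[OF 1, of m] m by (simp add: mult_ac)
  also have "\<dots> = card L * (m * sum x R)" by simp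
  also have "\<dots> \<le> card L * (card R * sum x L)" using 2 by (intro mult_left_mono) auto
  finally have "m * m \<le> real (card L) * card R" using sum_L_pos by (simp add: mult.assoc[symmetric])
  moreover have "real (card V) / 2 * (real (card V) / 2) < m * m" using m by (intro mult_strict_mono) auto
  ultimately show False using product_le by simp
qed

lemma lam_le: "lam \<le> card V / 2 + 4 * k"
  using lam_le_card_R card_R_le by simp

text \<open>In a join with almost no edges inside \<open>T\<close>, the eigenvector is in the ratio
  \<open>lam\<close> on \<open>S\<close> to \<open>card S\<close> on \<open>T\<close>, so these are
  the test values. Degree sum 2 in \<open>T\<close> against shortfall 1 in \<open>S\<close> gains
  about 1, as \<open>card S\<close> is close to \<open>lam\<close>; the value 1 / 2 leaves room for
  the error.\<close>

lemma lam_quadratic_lower: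
  assumes S: "S \<union> T = V" "S \<inter> T = {}" and l: "card V / 2 - 2 * k - 1 \<le> card S" "card S \<le> card V / 2 + 2 * k + 1"
  shows "real (card S) * card T + 1 / 2 \<le> lam * lam - real (k - 1) * lam"
proof (rule ccontr)
  assume neg: "\<not> ?thesis"
  define l r d m where "l = real (card S)" and "r = real (card T)" and "d = real (k - 1)" and "m = real (card V) / 2"
  have k2: "2 * real k + 1 \<le> m / 100" "4 * real k \<le> m / 100" "0 < m" using large_k k3 unfolding m_def by auto
  have b: "99 / 100 * m \<le> l" "l \<le> 101 / 100 * m" "lam \<le> 101 / 100 * m" "0 < l"
    using l lam_le k2 unfolding l_def m_def by linarith+
  have lr: "l + r = real (card V)"
  proof -
    have "card S + card T = card V" using card_Un_disjoint[of S T] S E_D(1) by (metis finite_Un)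
    then show ?thesis unfolding l_def r_def by (simp flip: of_nat_add)
  qed
  have "3 * (k * (2 * k - 2) + k + 1) < card V" using target_size[OF k3] large by (rule less_le_trans)
  moreover have "j < card S" if "3 * j < card V" for j
    using that b(1) k2(3) unfolding l_def m_def by linarith
  ultimately have "k * (2 * k - 2) + k + 1 < card S" by blast
  moreover have "2 \<le> card T" using lr b(2) k2 k3 unfolding r_def m_def by linarith
  ultimately have tb: "(d * l - 1) * lam\<^sup>2 + 2 * l * r * lam * l + 2 * l\<^sup>2 \<le> lam * (l * lam\<^sup>2 + r * l\<^sup>2)"
    using target_bound[OF S, of lam l] unfolding d_def l_def r_def by simp
  have "2 * l\<^sup>2 - lam\<^sup>2 \<le> l * lam * (lam * lam - d * lam - l * r)"
    using tb by (simp add: algebra_simps power2_eq_square)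
  also have "\<dots> \<le> l * lam * (1 / 2)" using neg b(4) lam_pos unfolding l_def r_def d_def
    by (intro mult_left_mono) auto
  finally have 1: "2 * l\<^sup>2 - lam\<^sup>2 \<le> l * lam / 2" by simp
  have "l * lam \<le> (101 / 100 * m) * (101 / 100 * m)" using b lam_pos k2 by (intro mult_mono) auto
  moreover have "lam\<^sup>2 \<le> (101 / 100 * m)\<^sup>2" using b lam_pos by (intro power_mono) auto
  moreover have "(99 / 100 * m)\<^sup>2 \<le> l\<^sup>2" using b k2 by (intro power_mono) auto
  moreover have "0 < m\<^sup>2" using k2 by simp
  ultimately show False using 1 by (simp add: power2_eq_square)
qed

text \<open>The summed eigenvalue equations of the two parts are multiplied. The single edge in
  \<open>R\<close> contributes 2, and division by \<open>sum x L\<close>, which is slightly below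
  \<open>card L\<close>, is absorbed in 21 / 10.\<close>

lemma lam_quadratic_upper:
  assumes c: concentrated
  shows "lam * lam - real (k - 1) * lam \<le> real (card L) * card R + 21 / 10"
proof (rule ccontr)
  assume neg: "\<not> ?thesis"
  define d s t l where "d = real (k - 1)" and "s = sum x L" and "t = sum x R" and "l = real (card L)"
  have 1: "(lam - d) * s \<le> l * t"
    using sum_L_le_degree[of "k - 1"] own_degree_le unfolding d_def s_def t_def l_def by simp
  have "(\<Sum>w\<in>R. x w * card (nbrs E R w)) \<le> (\<Sum>w\<in>R. 1 * real (card (nbrs E R w)))"
    by (intro sum_mono mult_right_mono) (use x_le_1 LR in auto)
  also have "\<dots> = 2" using concentrated_structure(3)[OF c] by (simp flip: of_nat_sum)
  finally have 2: "lam * t \<le> card R * s + 2"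
    using bipartition.sum_L_le[OF bipartition_swap] unfolding s_def t_def by simp
  have "lam * (lam - d) * s \<le> lam * (l * t)" using mult_left_mono[OF 1, of lam] lam_pos by (simp add: mult_ac)
  also have "\<dots> = l * (lam * t)" by simp
  also have "\<dots> \<le> l * (card R * s + 2)" using 2 unfolding l_def by (intro mult_left_mono) auto
  finally have 3: "(lam * lam - d * lam - l * card R) * s \<le> 2 * l" by (simp add: algebra_simps)
  have s: "(1 - 2 * k / card V) * l \<le> s" "0 < s" using sum_L_ge sum_L_pos unfolding s_def l_def by auto
  have "21 / 10 * s \<le> (lam * lam - d * lam - l * card R) * s"
    using neg s unfolding d_def l_def by (intro mult_right_mono) auto
  moreover have "21 / 10 * ((1 - 2 * k / card V) * l) \<le> 21 / 10 * s" using s(1) by (rule mult_left_mono) simp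
  ultimately have "21 / 10 * ((1 - 2 * k / card V) * l) \<le> 2 * l" using 3 by (meson order_trans)
  moreover have "l > 0" using third(1) large_k unfolding l_def by linarith
  ultimately have "21 / 10 * (1 - 2 * k / card V) \<le> 2" by simp
  moreover have "2 * k / card V \<le> 1 / 100" using large_k k3 by (simp add: field_simps)
  ultimately show False by simp
qed

text \<open>If the sizes differed by 3 or more, moving one vertex would raise their product by at
  least 2. The lower bound for the new split would then exceed the upper bound for the old one,
  since 2 + 1 / 2 is more than 21 / 10.\<close>

lemma balanced:
  assumes c: concentrated
  shows "card L \<le> card R + 2" "card R \<le> card L + 2"
proof -
  have no: False if S: "S \<union> T = V" "S \<inter> T = {}" "card V / 2 - 2 * k - 1 \<le> card S" "card S \<le> card V / 2 + 2 * k + 1"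
    "real (card L) * card R + 2 \<le> real (card S) * card T" for S T
    using lam_quadratic_lower[OF S(1-4)] lam_quadratic_upper[OF c] S(5) by linarith
  show "card L \<le> card R + 2"
  proof (rule ccontr)
    assume g: "\<not> ?thesis"
    then have "L \<noteq> {}" by auto
    then obtain v where v: "v \<in> L" by blast
    then have vR: "v \<notin> R" using LR(2) by blast
    have cS: "real (card (L - {v})) = card L - 1" "real (card (insert v R)) = card R + 1"
      using v vR finite_LR g by (auto simp: of_nat_diff)
    show False
    proof (rule no[of "L - {v}" "insert v R"])
      show "(L - {v}) \<union> insert v R = V" "(L - {v}) \<inter> insert v R = {}" using v LR by auto
      have "real (card R) + 3 \<le> card L" using g by linarith
      then show "real (card L) * card R + 2 \<le> real (card (L - {v})) * card (insert v R)"
        unfolding cS by (simp add: algebra_simps)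
    qed (use cS card_L_ge card_L_le in auto)
  qed
  show "card R \<le> card L + 2"
  proof (rule ccontr)
    assume g: "\<not> ?thesis"
    then have "R \<noteq> {}" by auto
    then obtain v where v: "v \<in> R" by blast
    then have vR: "v \<notin> L" using LR(2) by blast
    have cS: "real (card (R - {v})) = card R - 1" "real (card (insert v L)) = card L + 1"
      using v vR finite_LR g by (auto simp: of_nat_diff)
    show False
    proof (rule no[of "insert v L" "R - {v}"])
      show "insert v L \<union> (R - {v}) = V" "insert v L \<inter> (R - {v}) = {}" using v LR by auto
      have "real (card L) + 3 \<le> card R" using g by linarith
      then show "real (card L) * card R + 2 \<le> real (card (insert v L)) * card (R - {v})"
        unfolding cS by (simp add: algebra_simps)
    qed (use cS card_L_ge card_L_le in auto)
  qed
qed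

text \<open>A path on \<open>2 * k - 1\<close> vertices in \<open>L\<close> would give a wheel: of
  the edge in \<open>R\<close>, the end \<open>b\<close> closes the path to a rim and the end
  \<open>a\<close> is the hub.\<close>

lemma good_split_of_concentrated:
  assumes c: concentrated
  shows "good_split k V E L R"
proof -
  note st = concentrated_structure[OF c]
  have "\<exists>v\<in>R. nbrs E R v \<noteq> {}"
  proof (rule ccontr)
    assume "\<not> ?thesis"
    then have "(\<Sum>v\<in>R. card (nbrs E R v)) = 0" by simp
    then show False using st(3) by simp
  qed
  then obtain a b where ab: "a \<in> R" "b \<in> R" "E a b" by auto
  have "\<not> (\<exists>p. distinct p \<and> length p = 2 * k - 1 \<and> set p \<subseteq> L \<and> successively E p)"
  proof
    assume "\<exists>p. distinct p \<and> length p = 2 * k - 1 \<and> set p \<subseteq> L \<and> successively E p"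
    then obtain p where p: "distinct p" "length p = 2 * k - 1" "set p \<subseteq> L" "successively E p" by blast
    have p0: "p \<noteq> []" using p(2) k3 by auto
    then have hl: "hd p \<in> L" "last p \<in> L" using p(3) by auto
    have "b \<notin> set p" using p(3) ab LR(2) by blast
    then have "cyc E (b # p)"
      unfolding cyc_def using p p0 st(1)[OF hl(2) ab(2)] st(1)[OF hl(1) ab(2)] E_D(5) by (auto simp: successively_Cons)
    moreover have "E a v" if "v \<in> set (b # p)" for v
      using that st(1)[of v a] p(3) ab E_D(5) by auto
    moreover have "length (b # p) = 2 * k" using p(2) k3 by simp
    ultimately show False using wf unfolding wheel_free_def by blast
  qed
  then show ?thesis using LR balanced[OF c] st own_degree_le unfolding good_split_def by blast
qed

theorem ex_good_split:
  assumes "k \<noteq> 4" "k \<noteq> 5"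
  shows "\<exists>L R. good_split k V E L R"
  using concentrated_cases[OF assms] good_split_of_concentrated
    bipartition.good_split_of_concentrated[OF bipartition_swap] not_both_matchings by blast

end

theorem extremal_structure:
  assumes k: "3 \<le> k" "k \<noteq> 4" "k \<noteq> 5"
  shows "\<exists>N. \<forall>(V::'a set) E lam x. N \<le> card V \<longrightarrow> extremal k V E lam x \<longrightarrow> (\<exists>L R. good_split k V E L R)"
proof -
  \<comment> \<open>Then \<open>\<tau> = \<delta> * card V\<close> meets
    \<open>100 * k * \<tau> \<le> card V\<close> with equality, and \<open>\<tau>\<^sup>2\<close>
    corresponds to the fixed density \<open>\<delta>\<^sup>2\<close> in
    \<open>dense_biclique\<close>.\<close>
  define \<delta> where "\<delta> = 1 / (100 * real k)"
  have \<delta>: "0 < \<delta>" using k unfolding \<delta>_def by simp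
  obtain N0 where N0: "\<forall>n\<ge>N0. \<forall>X Y :: 'a set. \<forall>E. finite X \<and> finite Y \<and> card X \<le> n \<and> card Y \<le> n \<and>
      \<delta>\<^sup>2 * (real n)\<^sup>2 \<le> real (\<Sum>u\<in>X. card (nbrs E Y u)) \<longrightarrow>
      (\<exists>A B. A \<subseteq> X \<and> B \<subseteq> Y \<and> card A = 2 * k + 1 \<and> card B = 2 * k + 1 \<and> (\<forall>a\<in>A. \<forall>b\<in>B. E a b))"
    using dense_biclique[of "\<delta>\<^sup>2" "2 * k + 1", where 'a = 'a] \<delta> by (metis zero_less_power le_add2)
  show ?thesis
  proof (intro exI[of _ "N0 + 1000 * k ^ 6"] allI impI)
    fix V :: "'a set" and E lam x
    assume n: "N0 + 1000 * k ^ 6 \<le> card V" and ex: "extremal k V E lam x"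
    interpret extremal k V E lam x by (rule ex)
    define \<tau> where "\<tau> = \<delta> * card V"
    have large: "1000 * k ^ 6 \<le> card V" using n by simp
    have kp: "k \<le> k ^ 6" using k power_increasing[of 1 6 k] by auto
    have lam: "(real (card V) + real (k - 1)) / 2 < lam"
      by (rule lam_gt) (rule less_le_trans[OF target_size[OF k(1)] large])
    have "200 * k \<le> card V" using large kp by linarith
    then have "real (200 * k) \<le> real (card V)" by (simp only: of_nat_le_iff)
    then have \<tau>2: "2 \<le> \<tau>" "100 * k * \<tau> \<le> card V" using k unfolding \<tau>_def \<delta>_def by (simp_all add: field_simps)
    have "\<exists>L R. L \<union> R = V \<and> L \<inter> R = {} \<and> real (card V) / 3 \<le> card L \<and> real (card V) / 3 \<le> card R \<and>
      (\<forall>v\<in>L. real (card (non_nbrs E R v)) \<le> 6 * \<tau>) \<and> (\<forall>v\<in>R. real (card (non_nbrs E L v)) \<le> 6 * \<tau>) \<and>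
      (\<forall>v\<in>V. 1 - 3 * \<tau> / card V \<le> x v)"
    proof (rule near_bipartition[OF \<tau>2])
      fix X Y assume XY: "X \<subseteq> V" "Y \<subseteq> V" "\<tau>\<^sup>2 \<le> real (\<Sum>u\<in>X. card (nbrs E Y u))"
      then have "finite X \<and> finite Y \<and> card X \<le> card V \<and> card Y \<le> card V"
        using E_D(1) finite_subset card_mono by meson
      then show "\<exists>A B. A \<subseteq> X \<and> B \<subseteq> Y \<and> card A = 2 * k + 1 \<and> card B = 2 * k + 1 \<and> (\<forall>a\<in>A. \<forall>b\<in>B. E a b)"
        using XY(3) n by (intro N0[rule_format, of "card V"]) (auto simp: \<tau>_def power_mult_distrib)
    qed (use lam in simp)
    then obtain L R where LR: "L \<union> R = V" "L \<inter> R = {}" "real (card V) / 3 \<le> card L" "real (card V) / 3 \<le> card R"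
      "\<forall>v\<in>L. real (card (non_nbrs E R v)) \<le> 6 * \<tau>" "\<forall>v\<in>R. real (card (non_nbrs E L v)) \<le> 6 * \<tau>"
      "\<forall>v\<in>V. 1 - 3 * \<tau> / card V \<le> x v" by blast
    interpret bipartition k V E lam x L R \<tau>
      by unfold_locales (use LR \<tau>2 large in auto)
    show "\<exists>L R. good_split k V E L R" using ex_good_split k by blast
  qed
qed

section \<open>Perron vectors and adjacency matrices\<close>

lemma quad_add_scaled:
  assumes "rel_graph V E"
  shows "quad V E (\<lambda>u. y u + t * z u) = quad V E y + 2 * t * (\<Sum>u\<in>V. z u * (\<Sum>w\<in>nbrs E V u. y w)) + t\<^sup>2 * quad V E z"
proof -
  have sw: "(\<Sum>u\<in>V. y u * (\<Sum>w\<in>nbrs E V u. z w)) = (\<Sum>u\<in>V. z u * (\<Sum>w\<in>nbrs E V u. y w))"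
    by (rule sum_nbrs_swap) (use rel_graphD[OF assms] in auto)
  have "quad V E (\<lambda>u. y u + t * z u) = (\<Sum>u\<in>V. y u * (\<Sum>w\<in>nbrs E V u. y w) + t * (y u * (\<Sum>w\<in>nbrs E V u. z w))
     + t * (z u * (\<Sum>w\<in>nbrs E V u. y w)) + t\<^sup>2 * (z u * (\<Sum>w\<in>nbrs E V u. z w)))"
    unfolding quad_def
    by (rule sum.cong) (simp_all add: sum.distrib sum_distrib_left[symmetric] algebra_simps power2_eq_square)
  also have "\<dots> = quad V E y + t * (\<Sum>u\<in>V. y u * (\<Sum>w\<in>nbrs E V u. z w))
     + t * (\<Sum>u\<in>V. z u * (\<Sum>w\<in>nbrs E V u. y w)) + t\<^sup>2 * quad V E z"
    unfolding quad_def by (simp add: sum.distrib sum_distrib_left)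
  finally show ?thesis unfolding sw by simp
qed

lemma quad_scale: "quad V E (\<lambda>u. t * z u) = t\<^sup>2 * quad V E z"
  unfolding quad_def by (simp add: sum_distrib_left power2_eq_square mult_ac)

lemma quad_abs_ge: "quad V E y \<le> quad V E (\<lambda>u. \<bar>y u\<bar>)"
  unfolding quad_def
proof (rule sum_mono)
  fix u
  have "y u * (\<Sum>v\<in>nbrs E V u. y v) \<le> \<bar>y u\<bar> * \<bar>\<Sum>v\<in>nbrs E V u. y v\<bar>" by (metis abs_ge_self abs_mult)
  also have "\<dots> \<le> \<bar>y u\<bar> * (\<Sum>v\<in>nbrs E V u. \<bar>y v\<bar>)" by (intro mult_left_mono sum_abs) auto
  finally show "y u * (\<Sum>v\<in>nbrs E V u. y v) \<le> \<bar>y u\<bar> * (\<Sum>v\<in>nbrs E V u. \<bar>y v\<bar>)" .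
qed

text \<open>The form is maximised over nonnegative unit vectors, a compact set. Taking absolute
  values never lowers the form, so the maximum bounds it at all vectors, and a first-order variation
  at one vertex gives the eigenvalue equation.\<close>

lemma perron_vector:
  assumes g: "rel_graph V E" and ne: "V \<noteq> {}"
  shows "\<exists>lam x. (\<forall>v\<in>V. 0 \<le> x v \<and> x v \<le> 1) \<and> (\<exists>u\<in>V. x u = 1) \<and>
    (\<forall>v\<in>V. (\<Sum>w\<in>nbrs E V v. x w) = lam * x v) \<and> (\<forall>y. quad V E y \<le> lam * (\<Sum>v\<in>V. (y v)\<^sup>2))"
proof -
  have f: "finite V" using g by (rule rel_graphD(1))
  \<comment> \<open>The value 0 outside \<open>V\<close> makes this a product of compact sets even
    if the vertex type is infinite.\<close>
  define B :: "('a \<Rightarrow> real) set" where "B = PiE UNIV (\<lambda>v. if v \<in> V then {0..1} else {0})"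
  define K where "K = B \<inter> {x. (\<Sum>v\<in>V. (x v)\<^sup>2) = 1}"
  have "compactin (product_topology (\<lambda>_::'a. euclidean :: real topology) UNIV) B"
    unfolding B_def compactin_PiE by auto
  then have "compact B" unfolding euclidean_product_topology by simp
  moreover have "closed {x :: 'a \<Rightarrow> real. (\<Sum>v\<in>V. (x v)\<^sup>2) = 1}"
    by (intro closed_Collect_eq continuous_intros continuous_on_product_coordinates)
  ultimately have cK: "compact K" unfolding K_def by (rule compact_Int_closed)
  obtain v0 where v0: "v0 \<in> V" using ne by blast
  have "(\<lambda>v. if v = v0 then 1 else 0) \<in> K" unfolding K_def B_def using v0 f by (auto simp: if_distrib[of "\<lambda>a. a\<^sup>2"] cong: if_cong)
  then have "K \<noteq> {}" by blast
  moreover have "continuous_on K (quad V E)" unfolding quad_def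
    by (intro continuous_intros continuous_on_subset[OF continuous_on_product_coordinates]) auto
  ultimately obtain x where x: "x \<in> K" "\<And>y. y \<in> K \<Longrightarrow> quad V E y \<le> quad V E x"
    using continuous_attains_sup[OF cK] by blast
  define lam where "lam = quad V E x"
  have x0: "0 \<le> x v" if "v \<in> V" for v using x(1) that unfolding K_def B_def by (auto dest!: PiE_mem[of _ _ _ v])
  have x1: "(\<Sum>v\<in>V. (x v)\<^sup>2) = 1" using x(1) unfolding K_def by simp
  have lam0: "0 \<le> lam" unfolding lam_def quad_def
    by (intro sum_nonneg mult_nonneg_nonneg) (use x0 in auto)
  have ray: "quad V E y \<le> lam * (\<Sum>v\<in>V. (y v)\<^sup>2)" for y
  proof (cases "(\<Sum>v\<in>V. (y v)\<^sup>2) = 0")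
    case True
    then have "y v = 0" if "v \<in> V" for v using that f by (simp add: sum_nonneg_eq_0_iff)
    then have "quad V E y = 0" unfolding quad_def by simp
    then show ?thesis using True by simp
  next
    case False
    define s where "s = (\<Sum>v\<in>V. (y v)\<^sup>2)"
    have s: "0 < s" using False sum_nonneg[of V "\<lambda>v. (y v)\<^sup>2"] unfolding s_def by force
    define z where "z v = (if v \<in> V then \<bar>y v\<bar> / sqrt s else 0)" for v
    have zs: "(\<Sum>v\<in>V. (z v)\<^sup>2) = 1"
    proof -
      have "(\<Sum>v\<in>V. (z v)\<^sup>2) = (\<Sum>v\<in>V. (y v)\<^sup>2 / s)" by (rule sum.cong) (use s in \<open>auto simp: z_def power_divide\<close>)
      then show ?thesis using s by (simp add: sum_divide_distrib[symmetric] s_def[symmetric])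
    qed
    have "z v \<le> 1" if "v \<in> V" for v
    proof -
      have "(z v)\<^sup>2 \<le> (\<Sum>v\<in>V. (z v)\<^sup>2)" using f that by (intro member_le_sum) auto
      then show ?thesis using zs by (simp add: power2_le_imp_le[of "z v" 1])
    qed
    then have "z \<in> K" using zs s unfolding K_def B_def by (auto simp: z_def)
    then have "quad V E z \<le> lam" using x(2) unfolding lam_def by blast
    moreover have "quad V E (\<lambda>u. \<bar>y u\<bar>) = quad V E (\<lambda>u. sqrt s * z u)"
      unfolding quad_def by (intro sum.cong refl arg_cong2[where f = "(*)"]) (use s in \<open>auto simp: z_def nbrs_def\<close>)
    ultimately have "quad V E (\<lambda>u. \<bar>y u\<bar>) \<le> s * lam" using s by (simp add: quad_scale)
    then show ?thesis using quad_abs_ge[of V E y] unfolding s_def by (simp add: mult.commute)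
  qed
  have eig: "(\<Sum>w\<in>nbrs E V v. x w) = lam * x v" if v: "v \<in> V" for v
  proof -
    define S where "S = (\<Sum>w\<in>nbrs E V v. x w)"
    define e :: "'a \<Rightarrow> real" where "e u = (if u = v then 1 else 0)" for u
    define g0 where "g0 = S - lam * x v"
    have es: "(\<Sum>u\<in>V. e u * h u) = h v" for h
    proof -
      have "(\<Sum>u\<in>V. e u * h u) = (\<Sum>u\<in>V. if u = v then h u else 0)" by (rule sum.cong) (auto simp: e_def)
      then show ?thesis using v f by simp
    qed
    have qe: "quad V E e = 0"
      unfolding quad_def es using rel_graphD(4)[OF g] by (auto simp: e_def intro!: sum.neutral)
    have "2 * t * g0 \<le> lam * t\<^sup>2" for t
    proof -
      have "lam + 2 * t * S \<le> lam * (\<Sum>u\<in>V. (x u + t * e u)\<^sup>2)"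
        using ray[of "\<lambda>u. x u + t * e u"] quad_add_scaled[OF g, of x t e] qe unfolding es S_def[symmetric] lam_def by simp
      also have "(\<Sum>u\<in>V. (x u + t * e u)\<^sup>2) = (\<Sum>u\<in>V. (x u)\<^sup>2 + 2 * t * (e u * x u) + t\<^sup>2 * (e u * 1))"
        by (rule sum.cong) (auto simp: e_def power2_eq_square algebra_simps)
      also have "\<dots> = 1 + 2 * t * x v + t\<^sup>2"
        unfolding sum.distrib x1 sum_distrib_left[symmetric] es by simp
      finally show ?thesis unfolding g0_def by (simp add: algebra_simps)
    qed
    \<comment> \<open>Dividing by \<open>lam + 1\<close> covers the edgeless graph, where
      \<open>lam = 0\<close>.\<close>
    from this[of "g0 / (lam + 1)"] have "2 * (g0 / (lam + 1)) * g0 \<le> lam * (g0 / (lam + 1))\<^sup>2" .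
    also have "\<dots> \<le> (lam + 1) * (g0 / (lam + 1))\<^sup>2" by (rule mult_right_mono) auto
    also have "\<dots> = g0\<^sup>2 / (lam + 1)" using lam0 by (simp add: power2_eq_square)
    finally have "2 * (g0\<^sup>2 / (lam + 1)) \<le> g0\<^sup>2 / (lam + 1)" by (simp add: power2_eq_square)
    then have "g0\<^sup>2 / (lam + 1) \<le> 0" by linarith
    then have "g0\<^sup>2 \<le> 0" using lam0 by (simp add: divide_le_0_iff)
    then show ?thesis unfolding g0_def S_def by simp
  qed
  define M where "M = Max (x ` V)"
  have Mle: "x v \<le> M" if "v \<in> V" for v unfolding M_def using f that by simp
  have "M \<in> x ` V" unfolding M_def by (rule Max_in) (use f ne in auto)
  then obtain u where u: "u \<in> V" "x u = M" by (metis imageE)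
  have M0: "0 < M"
  proof (rule ccontr)
    assume "\<not> 0 < M"
    then have "x v = 0" if "v \<in> V" for v using Mle[OF that] x0[OF that] by simp
    then have "(\<Sum>v\<in>V. (x v)\<^sup>2) = 0" by simp
    then show False using x1 by simp
  qed
  have "(\<forall>v\<in>V. 0 \<le> x v / M \<and> x v / M \<le> 1) \<and> (\<exists>u\<in>V. x u / M = 1) \<and>
    (\<forall>v\<in>V. (\<Sum>w\<in>nbrs E V v. x w / M) = lam * (x v / M)) \<and> (\<forall>y. quad V E y \<le> lam * (\<Sum>v\<in>V. (y v)\<^sup>2))"
    using x0 Mle M0 u eig ray by (auto simp: sum_divide_distrib[symmetric])
  then show ?thesis by (intro exI[of _ lam] exI[of _ "\<lambda>v. x v / M"])
qed

section \<open>Largest eigenvalues of adjacency matrices\<close>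

lemma adj_mat_mult_vec:
  assumes "verts G = {..<n}" "v \<in> carrier_vec n" "i < n"
  shows "(adj_mat G *\<^sub>v v) $ i = (\<Sum>w\<in>nbrs (adjacent G) {..<n} i. v $ w)"
proof -
  have "(adj_mat G *\<^sub>v v) $ i = (\<Sum>j\<in>{0..<n}. (if adjacent G i j then 1 else 0) * v $ j)"
    using assms by (simp add: adj_mat_def scalar_prod_def)
  also have "\<dots> = (\<Sum>j\<in>{..<n}. if adjacent G i j then v $ j else 0)"
    by (rule sum.cong) auto
  also have "\<dots> = (\<Sum>w\<in>nbrs (adjacent G) {..<n} i. v $ w)" unfolding nbrs_def by (simp flip: sum.inter_filter)
  finally show ?thesis .
qed

lemma rel_graph_adjacent:
  assumes "simple_graph G"
  shows "rel_graph (verts G) (adjacent G)"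
  using assms unfolding rel_graph_def simple_graph_def adjacent_def
  by (auto simp: insert_commute)

text \<open>The vector \<open>x\<close> puts \<open>lam\<close> into the spectrum, and every
  eigenvalue is the Rayleigh quotient of its own eigenvector, hence at most
  \<open>lam\<close>.\<close>

lemma lambda1_eqI:
  assumes G: "simple_graph G" "verts G = {..<n}"
    and x: "\<exists>u\<in>{..<n}. x u = 1" "\<And>v. v \<in> {..<n} \<Longrightarrow> (\<Sum>w\<in>nbrs (adjacent G) {..<n} v. x w) = lam * x v"
    and ray: "\<And>y. quad {..<n} (adjacent G) y \<le> lam * (\<Sum>v<n. (y v)\<^sup>2)"
  shows "lambda1 G = lam"
  unfolding lambda1_def
proof (rule Max_eqI)
  have A: "adj_mat G \<in> carrier_mat n n" unfolding adj_mat_def G(2) by simp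
  then show "finite (spectrum (adj_mat G))" by (rule card_finite_spectrum(1))
  show "lam \<in> spectrum (adj_mat G)"
  proof -
    have "adj_mat G *\<^sub>v vec n x = lam \<cdot>\<^sub>v vec n x"
    proof (rule eq_vecI)
      show "dim_vec (adj_mat G *\<^sub>v vec n x) = dim_vec (lam \<cdot>\<^sub>v vec n x)" using A by simp
      fix i assume "i < dim_vec (lam \<cdot>\<^sub>v vec n x)"
      then have i: "i < n" by simp
      have "(adj_mat G *\<^sub>v vec n x) $ i = (\<Sum>w\<in>nbrs (adjacent G) {..<n} i. vec n x $ w)"
        using i by (intro adj_mat_mult_vec G(2)) auto
      also have "\<dots> = (\<Sum>w\<in>nbrs (adjacent G) {..<n} i. x w)" by (rule sum.cong) auto
      finally show "(adj_mat G *\<^sub>v vec n x) $ i = (lam \<cdot>\<^sub>v vec n x) $ i" using x(2)[of i] i by simp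
    qed
    moreover have "vec n x \<noteq> 0\<^sub>v n"
    proof
      assume e: "vec n x = 0\<^sub>v n"
      obtain u where "u < n" "x u = 1" using x(1) by blast
      then show False using arg_cong[OF e, of "\<lambda>v. v $ u"] by simp
    qed
    ultimately have "eigenvector (adj_mat G) (vec n x) lam" using A unfolding eigenvector_def by auto
    then show ?thesis unfolding spectrum_def eigenvalue_def by blast
  qed
  fix \<mu> assume "\<mu> \<in> spectrum (adj_mat G)"
  then obtain v where v: "v \<in> carrier_vec n" "v \<noteq> 0\<^sub>v n" "adj_mat G *\<^sub>v v = \<mu> \<cdot>\<^sub>v v"
    using A unfolding spectrum_def eigenvalue_def eigenvector_def by auto
  define y where "y i = v $ i" for i
  have "quad {..<n} (adjacent G) y = (\<Sum>u<n. y u * (\<mu> * y u))"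
    unfolding quad_def
  proof (rule sum.cong[OF refl])
    fix u assume "u \<in> {..<n}"
    then have u: "u < n" by simp
    have "(\<Sum>w\<in>nbrs (adjacent G) {..<n} u. y w) = (adj_mat G *\<^sub>v v) $ u"
      unfolding y_def by (rule adj_mat_mult_vec[OF G(2) v(1) u, symmetric])
    also have "\<dots> = \<mu> * y u" unfolding v(3) y_def using u v(1) by simp
    finally show "y u * (\<Sum>w\<in>nbrs (adjacent G) {..<n} u. y w) = y u * (\<mu> * y u)" by simp
  qed
  also have "\<dots> = \<mu> * (\<Sum>u<n. (y u)\<^sup>2)" by (simp add: sum_distrib_left power2_eq_square mult_ac)
  finally have le: "\<mu> * (\<Sum>u<n. (y u)\<^sup>2) \<le> lam * (\<Sum>u<n. (y u)\<^sup>2)" using ray[of y] by simp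
  obtain i where i: "i < n" "v $ i \<noteq> 0" using v(1,2) by (metis carrier_vecD eq_vecI index_zero_vec(1) index_zero_vec(2))
  have "0 < (\<Sum>u<n. (y u)\<^sup>2)"
    by (rule sum_pos2[of _ i]) (use i in \<open>auto simp: y_def\<close>)
  then show "\<mu> \<le> lam" using le by simp
qed

section \<open>Translation between labelled graphs and relations\<close>

lemma verts_wheel: "verts (wheel t) = {..<t}"
  unfolding wheel_def by simp

lemma verts_path_graph: "verts (path_graph t) = {..<t}"
  unfolding path_graph_def by simp

lemma verts_induced: "verts (induced G S) = S"
  unfolding induced_def by simp

lemma contains_wheel_iff:
  assumes G: "simple_graph G" and k: "3 \<le> k"
  shows "contains_subgraph G (wheel (2 * k + 1)) \<longleftrightarrow> \<not> wheel_free k (adjacent G)"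
proof
  note rg = rel_graphD[OF rel_graph_adjacent[OF G]]
  assume "contains_subgraph G (wheel (2 * k + 1))"
  then obtain f where f: "inj_on f {..<2 * k + 1}" "\<And>e. e \<in> edges (wheel (2 * k + 1)) \<Longrightarrow> f ` e \<in> edges G"
    unfolding contains_subgraph_def verts_wheel by blast
  define c where "c = map f [1..<2 * k + 1]"
  have nth: "c ! i = f (i + 1)" if "i < 2 * k" for i using that unfolding c_def by (simp del: upt_Suc)
  have len: "length c = 2 * k" unfolding c_def by simp
  have hub: "adjacent G (f 0) (f i)" if "1 \<le> i" "i < 2 * k + 1" for i
    using f(2)[of "{0, i}"] that unfolding wheel_def adjacent_def by auto
  have rim: "adjacent G (f i) (f (Suc i))" if "1 \<le> i" "Suc i < 2 * k + 1" for i
    using f(2)[of "{i, Suc i}"] that unfolding wheel_def adjacent_def by auto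
  have close: "adjacent G (f (2 * k)) (f 1)"
    using f(2)[of "{2 * k + 1 - 1, 1}"] unfolding wheel_def adjacent_def by auto
  have "inj_on f {1..<2 * k + 1}" by (rule inj_on_subset[OF f(1)]) auto
  then have "distinct c" unfolding c_def distinct_map by (simp del: upt_Suc)
  moreover have "successively (adjacent G) c"
    unfolding successively_conv_nth using rim nth len by auto
  moreover have "adjacent G (last c) (hd c)"
  proof -
    have "c \<noteq> []" using len k by auto
    then show ?thesis using close nth len k by (simp add: last_conv_nth hd_conv_nth)
  qed
  moreover have "\<forall>v\<in>set c. adjacent G (f 0) v" unfolding c_def using hub by auto
  ultimately show "\<not> wheel_free k (adjacent G)" using len unfolding wheel_free_def cyc_def by blast
next
  note rg = rel_graphD[OF rel_graph_adjacent[OF G]]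
  assume "\<not> wheel_free k (adjacent G)"
  then obtain h c where c: "length c = 2 * k" "distinct c" "successively (adjacent G) c"
    "adjacent G (last c) (hd c)" "\<forall>v\<in>set c. adjacent G h v" unfolding wheel_free_def cyc_def by blast
  define f where "f i = (if i = 0 then h else c ! (i - 1))" for i
  have c0: "c \<noteq> []" using c(1) k by auto
  have hc: "h \<notin> set c" using c(5) rg(4) by blast
  have fc: "f i \<in> set c" if "1 \<le> i" "i < 2 * k + 1" for i using that c(1) unfolding f_def by auto
  have "inj_on f {..<2 * k + 1}"
  proof (rule inj_onI)
    fix i j assume ij: "i \<in> {..<2 * k + 1}" "j \<in> {..<2 * k + 1}" "f i = f j"
    consider "i = 0" "j = 0" | "i = 0" "1 \<le> j" | "1 \<le> i" "j = 0" | "1 \<le> i" "1 \<le> j" by linarith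
    then show "i = j"
    proof cases
      case 2 then show ?thesis using fc[of j] ij hc unfolding f_def by auto
    next
      case 3 then show ?thesis using fc[of i] ij hc unfolding f_def by auto
    next
      case 4
      then have "c ! (i - 1) = c ! (j - 1)" "i - 1 < length c" "j - 1 < length c"
        using ij c(1) unfolding f_def by auto
      then have "i - 1 = j - 1" using c(2) nth_eq_iff_index_eq by blast
      then show ?thesis using 4 by linarith
    qed simp
  qed
  moreover have "f i \<in> verts G" if "i < 2 * k + 1" for i
  proof (cases "i = 0")
    case True
    then show ?thesis using c(5) c0 rg(2)[of h "hd c"] unfolding f_def by simp
  next
    case False
    then show ?thesis using fc[of i] that c(5) rg(3)[of h "f i"] by simp
  qed
  moreover have "f ` e \<in> edges G" if eW: "e \<in> edges (wheel (2 * k + 1))" for e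
  proof -
    consider i where "e = {0, i}" "1 \<le> i" "i < 2 * k + 1" | i where "e = {i, Suc i}" "1 \<le> i" "Suc i < 2 * k + 1"
      | "e = {2 * k, 1}" using eW unfolding wheel_def by auto
    then show ?thesis
    proof cases
      case 1
      then have "adjacent G h (f i)" using c(5) fc by blast
      then show ?thesis using 1 unfolding adjacent_def f_def by (simp add: insert_commute)
    next
      case 2
      then have "adjacent G (c ! (i - 1)) (c ! Suc (i - 1))" using successively_nth[OF c(3), of "i - 1"] c(1) by simp
      then show ?thesis using 2 unfolding adjacent_def f_def by simp
    next
      case 3
      have "adjacent G (c ! (2 * k - 1)) (c ! 0)" using c(1,4) c0 by (simp add: last_conv_nth hd_conv_nth)
      then show ?thesis using 3 k unfolding adjacent_def f_def by simp
    qed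
  qed
  ultimately show "contains_subgraph G (wheel (2 * k + 1))"
    unfolding contains_subgraph_def by (intro exI[of _ f]) (auto simp: wheel_def)
qed

definition graph_of :: "'a set \<Rightarrow> ('a \<Rightarrow> 'a \<Rightarrow> bool) \<Rightarrow> 'a sgraph" where
  "graph_of V H = \<lparr>verts = V, edges = {{u, v} | u v. H u v}\<rparr>"

lemma graph_of:
  assumes "rel_graph V H"
  shows "simple_graph (graph_of V H)" "verts (graph_of V H) = V" "adjacent (graph_of V H) = H"
proof -
  note r = rel_graphD[OF assms]
  show "simple_graph (graph_of V H)"
    unfolding simple_graph_def graph_of_def using r by (auto simp: card_insert_if)
  show "verts (graph_of V H) = V" unfolding graph_of_def by simp
  show "adjacent (graph_of V H) = H"
    unfolding adjacent_def graph_of_def using r(5) by (auto simp: doubleton_eq_iff fun_eq_iff)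
qed

text \<open>A competing relation is turned into a labelled graph to compare \<open>lambda1\<close>;
  the Rayleigh bound of the competitor with its own eigenvalue \<open>mu\<close> then holds with
  \<open>lam\<close> as well.\<close>

lemma SPEX_extremal:
  assumes G: "G \<in> SPEX n (wheel (2 * k + 1))" and k: "3 \<le> k" and n: "0 < n"
  shows "\<exists>lam x. extremal k {..<n} (adjacent G) lam x"
proof -
  have G1: "simple_graph G" "verts G = {..<n}" "\<not> contains_subgraph G (wheel (2 * k + 1))"
    and Gmax: "\<And>H. H \<in> free_graphs n (wheel (2 * k + 1)) \<Longrightarrow> lambda1 H \<le> lambda1 G"
    using G unfolding SPEX_def free_graphs_def by auto
  have rg: "rel_graph {..<n} (adjacent G)" using rel_graph_adjacent[OF G1(1)] G1(2) by simp
  have ne: "{..<n} \<noteq> {}" using n by auto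
  obtain lam x where P: "\<forall>v\<in>{..<n}. 0 \<le> x v \<and> x v \<le> 1" "\<exists>u\<in>{..<n}. x u = 1"
    "\<forall>v\<in>{..<n}. (\<Sum>w\<in>nbrs (adjacent G) {..<n} v. x w) = lam * x v"
    "\<forall>y. quad {..<n} (adjacent G) y \<le> lam * (\<Sum>v<n. (y v)\<^sup>2)"
    using perron_vector[OF rg ne] by blast
  have lamG: "lambda1 G = lam" by (rule lambda1_eqI[OF G1(1,2) P(2)]) (use P in auto)
  have "extremal k {..<n} (adjacent G) lam x"
  proof
    show "wheel_free k (adjacent G)" using G1(3) contains_wheel_iff[OF G1(1) k] by simp
    fix H y assume H: "rel_graph {..<n} H" "wheel_free k H"
    obtain mu z where Q: "\<exists>u\<in>{..<n}. z u = 1" "\<forall>v\<in>{..<n}. (\<Sum>w\<in>nbrs H {..<n} v. z w) = mu * z v"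
      "\<forall>y. quad {..<n} H y \<le> mu * (\<Sum>v<n. (y v)\<^sup>2)"
      using perron_vector[OF H(1) ne] by blast
    let ?H = "graph_of {..<n} H"
    note gH = graph_of[OF H(1)]
    have "lambda1 ?H = mu" by (rule lambda1_eqI[OF gH(1,2) Q(1)]) (use Q gH(3) in auto)
    moreover have "?H \<in> free_graphs n (wheel (2 * k + 1))"
      unfolding free_graphs_def using gH contains_wheel_iff[OF gH(1) k] H(2) by simp
    ultimately have "mu \<le> lam" using Gmax lamG by force
    then have "mu * (\<Sum>v<n. (y v)\<^sup>2) \<le> lam * (\<Sum>v<n. (y v)\<^sup>2)" by (intro mult_right_mono sum_nonneg) auto
    then show "quad {..<n} H y \<le> lam * (\<Sum>v<n. (y v)\<^sup>2)" using Q(3) by (meson order_trans)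
  qed (use k rg P in auto)
  then show ?thesis by blast
qed

text \<open>Since no degree exceeds \<open>k - 1\<close>, a total shortfall of 1 can only be one
  vertex of degree \<open>k - 2\<close>.\<close>

lemma induced_U_family:
  assumes G: "simple_graph G" and L: "L \<subseteq> verts G" and k: "3 \<le> k"
    and deg: "\<And>v. v \<in> L \<Longrightarrow> card (nbrs (adjacent G) L v) \<le> k - 1"
    and sum: "(k - 1) * card L \<le> (\<Sum>v\<in>L. card (nbrs (adjacent G) L v)) + 1"
    and path: "\<not> (\<exists>p. distinct p \<and> length p = 2 * k - 1 \<and> set p \<subseteq> L \<and> successively (adjacent G) p)"
  shows "induced G L \<in> U_family k (card L)"
proof -
  let ?d = "\<lambda>v. card (nbrs (adjacent G) L v)"
  have fL: "finite L" using G L finite_subset unfolding simple_graph_def by blast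
  have sg: "simple_graph (induced G L)" using G fL unfolding simple_graph_def induced_def by auto
  have vd: "vdegree (induced G L) v = ?d v" if "v \<in> L" for v
    unfolding vdegree_def nbrs_def induced_def adjacent_def using that by (intro arg_cong[where f = card]) auto
  have "regular_graph (k - 1) (induced G L) \<or> nearly_regular (k - 1) (induced G L)"
  proof (cases "\<exists>w\<in>L. ?d w \<noteq> k - 1")
    case False
    then show ?thesis using vd unfolding regular_graph_def by (simp add: induced_def)
  next
    case True
    then obtain w where w: "w \<in> L" "?d w < k - 1" using deg by (metis le_neq_implies_less)
    have "(\<Sum>v\<in>L. ?d v) = ?d w + (\<Sum>v\<in>L - {w}. ?d v)" using fL w by (simp add: sum.remove)
    moreover have "(k - 1) * card L = (k - 1) + (k - 1) * card (L - {w})"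
      using fL w card_Suc_Diff1[OF fL w(1)] by (metis mult_Suc_right)
    ultimately have le: "(k - 1) + (k - 1) * card (L - {w}) \<le> ?d w + (\<Sum>v\<in>L - {w}. ?d v) + 1" using sum by simp
    have "(\<Sum>v\<in>L - {w}. ?d v) \<le> (\<Sum>v\<in>L - {w}. k - 1)" by (rule sum_mono) (use deg in auto)
    then have le2: "(\<Sum>v\<in>L - {w}. ?d v) \<le> (k - 1) * card (L - {w})" by (simp add: mult.commute)
    have dw: "?d w = k - 1 - 1" using le le2 w(2) by linarith
    have "?d v = k - 1" if v: "v \<in> L - {w}" for v
    proof (rule ccontr)
      assume "?d v \<noteq> k - 1"
      then have "?d v < k - 1" using deg[of v] v by simp
      then have "(\<Sum>v\<in>L - {w}. ?d v) < (\<Sum>v\<in>L - {w}. k - 1)"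
        using fL v deg by (intro sum_strict_mono_ex1) auto
      then have "(\<Sum>v\<in>L - {w}. ?d v) < (k - 1) * card (L - {w})" by (simp add: mult.commute)
      then show False using le w(2) by linarith
    qed
    then have "nearly_regular (k - 1) (induced G L)"
      unfolding nearly_regular_def using w(1) vd dw by (intro bexI[of _ w]) (auto simp: induced_def)
    then show ?thesis by blast
  qed
  moreover have "\<not> contains_subgraph (induced G L) (path_graph (2 * k - 1))"
  proof
    assume "contains_subgraph (induced G L) (path_graph (2 * k - 1))"
    then obtain f where f: "inj_on f {..<2 * k - 1}" "f ` {..<2 * k - 1} \<subseteq> L"
      "\<And>e. e \<in> edges (path_graph (2 * k - 1)) \<Longrightarrow> f ` e \<in> edges (induced G L)"
      unfolding contains_subgraph_def verts_path_graph verts_induced by blast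
    define p where "p = map f [0..<2 * k - 1]"
    have "adjacent G (f i) (f (Suc i))" if "Suc i < 2 * k - 1" for i
      using f(3)[of "{i, Suc i}"] that unfolding path_graph_def adjacent_def induced_def by auto
    then have "successively (adjacent G) p" unfolding p_def successively_conv_nth by simp
    moreover have "distinct p" unfolding p_def using f(1) by (simp add: distinct_map lessThan_atLeast0)
    moreover have "set p \<subseteq> L" unfolding p_def using f(2) by (auto simp: lessThan_atLeast0)
    moreover have "length p = 2 * k - 1" unfolding p_def by simp
    ultimately show False using path by blast
  qed
  ultimately show ?thesis unfolding U_family_def using sg by (simp add: induced_def)
qed

lemma card_edges_induced_1:
  assumes G: "simple_graph G" and R: "R \<subseteq> verts G"
    and sum: "(\<Sum>v\<in>R. card (nbrs (adjacent G) R v)) = 2"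
  shows "card (edges (induced G R)) = 1"
proof -
  let ?N = "nbrs (adjacent G) R"
  note rg = rel_graphD[OF rel_graph_adjacent[OF G]]
  have fR: "finite R" using rg(1) R finite_subset by blast
  have "\<exists>a\<in>R. ?N a \<noteq> {}"
  proof (rule ccontr)
    assume "\<not> ?thesis"
    then have "(\<Sum>v\<in>R. card (?N v)) = 0" by simp
    then show False using sum by simp
  qed
  then obtain a b where ab: "a \<in> R" "b \<in> R" "adjacent G a b" by auto
  have ba: "adjacent G b a" "a \<noteq> b" using ab rg(4,5) by blast+
  have "1 \<le> card (?N a)" "1 \<le> card (?N b)" using ab ba fR by (auto simp: Suc_le_eq card_gt_0_iff)
  moreover have "(\<Sum>v\<in>R. card (?N v)) = card (?N a) + (card (?N b) + (\<Sum>v\<in>R - {a} - {b}. card (?N v)))"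
    using sum.remove[OF fR ab(1), of "\<lambda>v. card (?N v)"] sum.remove[of "R - {a}" b "\<lambda>v. card (?N v)"] fR ab ba by simp
  ultimately have one: "card (?N a) = 1" "card (?N b) = 1" "(\<Sum>v\<in>R - {a} - {b}. card (?N v)) = 0" using sum by linarith+
  have Na: "?N a = {b}" using one(1) ab by (metis card_1_singletonE in_nbrs singletonD)
  have Nb: "?N b = {a}" using one(2) ab ba by (metis card_1_singletonE in_nbrs singletonD)
  have No: "?N v = {}" if "v \<in> R" "v \<noteq> a" "v \<noteq> b" for v using one(3) that fR by simp
  have "edges (induced G R) = {{a, b}}"
  proof
    show "{{a, b}} \<subseteq> edges (induced G R)" using ab unfolding induced_def adjacent_def by simp
    show "edges (induced G R) \<subseteq> {{a, b}}"
    proof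
      fix e assume "e \<in> edges (induced G R)"
      then have e: "e \<in> edges G" "e \<subseteq> R" unfolding induced_def by auto
      then have "card e = 2" using G unfolding simple_graph_def by blast
      then obtain u v where uv: "e = {u, v}" "u \<noteq> v" by (meson card_2_iff)
      then have "v \<in> ?N u" using e unfolding adjacent_def by auto
      then show "e \<in> {{a, b}}" using Na Nb No[of u] uv e by (cases "u = a"; cases "u = b") auto
    qed
  qed
  then show ?thesis by simp
qed

theorem theorem4:
  fixes k :: nat
  assumes "k \<ge> 3" and "k \<notin> {4, 5}"
  shows "\<exists>N. \<forall>n\<ge>N. \<forall>G\<in>SPEX n (wheel (2 * k + 1)).
    \<exists>L R. \<exists>s::real.
      L \<union> R = verts G \<and> L \<inter> R = {} \<and>
      real (card L) = real n / 2 + s \<and> real (card R) = real n / 2 - s \<and> \<bar>s\<bar> \<le> 1 \<and>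
      (\<forall>u\<in>L. \<forall>v\<in>R. adjacent G u v) \<and>
      induced G L \<in> U_family k (card L) \<and>
      card (edges (induced G R)) = 1"
proof -
  obtain N where N: "\<forall>(V::nat set) E lam x. N \<le> card V \<longrightarrow> extremal k V E lam x \<longrightarrow> (\<exists>L R. good_split k V E L R)"
    using extremal_structure[of k, where 'a = nat] assms by auto
  show ?thesis
  proof (intro exI[of _ "N + 1"] allI impI ballI)
    fix n G assume n: "N + 1 \<le> n" and G: "G \<in> SPEX n (wheel (2 * k + 1))"
    have Gs: "simple_graph G" "verts G = {..<n}" using G unfolding SPEX_def free_graphs_def by auto
    obtain lam x where "extremal k {..<n} (adjacent G) lam x"
      using SPEX_extremal[OF G assms(1)] n by auto
    moreover have "N \<le> card {..<n}" using n by simp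
    ultimately obtain L R where "good_split k {..<n} (adjacent G) L R" using N by blast
    then have LR: "L \<union> R = verts G" "L \<inter> R = {}" "card L \<le> card R + 2" "card R \<le> card L + 2"
      "\<forall>u\<in>L. \<forall>v\<in>R. adjacent G u v" "\<And>v. v \<in> L \<Longrightarrow> card (nbrs (adjacent G) L v) \<le> k - 1"
      "(k - 1) * card L \<le> (\<Sum>v\<in>L. card (nbrs (adjacent G) L v)) + 1"
      "\<not> (\<exists>p. distinct p \<and> length p = 2 * k - 1 \<and> set p \<subseteq> L \<and> successively (adjacent G) p)"
      "(\<Sum>v\<in>R. card (nbrs (adjacent G) R v)) = 2"
      unfolding good_split_def Gs(2) by blast+
    define s where "s = real (card L) - real n / 2"
    have "finite L" "finite R" using LR(1) Gs by (metis finite_Un finite_lessThan)+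
    then have "card L + card R = n" using card_Un_disjoint[of L R] LR(1,2) Gs(2) by simp
    then have "real (card L) + real (card R) = real n" by (simp flip: of_nat_add)
    \<comment> \<open>\<open>s\<close> is half the difference of the part sizes, which is at most
      2.\<close>
    then have s: "real (card L) = real n / 2 + s" "real (card R) = real n / 2 - s" "\<bar>s\<bar> \<le> 1"
      using LR(3,4) unfolding s_def by linarith+
    have U: "induced G L \<in> U_family k (card L)"
      by (rule induced_U_family[OF Gs(1) _ assms(1) LR(6-8)]) (use LR(1) in auto)
    have e: "card (edges (induced G R)) = 1"
      by (rule card_edges_induced_1[OF Gs(1) _ LR(9)]) (use LR(1) in auto)
    show "\<exists>L R. \<exists>s::real.
      L \<union> R = verts G \<and> L \<inter> R = {} \<and>
      real (card L) = real n / 2 + s \<and> real (card R) = real n / 2 - s \<and> \<bar>s\<bar> \<le> 1 \<and>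
      (\<forall>u\<in>L. \<forall>v\<in>R. adjacent G u v) \<and>
      induced G L \<in> U_family k (card L) \<and>
      card (edges (induced G R)) = 1"
      by (intro exI[of _ L] exI[of _ R] exI[of _ s] conjI LR(1,2,5) s U e)
  qed
qed

end
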